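(* Let $p > 3$ be a prime such that $p\equiv 1 \bmod 8$ or $p\equiv 3\bmod 8$. Then there is a Latin square $\mathscr{L}_p$ of order $p$ with $\nu(\mathscr{L}_p)=4$.
   Context: A Latin square of order $n$ is an $n\times n$ matrix on a set of $n$ symbols such that each symbol occurs exactly once in each row and each column. Rows, columns and symbols are all indexed by the same $n$-element set $S$, and $L$ is identified with its set of triples $(i,j,L_{i,j})\in S^3$. For each of the six permutations of the three coordinates, applying that permutation uniformly to all triples of $L$ gives the set of triples of another Latin square, called a conjugate of $L$; thus $L$ has six conjugates, labelled by permutations (and counted with this labelling, even if some of them coincide as squares). For two distinct rows $i,j$ of a Latin square $L$ with symbol set $S$, the row permutation $r_{i,j}:S\to S$ is defined by $r_{i,j}(L_{i,k})=L_{j,k}$ for every column $k$. $L$ is row-Hamiltonian if every row permutation (over all pairs of distinct rows) consists of a single cycle of length $n$. $\nu(L)$ denotes the number of the six conjugates of $L$ that are row-Hamiltonian. *)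

theory Defs
  imports "HOL-Combinatorics.Combinatorics" "HOL-Computational_Algebra.Primes"
begin

text \<open>Rows, columns and symbols of a Latin square are all indexed by the same finite set \<open>S\<close>;
  its order is \<open>card S\<close>. Only the values of \<open>L\<close> on \<open>S \<times> S\<close> matter.\<close>

definition latin_square :: "'a set \<Rightarrow> ('a \<Rightarrow> 'a \<Rightarrow> 'a) \<Rightarrow> bool" where
  "latin_square S L \<longleftrightarrow>
     finite S \<and>
     (\<forall>i\<in>S. \<forall>j\<in>S. L i j \<in> S) \<and>
     (\<forall>i\<in>S. \<forall>x\<in>S. \<exists>!j. j \<in> S \<and> L i j = x) \<and>
     (\<forall>j\<in>S. \<forall>x\<in>S. \<exists>!i. i \<in> S \<and> L i j = x)"

text \<open>Triples are represented as lists of length 3, so that a permutation of the coordinates acts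
  on them by \<^const>\<open>permute_list\<close>.\<close>

definition triples :: "'a set \<Rightarrow> ('a \<Rightarrow> 'a \<Rightarrow> 'a) \<Rightarrow> 'a list set" where
  "triples S L = {[i, j, L i j] | i j. i \<in> S \<and> j \<in> S}"

text \<open>The conjugate labelled by a permutation \<open>\<sigma>\<close> of the coordinates \<open>{0, 1, 2}\<close>, as a matrix. It is
  the Latin square whose set of triples is obtained by permuting coordinates; see the lemmas
  \<open>latin_square_conjugate\<close> and \<open>triples_conjugate\<close> below.\<close>

definition conjugate :: "'a set \<Rightarrow> ('a \<Rightarrow> 'a \<Rightarrow> 'a) \<Rightarrow> (nat \<Rightarrow> nat) \<Rightarrow> 'a \<Rightarrow> 'a \<Rightarrow> 'a" where
  "conjugate S L \<sigma> = (\<lambda>i j. THE k. [i, j, k] \<in> permute_list \<sigma> ` triples S L)"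

text \<open>\<open>row_perm S L i j\<close> maps \<open>L i k\<close> to \<open>L j k\<close>. It is extended by the identity outside \<open>S\<close>.\<close>

definition row_perm :: "'a set \<Rightarrow> ('a \<Rightarrow> 'a \<Rightarrow> 'a) \<Rightarrow> 'a \<Rightarrow> 'a \<Rightarrow> 'a \<Rightarrow> 'a" where
  "row_perm S L i j = (\<lambda>x. if x \<in> S then L j (THE k. k \<in> S \<and> L i k = x) else x)"

text \<open>\<^term>\<open>cyclic_on f S\<close> says that \<open>S\<close> is a single orbit of \<open>f\<close>, i.e. for a permutation \<open>f\<close> of a
  finite set \<open>S\<close>, that \<open>f\<close> is a single cycle of length \<open>card S\<close>.\<close>

definition row_hamiltonian :: "'a set \<Rightarrow> ('a \<Rightarrow> 'a \<Rightarrow> 'a) \<Rightarrow> bool" where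
  "row_hamiltonian S L \<longleftrightarrow> (\<forall>i\<in>S. \<forall>j\<in>S. i \<noteq> j \<longrightarrow> cyclic_on (row_perm S L i j) S)"

text \<open>Conjugates are counted with their labels, even if some of them coincide as squares.\<close>

definition \<nu> :: "'a set \<Rightarrow> ('a \<Rightarrow> 'a \<Rightarrow> 'a) \<Rightarrow> nat" where
  "\<nu> S L = card {\<sigma>. \<sigma> permutes {..<3} \<and> row_hamiltonian S (conjugate S L \<sigma>)}"

lemma latin_squareD:
  assumes "latin_square S L"
  shows "finite S"
    and "i \<in> S \<Longrightarrow> j \<in> S \<Longrightarrow> L i j \<in> S"
    and "i \<in> S \<Longrightarrow> x \<in> S \<Longrightarrow> \<exists>!j. j \<in> S \<and> L i j = x"
    and "j \<in> S \<Longrightarrow> x \<in> S \<Longrightarrow> \<exists>!i. i \<in> S \<and> L i j = x"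
  using assms by (simp_all add: latin_square_def)

lemma row_perm_apply:
  assumes "latin_square S L" "i \<in> S" "k \<in> S"
  shows "row_perm S L i j (L i k) = L j k"
proof -
  have in_S: "L i k \<in> S" and ex1: "\<exists>!k'. k' \<in> S \<and> L i k' = L i k"
    using latin_squareD(2,3)[OF assms(1)] assms by simp_all
  have "(THE k'. k' \<in> S \<and> L i k' = L i k) = k"
    using ex1 assms(3) by (intro the1_equality) auto
  with in_S show ?thesis
    by (simp add: row_perm_def)
qed

lemma row_perm_permutes:
  assumes "latin_square S L" "i \<in> S" "j \<in> S"
  shows "row_perm S L i j permutes S"
proof (rule bij_imp_permutes)
  have surj: "x \<in> row_perm S L i j ` S" if x: "x \<in> S" for x
  proof -
    obtain k where k: "k \<in> S" "L j k = x"
      using latin_squareD(3)[OF assms(1,3) x] by blast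
    show ?thesis
    proof (rule image_eqI)
      show "x = row_perm S L i j (L i k)"
        using row_perm_apply[OF assms(1,2) k(1)] k(2) by simp
      show "L i k \<in> S"
        by (rule latin_squareD(2)[OF assms(1,2) k(1)])
    qed
  qed
  have into: "row_perm S L i j x \<in> S" if x: "x \<in> S" for x
  proof -
    obtain k where k: "k \<in> S" "L i k = x"
      using latin_squareD(3)[OF assms(1,2) x] by blast
    then have "row_perm S L i j x = L j k"
      using row_perm_apply[OF assms(1,2) k(1)] by simp
    then show ?thesis
      using latin_squareD(2)[OF assms(1,3) k(1)] by simp
  qed
  have "row_perm S L i j ` S = S"
    using surj into by auto
  moreover have "finite S"
    by (rule latin_squareD(1)[OF assms(1)])
  ultimately show "bij_betw (row_perm S L i j) S S"
    by (simp add: bij_betw_def finite_surj_inj)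
next
  show "row_perm S L i j x = x" if "x \<notin> S" for x
    using that by (simp add: row_perm_def)
qed

lemma all_less_3: "(\<forall>b<3. P b) \<longleftrightarrow> P 0 \<and> P 1 \<and> P 2" for P :: "nat \<Rightarrow> bool"
  by (auto simp: less_Suc_eq numeral_3_eq_3 numeral_2_eq_2)

lemma triples_ex1:
  assumes L: "latin_square S L" and a: "a < 3" and f: "\<And>b. b < 3 \<Longrightarrow> f b \<in> S"
  shows "\<exists>!t. t \<in> triples S L \<and> (\<forall>b<3. b \<noteq> a \<longrightarrow> t ! b = f b)"
proof -
  have fS: "f 0 \<in> S" "f 1 \<in> S" "f 2 \<in> S" using f by auto
  consider "a = 0" | "a = 1" | "a = 2" using a by linarith
  then show ?thesis
  proof cases
    case 1
    obtain i where i: "i \<in> S" "L i (f 1) = f 2"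
      and uniq: "\<And>i'. i' \<in> S \<Longrightarrow> L i' (f 1) = f 2 \<Longrightarrow> i' = i"
      using latin_squareD(4)[OF L fS(2,3)] by blast
    show ?thesis
    proof (rule ex1I[of _ "[i, f 1, f 2]"])
      show "[i, f 1, f 2] \<in> triples S L \<and> (\<forall>b<3. b \<noteq> a \<longrightarrow> [i, f 1, f 2] ! b = f b)"
        using i fS 1 by (simp add: all_less_3 triples_def)
    next
      fix t assume "t \<in> triples S L \<and> (\<forall>b<3. b \<noteq> a \<longrightarrow> t ! b = f b)"
      then obtain i' where "i' \<in> S" "t = [i', f 1, L i' (f 1)]" "L i' (f 1) = f 2"
        using 1 by (auto simp add: all_less_3 triples_def)
      then show "t = [i, f 1, f 2]" using uniq[of i'] by simp
    qed
  next
    case 2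
    obtain j where j: "j \<in> S" "L (f 0) j = f 2"
      and uniq: "\<And>j'. j' \<in> S \<Longrightarrow> L (f 0) j' = f 2 \<Longrightarrow> j' = j"
      using latin_squareD(3)[OF L fS(1,3)] by blast
    show ?thesis
    proof (rule ex1I[of _ "[f 0, j, f 2]"])
      show "[f 0, j, f 2] \<in> triples S L \<and> (\<forall>b<3. b \<noteq> a \<longrightarrow> [f 0, j, f 2] ! b = f b)"
        using j fS 2 by (simp add: all_less_3 triples_def)
    next
      fix t assume "t \<in> triples S L \<and> (\<forall>b<3. b \<noteq> a \<longrightarrow> t ! b = f b)"
      then obtain j' where "j' \<in> S" "t = [f 0, j', L (f 0) j']" "L (f 0) j' = f 2"
        using 2 by (auto simp add: all_less_3 triples_def)
      then show "t = [f 0, j, f 2]" using uniq[of j'] by simp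
    qed
  next
    case 3
    then show ?thesis using fS
      by (intro ex1I[of _ "[f 0, f 1, L (f 0) (f 1)]"]) (auto simp: all_less_3 triples_def)
  qed
qed

lemma permuted_triples_ex1:
  assumes L: "latin_square S L" and \<sigma>: "\<sigma> permutes {..<3}"
    and a: "a < 3" and f: "\<And>b. b < 3 \<Longrightarrow> f b \<in> S"
  shows "\<exists>!t. t \<in> permute_list \<sigma> ` triples S L \<and> (\<forall>b<3. b \<noteq> a \<longrightarrow> t ! b = f b)"
proof -
  let ?\<tau> = "inv \<sigma>"
  have lt: "\<sigma> b < 3" if "b < 3" for b using permutes_in_image[OF \<sigma>, of b] that by simp
  have lt': "?\<tau> b < 3" if "b < 3" for b
    using permutes_in_image[OF permutes_inv[OF \<sigma>], of b] that by simp
  have inv: "?\<tau> (\<sigma> b) = b" "\<sigma> (?\<tau> b) = b" for b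
    using permutes_inverses[OF \<sigma>] by auto
  have nth: "permute_list \<sigma> t ! b = t ! \<sigma> b" if "t \<in> triples S L" "b < 3" for t b
  proof -
    have "length t = 3" using that by (auto simp: triples_def)
    then show ?thesis using permute_list_nth[of \<sigma> t b] \<sigma> that by simp
  qed
  have iff: "(\<forall>b<3. b \<noteq> a \<longrightarrow> permute_list \<sigma> t ! b = f b) \<longleftrightarrow>
      (\<forall>b<3. b \<noteq> \<sigma> a \<longrightarrow> t ! b = f (?\<tau> b))" if "t \<in> triples S L" for t
    using nth[OF that] lt lt' inv by metis
  have "\<exists>!t. t \<in> triples S L \<and> (\<forall>b<3. b \<noteq> \<sigma> a \<longrightarrow> t ! b = f (?\<tau> b))"
    by (rule triples_ex1[OF L]) (use lt lt' a f in auto)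
  then obtain t where t: "t \<in> triples S L" "\<forall>b<3. b \<noteq> \<sigma> a \<longrightarrow> t ! b = f (?\<tau> b)"
    and uniq: "\<And>u. u \<in> triples S L \<Longrightarrow> \<forall>b<3. b \<noteq> \<sigma> a \<longrightarrow> u ! b = f (?\<tau> b) \<Longrightarrow> u = t"
    by (elim ex1E) blast
  show ?thesis
  proof (rule ex1I[of _ "permute_list \<sigma> t"])
    show "permute_list \<sigma> t \<in> permute_list \<sigma> ` triples S L \<and>
        (\<forall>b<3. b \<noteq> a \<longrightarrow> permute_list \<sigma> t ! b = f b)"
      using t(2) iff[OF t(1)] by (intro conjI imageI t(1)) (rule iffD2)
  next
    fix v assume v: "v \<in> permute_list \<sigma> ` triples S L \<and> (\<forall>b<3. b \<noteq> a \<longrightarrow> v ! b = f b)"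
    then obtain u where u: "u \<in> triples S L" "v = permute_list \<sigma> u" by (elim conjE imageE)
    have "u = t"
      by (rule uniq[OF u(1) iffD1[OF iff[OF u(1)]]]) (use v u(2) in simp)
    with u(2) show "v = permute_list \<sigma> t" by simp
  qed
qed

lemma permuted_triples_form:
  assumes L: "latin_square S L" and \<sigma>: "\<sigma> permutes {..<3}" and t: "t \<in> permute_list \<sigma> ` triples S L"
  obtains i j k where "t = [i, j, k]" "i \<in> S" "j \<in> S" "k \<in> S"
proof -
  obtain u where u: "u \<in> triples S L" "t = permute_list \<sigma> u" using t by auto
  have "set u \<subseteq> S" "length u = 3" using u L by (auto simp: triples_def latin_square_def)
  then have "set t \<subseteq> S" "length t = 3" using u \<sigma> by auto
  then show ?thesis using that by (auto simp: length_Suc_conv numeral_3_eq_3)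
qed

lemma permuted_triples_iff:
  assumes L: "latin_square S L" and \<sigma>: "\<sigma> permutes {..<3}" and ij: "i \<in> S" "j \<in> S"
  shows "[i, j, k] \<in> permute_list \<sigma> ` triples S L \<longleftrightarrow> k = conjugate S L \<sigma> i j"
proof -
  have "\<exists>!t. t \<in> permute_list \<sigma> ` triples S L \<and> t ! 0 = i \<and> t ! 1 = j"
    using permuted_triples_ex1[OF L \<sigma>, of 2 "\<lambda>b. if b = 0 then i else j"] ij
    by (simp add: all_less_3)
  then obtain t where t: "t \<in> permute_list \<sigma> ` triples S L" "t ! 0 = i" "t ! 1 = j"
    and uniq: "\<And>u. u \<in> permute_list \<sigma> ` triples S L \<Longrightarrow> u ! 0 = i \<Longrightarrow> u ! 1 = j \<Longrightarrow> u = t"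
    by blast
  obtain k' where k': "t = [i, j, k']"
    using permuted_triples_form[OF L \<sigma> t(1)] t by (metis One_nat_def nth_Cons_0 nth_Cons_Suc)
  have *: "[i, j, k] \<in> permute_list \<sigma> ` triples S L \<longleftrightarrow> k = k'" for k
    using t(1) k' uniq[of "[i, j, k]"] by auto
  then show ?thesis by (simp add: conjugate_def)
qed

lemma triples_conjugate:
  assumes "latin_square S L" "\<sigma> permutes {..<3}"
  shows "triples S (conjugate S L \<sigma>) = permute_list \<sigma> ` triples S L"
proof (intro equalityI subsetI)
  fix t assume "t \<in> triples S (conjugate S L \<sigma>)"
  then show "t \<in> permute_list \<sigma> ` triples S L"
    using permuted_triples_iff[OF assms] by (auto simp: triples_def[of S "conjugate S L \<sigma>"])
next
  fix t assume t: "t \<in> permute_list \<sigma> ` triples S L"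
  then obtain i j k where "t = [i, j, k]" "i \<in> S" "j \<in> S"
    using permuted_triples_form[OF assms] by metis
  then show "t \<in> triples S (conjugate S L \<sigma>)"
    using permuted_triples_iff[OF assms] t by (auto simp: triples_def[of S "conjugate S L \<sigma>"])
qed

lemma latin_square_conjugate:
  assumes L: "latin_square S L" and \<sigma>: "\<sigma> permutes {..<3}"
  shows "latin_square S (conjugate S L \<sigma>)"
proof -
  let ?T = "permute_list \<sigma> ` triples S L" and ?C = "conjugate S L \<sigma>"
  have mem: "[i, j, ?C i j] \<in> ?T" if "i \<in> S" "j \<in> S" for i j
    using permuted_triples_iff[OF L \<sigma> that] by simp
  have "?C i j \<in> S" if "i \<in> S" "j \<in> S" for i j
    using permuted_triples_form[OF L \<sigma> mem[OF that]] by auto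
  moreover have "\<exists>!j. j \<in> S \<and> ?C i j = x" if "i \<in> S" "x \<in> S" for i x
  proof -
    have ex1: "\<exists>!t. t \<in> ?T \<and> t ! 0 = i \<and> t ! 2 = x"
      using permuted_triples_ex1[OF L \<sigma>, of 1 "\<lambda>b. if b = 0 then i else x"] that
      by (simp add: all_less_3)
    then obtain t where t: "t \<in> ?T" "t ! 0 = i" "t ! 2 = x"
      and uniq: "\<And>u. u \<in> ?T \<Longrightarrow> u ! 0 = i \<Longrightarrow> u ! 2 = x \<Longrightarrow> u = t" by blast
    obtain i' j k where "t = [i', j, k]" and j: "j \<in> S"
      by (rule permuted_triples_form[OF L \<sigma> t(1)])
    with t have t_eq: "t = [i, j, x]" by simp
    show ?thesis
    proof (rule ex1I[of _ j])
      show "j \<in> S \<and> ?C i j = x"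
        using permuted_triples_iff[OF L \<sigma> that(1) j, of x] j t(1) t_eq by simp
    next
      fix j' assume "j' \<in> S \<and> ?C i j' = x"
      then have "[i, j', x] \<in> ?T" using mem[of i j'] that by simp
      then have "[i, j', x] = t" using uniq by simp
      then show "j' = j" using t_eq by simp
    qed
  qed
  moreover have "\<exists>!i. i \<in> S \<and> ?C i j = x" if "j \<in> S" "x \<in> S" for j x
  proof -
    have ex1: "\<exists>!t. t \<in> ?T \<and> t ! 1 = j \<and> t ! 2 = x"
      using permuted_triples_ex1[OF L \<sigma>, of 0 "\<lambda>b. if b = 1 then j else x"] that
      by (simp add: all_less_3)
    then obtain t where t: "t \<in> ?T" "t ! 1 = j" "t ! 2 = x"
      and uniq: "\<And>u. u \<in> ?T \<Longrightarrow> u ! 1 = j \<Longrightarrow> u ! 2 = x \<Longrightarrow> u = t" by blast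
    obtain i j' k where "t = [i, j', k]" and i: "i \<in> S"
      by (rule permuted_triples_form[OF L \<sigma> t(1)])
    with t have t_eq: "t = [i, j, x]" by simp
    show ?thesis
    proof (rule ex1I[of _ i])
      show "i \<in> S \<and> ?C i j = x"
        using permuted_triples_iff[OF L \<sigma> i that(1), of x] i t(1) t_eq by simp
    next
      fix i' assume "i' \<in> S \<and> ?C i' j = x"
      then have "[i', j, x] \<in> ?T" using mem[of i' j] that by simp
      then have "[i', j, x] = t" using uniq by simp
      then show "i' = i" using t_eq by simp
    qed
  qed
  ultimately show ?thesis
    using latin_squareD(1)[OF L] unfolding latin_square_def by simp
qed

end

(*
  For p other than 19, colour the residues mod p by the quadratic character chi and put
  L i j = 2 i - j if j - i is not a nonresidue and L i j = 2 j - i if it is; this is a Latin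
  square because chi (-2) = 1. A labelling that is constant on the cycles of a row permutation is,
  after rescaling, invariant under a map that reflects along residues and doubles along
  nonresidues; following runs of consecutive residues shows that such a labelling is constant.
  So L is row-Hamiltonian, and so is its transpose, which has the same shape.

  The conjugates that exchange symbols with rows or columns have a cycle of length 3 as soon as
  chi takes the values -1, 1, 1, 1, -1 on some arithmetic progression. If there is none, then
  summing a product that is supported on such progressions gives p + 1 = (2 - chi (-1)) t - 2 u
  with t = s 9 and u = s 3, where s l is the sum of chi (x (x - 1) (x - l)) over x. Up to sign, s
  takes the value t on three orbits, and u on two orbits, of the group generated by l -> 1 / l and
  l -> 1 - l (the curves y^2 = x (x - 1) (x - l) in question are isogenous), so the second moment
  of s gives 18 t^2 + 12 u^2 <= p^2 - 2 p - 1, which contradicts Cauchy-Schwarz. The orbits are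
  disjoint except for a few primes, which have explicit progressions, or, for 19, where no such
  progression exists, another square.
*)

theory Submission
  imports Defs "HOL-Number_Theory.Number_Theory"
begin

section \<open>Labellings of a circle of residues and nonresidues\<close>

text \<open>No cycle is followed to its end: constancy of the labelling comes from local relations,
  and of the colouring these use only periodicity, invariance under multiplication by -2, that 0 is
  on the reflecting side and that the doubling side is not empty. Hence the transpose, whose
  doubling side is the set of \<open>x\<close> with \<open>\<chi> (- x) = 1\<close>, is a second
  instance of the same argument.

  The obstacle in the second half is to bound t and u without Hasse's theorem. The second moment
  alone bounds a single value of s only by about p. It suffices because the value s^2 is repeated
  along whole orbits: for \<open>\<chi> (- 1) = - 1\<close>, Cauchy-Schwarz bounds (3 t - 2 u)^2 by
  (9/18 + 4/12) (18 t^2 + 12 u^2), and 5/6 < 1. Without one of the five orbits the factor would be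
  13/12 or 7/6, so none of them can be spared in this case. Two of the orbits have parameters
  involving a square root of -2; thus \<open>\<chi> (- 2) = 1\<close> enters again, putting these
  parameters into the field of p elements.\<close>

text \<open>With \<open>h k = (if N k then - 2 * k else k)\<close>, the last four assumptions are the consequences of
  \<open>c (h k + 1) = c (h (k - 1))\<close> that the proof needs.\<close>

locale doubling_colouring =
  fixes n :: int and N :: "int \<Rightarrow> bool" and c :: "int \<Rightarrow> 'b"
  assumes n_odd: "odd n" and n_pos: "n > 0"
    and N_cong: "[x = y] (mod n) \<Longrightarrow> N x \<longleftrightarrow> N y"
    and N_double: "N (- 2 * x) \<longleftrightarrow> N x"
    and N_0: "\<not> N 0"
    and N_ex: "\<exists>x. N x"
    and c_cong: "[x = y] (mod n) \<Longrightarrow> c x = c y"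
    and c_RR: "\<lbrakk>\<not> N x; \<not> N (x + 1)\<rbrakk> \<Longrightarrow> c x = c (x + 2)"
    and c_RN: "\<lbrakk>\<not> N x; N (x + 1)\<rbrakk> \<Longrightarrow> c x = c (- 2 * x - 1)"
    and c_NN: "\<lbrakk>N x; N (x - 2)\<rbrakk> \<Longrightarrow> c x = c (x - 1)"
    and c_NR: "\<lbrakk>\<not> N x; N (x - 1)\<rbrakk> \<Longrightarrow> c (2 - 2 * x) = c (x + 1)"
begin

text \<open>Last point of the run of \<open>\<not> N\<close> through \<open>x\<close>. The point
  \<open>x\<close> itself is not tested, so the value is meaningful only if
  \<open>\<not> N x\<close>. Runs are taken in the integers, not modulo \<open>n\<close>, which
  gives them an order and a length.\<close>

definition run_end :: "int \<Rightarrow> int" where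
  "run_end x = x + int (LEAST j. N (x + int j + 1))"

lemma ex_N_after: "\<exists>j. N (x + int j + 1)"
proof -
  obtain y where y: "N y" using N_ex by blast
  define j where "j = nat ((y - (x + 1)) mod n)"
  have "int j = (y - (x + 1)) mod n"
    using n_pos by (simp add: j_def)
  then have "[x + int j + 1 = x + (y - (x + 1)) + 1] (mod n)"
    by (intro cong_add cong_refl) (simp add: cong_def)
  then have "[x + int j + 1 = y] (mod n)" by simp
  then show ?thesis using y N_cong by blast
qed

lemma N_run_end: "N (run_end x + 1)"
  using LeastI_ex[OF ex_N_after[of x]] by (simp add: run_end_def)

lemma run_end_ge: "x \<le> run_end x"
  by (simp add: run_end_def)

lemma run_end_R:
  assumes "\<not> N x" "x \<le> y" "y \<le> run_end x"
  shows "\<not> N y"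
proof (cases "y = x")
  case False
  then have "nat (y - x - 1) < (LEAST j. N (x + int j + 1))"
    using assms by (simp add: run_end_def)
  then have "\<not> N (x + int (nat (y - x - 1)) + 1)" by (rule not_less_Least)
  then show ?thesis using assms False by simp
qed (use assms in simp)

lemma run_end_eqI:
  assumes "\<And>y. x \<le> y \<Longrightarrow> y \<le> w \<Longrightarrow> \<not> N y" "x \<le> w" "N (w + 1)"
  shows "run_end x = w"
proof -
  have "\<not> N x" using assms by simp
  have "run_end x \<le> w"
  proof (rule ccontr)
    assume "\<not> run_end x \<le> w"
    then show False using run_end_R[OF \<open>\<not> N x\<close>, of "w + 1"] assms by simp
  qed
  moreover have "w \<le> run_end x"
  proof (rule ccontr)
    assume "\<not> w \<le> run_end x"
    then show False using assms(1)[of "run_end x + 1"] N_run_end[of x] run_end_ge[of x] by simp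
  qed
  ultimately show ?thesis by simp
qed

lemma run_end_eq:
  assumes "\<And>k. x \<le> k \<Longrightarrow> k \<le> y \<Longrightarrow> \<not> N k" "x \<le> y"
  shows "run_end x = run_end y"
proof (rule run_end_eqI)
  fix k assume "x \<le> k" "k \<le> run_end y"
  then show "\<not> N k" using assms run_end_R[of y k] by (cases "k \<le> y") auto
qed (use assms N_run_end run_end_ge[of y] in auto)

section \<open>Halving: the colouring seen through division by -2\<close>

lemma half_ex: obtains u where "[- 2 * u = y] (mod n)"
proof -
  obtain m where "n = 2 * m + 1" using n_odd by (rule oddE)
  then have "- 2 * (m * y) - y = n * (- y)" by (simp add: algebra_simps)
  then have "[- 2 * (m * y) = y] (mod n)" by (simp add: cong_iff_dvd_diff)
  then show ?thesis by (rule that)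
qed

lemma half_shift:
  assumes "[- 2 * u = y] (mod n)"
  shows "[- 2 * (u + k) = y - 2 * k] (mod n)"
proof -
  have "- 2 * (u + k) = - 2 * u - 2 * k" by simp
  then show ?thesis using cong_diff[OF assms cong_refl[of "2 * k"]] by simp
qed

text \<open>Near the half \<open>u\<close> of \<open>y\<close>, consecutive points have the colours
  of every second point near \<open>y\<close>, read backwards. Every comparison of a run with its
  halves rests on this.\<close>

lemma half_N:
  assumes "[- 2 * u = y] (mod n)"
  shows "N (u + k) \<longleftrightarrow> N (y - 2 * k)"
  using N_cong[OF half_shift[OF assms, of k]] N_double[of "u + k"] by simp

lemma half_unique:
  assumes "[- 2 * u = y] (mod n)" "[- 2 * v = y - 2 * k] (mod n)"
  shows "[v = u + k] (mod n)"
proof -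
  have "[- 2 * v = - 2 * (u + k)] (mod n)"
    using half_shift[OF assms(1)] assms(2) cong_sym cong_trans by blast
  moreover have "coprime (- 2) n" using n_odd by simp
  ultimately show ?thesis by (simp only: cong_mult_lcancel)
qed

lemma run_end_cong:
  assumes "[x = y] (mod n)"
  shows "c (run_end x) = c (run_end y)"
proof -
  have "N (x + int j + 1) = N (y + int j + 1)" for j
    by (rule N_cong) (intro cong_add assms cong_refl)
  then show ?thesis unfolding run_end_def
    by (intro c_cong cong_add assms) simp
qed

lemma c_chain:
  assumes "\<And>k. x \<le> k \<Longrightarrow> k < x + 2 * int j \<Longrightarrow> \<not> N k"
  shows "c x = c (x + 2 * int j)"
  using assms
proof (induction j)
  case (Suc j)
  have "c x = c (x + 2 * int j)" by (rule Suc.IH) (use Suc.prems in auto)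
  also have "\<dots> = c (x + 2 * int j + 2)"
    by (rule c_RR) (use Suc.prems in auto)
  finally show ?case by (simp add: algebra_simps)
qed simp

lemma c_chainI:
  assumes "\<And>k. x \<le> k \<Longrightarrow> k < y \<Longrightarrow> \<not> N k" "x \<le> y" "even (y - x)"
  shows "c x = c y"
proof -
  obtain k where k: "y - x = 2 * k" using assms(3) by (rule evenE)
  with assms(2) have "y = x + 2 * int (nat k)" by simp
  then show ?thesis using c_chain[of x "nat k"] assms(1) by simp
qed

text \<open>Steps of two inside the run settle even length, and \<open>c_NN\<close> settles a single
  point. For odd length the second and the last point have different parity; the passage goes
  through the halves of \<open>z + 1, z + 3, ..., w - 1\<close>, which form a shorter run.\<close>

lemma run_second:
  assumes "\<not> N z" "N (z - 1)"
  shows "c (z + 1) = c (run_end z)"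
  using assms
proof (induction "nat (run_end z - z)" arbitrary: z rule: less_induct)
  case less
  define w where "w = run_end z"
  have zw: "z \<le> w" and Nw: "N (w + 1)" and R: "\<And>y. z \<le> y \<Longrightarrow> y \<le> w \<Longrightarrow> \<not> N y"
    using run_end_ge N_run_end run_end_R less.prems by (auto simp: w_def)
  consider "odd (w - z)" | "w = z" | "even (w - z)" "w \<noteq> z" by blast
  then show ?case
  proof cases
    case 1
    then have "w \<noteq> z" by auto
    then have "c (z + 1) = c w" by (intro c_chainI) (use R zw 1 in auto)
    then show ?thesis by (simp add: w_def)
  next
    case 2
    then show ?thesis using c_NN[of "z + 1"] Nw less.prems by (simp add: w_def[symmetric])
  next
    case 3
    then obtain t where "w - z = 2 * t" by (elim evenE)
    then have t: "w = z + 2 * t" "t \<ge> 1" using zw \<open>w \<noteq> z\<close> by auto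
    \<comment> \<open>The halves of \<open>w - 1, w - 3, ..., z + 1\<close> are
      \<open>u, ..., u + (t - 1)\<close>; the halves of the \<open>N\<close> points
      \<open>w + 1\<close> and \<open>z - 1\<close> bound this run on both sides.\<close>
    obtain u where u: "[- 2 * u = w - 1] (mod n)" by (rule half_ex)
    have Nu: "N (u + k) \<longleftrightarrow> N (w - 1 - 2 * k)" for k by (rule half_N[OF u])
    have Nu0: "\<not> N u" using Nu[of 0] R[of "w - 1"] t by simp
    have Nu1: "N (u - 1)" using Nu[of "-1"] Nw by (simp add: add.commute)
    have end_u: "run_end u = u + (t - 1)"
    proof (rule run_end_eqI)
      fix y assume "u \<le> y" "y \<le> u + (t - 1)"
      then show "\<not> N y" using Nu[of "y - u"] R[of "w - 1 - 2 * (y - u)"] t by simp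
    next
      show "N (u + (t - 1) + 1)" using Nu[of t] t less.prems by (simp add: algebra_simps)
    qed (use t in simp)
    have "c (z + 1) = c (w + 1)" by (rule c_chainI) (use R t in auto)
    also have "\<dots> = c (2 - 2 * u)"
      using cong_add[OF u cong_refl[of 2]] by (intro c_cong) (simp add: cong_sym algebra_simps)
    also have "\<dots> = c (u + 1)"
      by (intro c_NR Nu0 Nu1)
    also have "\<dots> = c (run_end u)"
      by (intro less.hyps Nu0 Nu1) (use t in \<open>auto simp: end_u w_def[symmetric]\<close>)
    also have "\<dots> = c (- 2 * (u + (t - 1)) - 1)"
      unfolding end_u using Nu[of "t - 1"] Nu[of t] R[of "z + 1"] t less.prems
      by (intro c_RN) (auto simp: algebra_simps)
    also have "\<dots> = c z"
    proof (rule c_cong)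
      show "[- 2 * (u + (t - 1)) - 1 = z] (mod n)"
        using cong_diff[OF half_shift[OF u, of "t - 1"] cong_refl[of 1]] t by (simp add: algebra_simps)
    qed
    also have "\<dots> = c w" by (rule c_chainI) (use R t in auto)
    finally show ?thesis by (simp add: w_def)
  qed
qed

lemma c_chain_N:
  assumes "\<And>k. w < k \<Longrightarrow> k \<le> y \<Longrightarrow> N k" "w + 2 \<le> y"
  shows "c y = c (w + 2)"
  using assms
proof (induction "nat (y - (w + 2))" arbitrary: y)
  case 0
  then show ?case by simp
next
  case (Suc m)
  then have "c y = c (y - 1)" by (intro c_NN) auto
  also have "\<dots> = c (w + 2)" by (rule Suc.hyps) (use Suc.prems Suc.hyps(2) in auto)
  finally show ?case .
qed

text \<open>Modulo \<open>n\<close>, \<open>y + 2\<close> is \<open>2 - 2 * v\<close>, which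
  \<open>c_NR\<close> links to \<open>v + 1\<close>. As \<open>N (y + 2)\<close> makes
  \<open>v\<close> the start of a run, \<open>run_second\<close> leads on to its end.\<close>

lemma c_after_N_run:
  assumes "N (y + 2)" "\<not> N y" "[- 2 * v = y] (mod n)"
  shows "c (y + 2) = c (run_end v)"
proof -
  have v: "\<not> N v" "N (v - 1)"
    using half_N[OF assms(3), of 0] half_N[OF assms(3), of "-1"] assms(1,2) by auto
  have "c (y + 2) = c (2 - 2 * v)"
    using cong_add[OF assms(3) cong_refl[of 2]] by (intro c_cong) (simp add: cong_sym algebra_simps)
  also have "\<dots> = c (v + 1)" by (rule c_NR[OF v])
  also have "\<dots> = c (run_end v)" by (rule run_second[OF v])
  finally show ?thesis .
qed

text \<open>\<open>N (z - 1)\<close> makes \<open>u\<close> the last point of its run, and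
  \<open>c_RN\<close> links it to \<open>- 2 * u - 1\<close>, that is, to \<open>z\<close>.\<close>

lemma c_before_N:
  assumes "\<not> N (z + 1)" "N (z - 1)" "[- 2 * u = z + 1] (mod n)"
  shows "c (run_end u) = c z"
proof -
  have u: "\<not> N u" "N (u + 1)"
    using half_N[OF assms(3), of 0] half_N[OF assms(3), of 1] assms(1,2) by auto
  have "run_end u = u" by (rule run_end_eqI) (use u in auto)
  then have "c (run_end u) = c (- 2 * u - 1)" using c_RN[OF u] by simp
  also have "\<dots> = c z"
    using cong_diff[OF assms(3) cong_refl[of 1]] by (intro c_cong) simp
  finally show ?thesis .
qed

text \<open>Halving reverses the order, so \<open>u\<close> precedes \<open>v\<close>. If
  \<open>w - z\<close> is even, both lie in one run. Otherwise the halves of the two parity classes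
  lie in runs whose ends have the colours of \<open>z\<close> and of \<open>w + 1\<close>, and steps
  of two join these points.\<close>

lemma half_across_run:
  assumes z: "\<not> N z" "N (z - 1)"
    and u: "[- 2 * u = run_end z] (mod n)" and v: "[- 2 * v = z] (mod n)"
  shows "c (run_end u) = c (run_end v)"
proof -
  define w where "w = run_end z"
  have zw: "z \<le> w" and Nw: "N (w + 1)" and R: "\<And>y. z \<le> y \<Longrightarrow> y \<le> w \<Longrightarrow> \<not> N y"
    using run_end_ge N_run_end run_end_R z by (auto simp: w_def)
  have Nu: "N (u + k) \<longleftrightarrow> N (w - 2 * k)" for k by (rule half_N) (use u in \<open>simp add: w_def\<close>)
  show ?thesis
  proof (cases "even (w - z)")
    case True
    then obtain t where "w - z = 2 * t" by (elim evenE)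
    then have t: "w = z + 2 * t" "t \<ge> 0" using zw by auto
    have "[v = u + t] (mod n)" by (rule half_unique[OF u]) (use v t w_def in simp)
    then have "c (run_end v) = c (run_end (u + t))" by (rule run_end_cong)
    moreover have "run_end u = run_end (u + t)"
    proof (rule run_end_eq)
      fix k assume "u \<le> k" "k \<le> u + t"
      then show "\<not> N k" using Nu[of "k - u"] R[of "w - 2 * (k - u)"] t by simp
    qed (use t in simp)
    ultimately show ?thesis by simp
  next
    case False
    then obtain t where "w - z = 2 * t + 1" by (elim oddE)
    then have t: "w = z + 2 * t + 1" "t \<ge> 0" using zw by auto
    have "run_end u = run_end (u + t)"
    proof (rule run_end_eq)
      fix k assume "u \<le> k" "k \<le> u + t"
      then show "\<not> N k" using Nu[of "k - u"] R[of "w - 2 * (k - u)"] t by simp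
    qed (use t in simp)
    moreover have "c (run_end (u + t)) = c z"
    proof (rule c_before_N)
      show "[- 2 * (u + t) = z + 1] (mod n)"
        using half_shift[OF u, of t] t by (simp add: w_def[symmetric])
    qed (use R t z in auto)
    moreover have "c z = c (w - 1 + 2)" by (rule c_chainI) (use R t in auto)
    moreover obtain v' where v': "[- 2 * v' = w - 1] (mod n)" by (rule half_ex)
    moreover have "c (w - 1 + 2) = c (run_end v')"
      by (rule c_after_N_run[OF _ _ v']) (use Nw R t in \<open>auto simp: algebra_simps\<close>)
    moreover have "run_end v' = run_end (v' + t)"
    proof (rule run_end_eq)
      fix k assume "v' \<le> k" "k \<le> v' + t"
      then show "\<not> N k" using half_N[OF v', of "k - v'"] R[of "w - 1 - 2 * (k - v')"] t by simp
    qed (use t in simp)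
    moreover have "[v = v' + t] (mod n)" by (rule half_unique[OF v']) (use v t in simp)
    ultimately show ?thesis using run_end_cong by metis
  qed
qed

text \<open>Across a single \<open>N\<close> point the two halves are neighbours in one run. Across
  a longer stretch, \<open>c_before_N\<close> reaches its last point, \<open>c_NN\<close> descends
  to \<open>w + 2\<close>, and \<open>c_after_N_run\<close> returns to a half.\<close>

lemma half_across_N_run:
  assumes "\<not> N w" "\<not> N z" "w + 2 \<le> z" "\<And>k. w < k \<Longrightarrow> k < z \<Longrightarrow> N k"
    and u: "[- 2 * u = z] (mod n)" and v: "[- 2 * v = w] (mod n)"
  shows "c (run_end u) = c (run_end v)"
proof (cases "z = w + 2")
  case True
  have "[v = u + 1] (mod n)" by (rule half_unique[OF u]) (use v True in simp)
  moreover have "run_end u = run_end (u + 1)"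
  proof (rule run_end_eq)
    fix k assume "u \<le> k" "k \<le> u + 1"
    then have "k = u \<or> k = u + 1" by auto
    then show "\<not> N k" using half_N[OF u, of "k - u"] assms True by auto
  qed simp
  ultimately show ?thesis using run_end_cong by metis
next
  case False
  have "c (run_end u) = c (z - 1)"
    by (rule c_before_N) (use assms False in auto)
  also have "\<dots> = c (w + 2)" by (rule c_chain_N) (use assms False in auto)
  also have "\<dots> = c (run_end v)" by (rule c_after_N_run) (use assms False in auto)
  finally show ?thesis .
qed

lemma run_start_ex:
  assumes "\<not> N y"
  obtains z where "z \<le> y" "N (z - 1)" "\<And>k. z \<le> k \<Longrightarrow> k \<le> y \<Longrightarrow> \<not> N k"
proof -
  obtain x where x: "N x" using N_ex by blast
  define x' where "x' = y - (y - x) mod n"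
  have "[x' = y - (y - x)] (mod n)"
    unfolding x'_def by (intro cong_diff cong_refl) (simp add: cong_def)
  then have "N x'" using x N_cong by simp
  moreover have "x' \<le> y" using n_pos by (simp add: x'_def)
  ultimately have fin: "finite {k. x' \<le> k \<and> k \<le> y \<and> N k}" "{k. x' \<le> k \<and> k \<le> y \<and> N k} \<noteq> {}"
    by (auto intro: finite_subset[of _ "{x'..y}"])
  define m where "m = Max {k. x' \<le> k \<and> k \<le> y \<and> N k}"
  have m: "x' \<le> m" "m \<le> y" "N m" using Max_in[OF fin] by (auto simp: m_def)
  have "m \<noteq> y" using m assms by auto
  show ?thesis
  proof (rule that[of "m + 1"])
    fix k assume k: "m + 1 \<le> k" "k \<le> y"
    show "\<not> N k"
    proof
      assume "N k"
      then have "k \<le> m" unfolding m_def by (intro Max_ge fin) (use k m in auto)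
      then show False using k by simp
    qed
  qed (use m \<open>m \<noteq> y\<close> in auto)
qed

lemma prev_R_ex:
  assumes "x \<le> y" "\<not> N x"
  obtains w where "x \<le> w" "w \<le> y" "\<not> N w" "\<And>k. w < k \<Longrightarrow> k \<le> y \<Longrightarrow> N k"
proof -
  have fin: "finite {k. x \<le> k \<and> k \<le> y \<and> \<not> N k}" "{k. x \<le> k \<and> k \<le> y \<and> \<not> N k} \<noteq> {}"
    using assms by (auto intro: finite_subset[of _ "{x..y}"])
  define m where "m = Max {k. x \<le> k \<and> k \<le> y \<and> \<not> N k}"
  have m: "x \<le> m" "m \<le> y" "\<not> N m" using Max_in[OF fin] by (auto simp: m_def)
  show ?thesis
  proof (rule that[of m])
    fix k assume k: "m < k" "k \<le> y"
    show "N k"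
    proof (rule ccontr)
      assume "\<not> N k"
      then have "k \<le> m" unfolding m_def by (intro Max_ge fin) (use k m in auto)
      then show False using k by simp
    qed
  qed (use m in auto)
qed

text \<open>The induction passes the runs of \<open>\<not> N\<close> and of \<open>N\<close> between \<open>z\<^sub>0\<close> and \<open>z\<close> one by one.\<close>

lemma half_tour:
  assumes z0: "\<not> N z\<^sub>0" "N (z\<^sub>0 - 1)" "[- 2 * v = z\<^sub>0] (mod n)"
    and "z\<^sub>0 \<le> z" "\<not> N z" "N (z - 1)" "[- 2 * u = z] (mod n)"
  shows "c (run_end u) = c (run_end v)"
  using assms(4-)
proof (induction "nat (z - z\<^sub>0)" arbitrary: z u rule: less_induct)
  case less
  show ?case
  proof (cases "z = z\<^sub>0")
    case True
    then have "[u = v + 0] (mod n)" by (intro half_unique[OF z0(3)]) (use less.prems in simp)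
    then show ?thesis using run_end_cong by simp
  next
    case False
    obtain w where w: "z\<^sub>0 \<le> w" "w \<le> z - 1" "\<not> N w" and Nw: "\<And>k. w < k \<Longrightarrow> k \<le> z - 1 \<Longrightarrow> N k"
      using prev_R_ex[of "z\<^sub>0" "z - 1"] z0 False less.prems by auto
    have "w \<noteq> z - 1" using w less.prems by auto
    obtain z' where z': "z' \<le> w" "N (z' - 1)" "\<And>k. z' \<le> k \<Longrightarrow> k \<le> w \<Longrightarrow> \<not> N k"
      using run_start_ex[OF w(3)] by blast
    have "z\<^sub>0 \<le> z'" using z'(3)[of "z\<^sub>0 - 1"] z0 w(1) by linarith
    have w_eq: "run_end z' = w"
      by (rule run_end_eqI) (use z' Nw w \<open>w \<noteq> z - 1\<close> in auto)
    obtain u' where u': "[- 2 * u' = z'] (mod n)" by (rule half_ex)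
    obtain v' where v': "[- 2 * v' = w] (mod n)" by (rule half_ex)
    have "c (run_end u) = c (run_end v')"
      by (rule half_across_N_run[OF w(3) less.prems(2) _ _ less.prems(4) v'])
        (use w Nw \<open>w \<noteq> z - 1\<close> in auto)
    also have "\<dots> = c (run_end u')"
      by (rule half_across_run[OF _ z'(2) _ u']) (use z' v' w_eq in auto)
    also have "\<dots> = c (run_end v)"
      by (rule less.hyps[OF _ \<open>z\<^sub>0 \<le> z'\<close> _ z'(2) u']) (use z' w in auto)
    finally show ?thesis .
  qed
qed

lemma half_run_ends:
  obtains g where "\<And>z u. \<lbrakk>\<not> N z; N (z - 1); [- 2 * u = z] (mod n)\<rbrakk> \<Longrightarrow> c (run_end u) = g"
    and "\<And>z u. \<lbrakk>\<not> N z; N (z - 1); [- 2 * u = run_end z] (mod n)\<rbrakk> \<Longrightarrow> c (run_end u) = g"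
proof -
  obtain z0 where "z0 \<le> 0" "N (z0 - 1)" "\<And>k. z0 \<le> k \<Longrightarrow> k \<le> 0 \<Longrightarrow> \<not> N k"
    using run_start_ex[OF N_0] by blast
  then have z0: "\<not> N z0" "N (z0 - 1)" by auto
  obtain v where v: "[- 2 * v = z0] (mod n)" by (rule half_ex)
  have start: "c (run_end u) = c (run_end v)"
    if z: "\<not> N z" "N (z - 1)" "[- 2 * u = z] (mod n)" for z u
  proof -
    \<comment> \<open>Shifting by a multiple of \<open>n\<close> brings the start to the right of
      \<open>z0\<close>, where the tour can reach it.\<close>
    define z' where "z' = z + n * \<bar>z0 - z\<bar>"
    have "1 * \<bar>z0 - z\<bar> \<le> n * \<bar>z0 - z\<bar>" using n_pos by (intro mult_right_mono) auto
    then have "z0 \<le> z'" by (simp add: z'_def)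
    moreover have cong: "[z' + k = z + k] (mod n)" for k by (simp add: z'_def cong_iff_dvd_diff)
    ultimately show ?thesis using half_tour[OF z0 v, of z' u] z N_cong[OF cong[of 0]] N_cong[OF cong[of "-1"]]
      cong_trans[OF z(3) cong_sym] cong[of 0] by simp
  qed
  show ?thesis
  proof (rule that[of "c (run_end v)"])
    fix z u assume z: "\<not> N z" "N (z - 1)" "[- 2 * u = run_end z] (mod n)"
    obtain u' where u': "[- 2 * u' = z] (mod n)" by (rule half_ex)
    show "c (run_end u) = c (run_end v)"
      using half_across_run[OF z u'] start[OF z(1,2) u'] by simp
  qed (use start in blast)
qed

text \<open>Induction from long runs to short ones. Let \<open>z'\<close> and \<open>w\<close> bound
  the run through \<open>- 2 * x\<close>, which is an even integer. If one of them is even, its half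
  lies in the run of \<open>x\<close> and \<open>half_run_ends\<close> applies. If both are odd,
  that run is longer than the run of \<open>x\<close>, so its end has colour \<open>g\<close>; steps
  of two carry this to \<open>z'\<close>, and \<open>c_before_N\<close> to the end of the run of
  \<open>x\<close>.\<close>

lemma run_end_const:
  obtains g where "\<And>x. \<not> N x \<Longrightarrow> c (run_end x) = g"
proof -
  obtain g where starts: "\<And>z u. \<lbrakk>\<not> N z; N (z - 1); [- 2 * u = z] (mod n)\<rbrakk> \<Longrightarrow> c (run_end u) = g"
    and ends: "\<And>z u. \<lbrakk>\<not> N z; N (z - 1); [- 2 * u = run_end z] (mod n)\<rbrakk> \<Longrightarrow> c (run_end u) = g"
    using half_run_ends by blast
  have main: "c (run_end x) = g"
    if "z \<le> x" "N (z - 1)" "\<And>k. z \<le> k \<Longrightarrow> k \<le> x \<Longrightarrow> \<not> N k" for x z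
    using that
  proof (induction "nat (n - (run_end x - z))" arbitrary: x z rule: less_induct)
    case less
    have Rx: "\<not> N x" using less.prems by simp
    obtain z' where z': "z' \<le> - 2 * x" "N (z' - 1)" "\<And>k. z' \<le> k \<Longrightarrow> k \<le> - 2 * x \<Longrightarrow> \<not> N k"
      using run_start_ex[of "- 2 * x"] Rx N_double by blast
    define w where "w = run_end (- 2 * x)"
    have w: "- 2 * x \<le> w" "N (w + 1)" "\<And>k. - 2 * x \<le> k \<Longrightarrow> k \<le> w \<Longrightarrow> \<not> N k"
      using run_end_ge N_run_end run_end_R[of "- 2 * x"] Rx N_double by (auto simp: w_def)
    have R: "\<not> N k" if "z' \<le> k" "k \<le> w" for k
      using that z'(3)[of k] w(3)[of k] by linarith
    have end_z': "run_end z' = w" using run_end_eq[of z' "- 2 * x"] z' by (simp add: w_def)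
    have Nx: "N (x + k) \<longleftrightarrow> N (- 2 * x - 2 * k)" for k by (rule half_N) simp
    consider "even w" | "even z'" | "odd w" "odd z'" by blast
    then show ?case
    proof cases
      case 1
      then obtain t where t: "w = 2 * t" by (elim evenE)
      have "run_end (- t) = run_end x"
      proof (rule run_end_eq)
        fix k assume "- t \<le> k" "k \<le> x"
        then show "\<not> N k" using Nx[of "k - x"] R[of "- 2 * k"] t z' by simp
      qed (use w t in simp)
      moreover have "c (run_end (- t)) = g"
        by (rule ends[of z']) (use z' t end_z' in auto)
      ultimately show ?thesis by simp
    next
      case 2
      then obtain t where t: "z' = 2 * t" by (elim evenE)
      have "run_end x = run_end (- t)"
      proof (rule run_end_eq)
        fix k assume "x \<le> k" "k \<le> - t"
        then show "\<not> N k" using Nx[of "k - x"] R[of "- 2 * k"] t w by simp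
      qed (use z' t in simp)
      moreover have "c (run_end (- t)) = g"
        by (rule starts[of z']) (use z' t in auto)
      ultimately show ?thesis by simp
    next
      case 3
      then obtain s t where s: "w = 2 * s + 1" and "z' = 2 * t + 1" by (elim oddE)
      then obtain t where t: "z' = 2 * t - 1" by (metis add.commute add_diff_cancel_left' diff_add_eq_diff_diff_swap distrib_left mult.right_neutral one_add_one)
      have end_x: "run_end x = - t"
      proof (rule run_end_eqI)
        fix k assume "x \<le> k" "k \<le> - t"
        then show "\<not> N k" using Nx[of "k - x"] R[of "- 2 * k"] t w by simp
      next
        show "N (- t + 1)" using Nx[of "- t + 1 - x"] z' t by (simp add: algebra_simps)
      qed (use z' t 3 in presburger)
      have eqs: "x + (- s - 1 - x) = - s - 1" "- 2 * x - 2 * (- s - 1 - x) = w + 1" using s by auto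
      have "N (- s - 1)" using Nx[of "- s - 1 - x"] w(2) by (simp only: eqs)
      moreover have "- s - 1 < x" using w(1) s 3 by presburger
      ultimately have "- s \<le> z" using less.prems(3)[of "- s - 1"] by linarith
      \<comment> \<open>An \<open>N\<close> point recurs with period \<open>n\<close>, so every run
        is shorter than \<open>n\<close>; this keeps the induction measure positive.\<close>
      have "[z' - 1 + n = z' - 1] (mod n)" by (simp add: cong_iff_dvd_diff)
      then have "N (z' - 1 + n)" using z'(2) N_cong by blast
      then have "w < z' - 1 + n" using R[of "z' - 1 + n"] n_pos z' w by linarith
      have "run_end x - z < w - z'" "w - z' < n"
        using \<open>- s \<le> z\<close> \<open>w < z' - 1 + n\<close> s t z'(1) w(1) by (auto simp: end_x)
      then have "nat (n - (run_end (- 2 * x) - z')) < nat (n - (run_end x - z))"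
        by (fold w_def) simp
      then have "c (run_end (- 2 * x)) = g" by (rule less.hyps[OF _ z'])
      moreover have "c (run_end x) = c z'"
      proof -
        have "run_end (- t) = - t" using run_end_eq[of x "- t"] end_x
          by (metis run_end_ge run_end_R Rx)
        moreover have "z' + 1 \<le> w" using z'(1) w(1) s t by presburger
        then have "c (run_end (- t)) = c z'"
          by (intro c_before_N R z'(2)) (use t in auto)
        ultimately show ?thesis by (simp add: end_x)
      qed
      moreover have "c z' = c w" by (rule c_chainI) (use R 3 z' w in auto)
      ultimately show ?thesis by (simp add: w_def)
    qed
  qed
  show ?thesis
  proof (rule that[of g])
    fix x assume "\<not> N x"
    then show "c (run_end x) = g" using run_start_ex main by metis
  qed
qed

text \<open>Outside \<open>N\<close>, steps of two lead to the end of the run, to its second point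
  (then \<open>run_second\<close>) or to its first point (then \<open>c_before_N\<close>), according
  to parity. Points of \<open>N\<close> descend by \<open>c_NN\<close> until \<open>after\<close> or
  a point outside \<open>N\<close> is reached.\<close>

theorem c_const: "c x = c y"
proof -
  obtain g where g: "\<And>x. \<not> N x \<Longrightarrow> c (run_end x) = g" using run_end_const by blast
  have after: "c (y + 2) = g" if "\<not> N y" "N (y + 2)" for y
  proof -
    obtain v where v: "[- 2 * v = y] (mod n)" by (rule half_ex)
    then have "\<not> N v" using half_N[OF v, of 0] that by simp
    then show ?thesis using c_after_N_run[OF that(2,1) v] g by simp
  qed
  have R: "c x = g" if x: "\<not> N x" for x
  proof -
    obtain z where z: "z \<le> x" "N (z - 1)" "\<And>k. z \<le> k \<Longrightarrow> k \<le> x \<Longrightarrow> \<not> N k"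
      using run_start_ex[OF x] by blast
    define w where "w = run_end x"
    have w: "x \<le> w" "\<And>k. x \<le> k \<Longrightarrow> k \<le> w \<Longrightarrow> \<not> N k"
      using run_end_ge run_end_R[of x] x by (auto simp: w_def)
    consider "even (w - x)" | "odd (w - x)" "odd (x - z)" | "odd (w - x)" "even (x - z)" by blast
    then show ?thesis
    proof cases
      case 1
      then have "c x = c w" by (intro c_chainI) (use w in auto)
      then show ?thesis using g x by (simp add: w_def)
    next
      case 2
      then have "z \<noteq> x" by auto
      then have "c (z + 1) = c x" by (intro c_chainI) (use z 2 in auto)
      then show ?thesis using run_second[of z] g[of z] z by simp
    next
      case 3
      then have "w \<noteq> x" by auto
      then have R: "\<not> N (z + 1)" using z w by (cases "z = x") auto
      obtain u where u: "[- 2 * u = z + 1] (mod n)" by (rule half_ex)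
      have "\<not> N u" using half_N[OF u, of 0] R by simp
      then have "c z = g" using c_before_N[OF R z(2) u] g by simp
      moreover have "c z = c x" by (rule c_chainI) (use z 3 in auto)
      ultimately show ?thesis by simp
    qed
  qed
  have "c x = g" for x
  proof (cases "N x")
    case True
    have "\<not> N (n * (- \<bar>x\<bar>))" using N_cong[of "n * (- \<bar>x\<bar>)" 0] N_0 by (simp add: cong_iff_dvd_diff)
    moreover have "n * (- \<bar>x\<bar>) \<le> x"
    proof -
      have "1 * \<bar>x\<bar> \<le> n * \<bar>x\<bar>" using n_pos by (intro mult_right_mono) auto
      then show ?thesis by simp
    qed
    ultimately obtain y where y: "y \<le> x" "\<not> N y" "\<And>k. y < k \<Longrightarrow> k \<le> x \<Longrightarrow> N k"
      using prev_R_ex by metis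
    have "y \<noteq> x" using y True by auto
    consider "y + 2 \<le> x" | "y = x - 1" "N (x - 2)" | "\<not> N (x - 2)"
      using y \<open>y \<noteq> x\<close> by fastforce
    then show ?thesis
    proof cases
      case 1
      then show ?thesis using c_chain_N[of y x] after[of y] y by auto
    next
      case 2
      then show ?thesis using c_NN[OF True] R[OF y(2)] by simp
    next
      case 3
      then show ?thesis using after[of "x - 2"] True by simp
    qed
  qed (rule R)
  then show ?thesis by simp
qed

end

section \<open>Row-Hamiltonian conjugates\<close>

lemma latin_row_bij:
  assumes "latin_square S L" "i \<in> S"
  shows "bij_betw (L i) S S"
proof (rule bij_betwI')
  fix j j' assume "j \<in> S" "j' \<in> S"
  then show "L i j = L i j' \<longleftrightarrow> j = j'"
    using latin_squareD(3)[OF assms latin_squareD(2)[OF assms \<open>j \<in> S\<close>]] by metis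
next
  fix x assume "x \<in> S"
  then show "\<exists>j\<in>S. x = L i j" using latin_squareD(3)[OF assms \<open>x \<in> S\<close>] by metis
qed (rule latin_squareD(2)[OF assms])

text \<open>A union of cycles of the row permutation is a set of symbols that both rows place in the
  same columns \<open>A\<close>. Stated for columns, the condition needs neither orbits nor inverses
  of rows.\<close>

lemma row_hamiltonian_iff:
  assumes L: "latin_square S L"
  shows "row_hamiltonian S L \<longleftrightarrow>
    (\<forall>i\<in>S. \<forall>j\<in>S. i \<noteq> j \<longrightarrow> (\<forall>A\<subseteq>S. A \<noteq> {} \<longrightarrow> L i ` A = L j ` A \<longrightarrow> A = S))"
proof -
  have "cyclic_on (row_perm S L i j) S \<longleftrightarrow> (\<forall>A\<subseteq>S. A \<noteq> {} \<longrightarrow> L i ` A = L j ` A \<longrightarrow> A = S)"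
    if ij: "i \<in> S" "j \<in> S" for i j
  proof
    let ?r = "row_perm S L i j"
    have r: "?r (L i k) = L j k" if "k \<in> S" for k using row_perm_apply[OF L ij(1) that] .
    have bij: "bij_betw (L i) S S" by (rule latin_row_bij[OF L ij(1)])
    {
      assume cyc: "cyclic_on ?r S"
      show "\<forall>A\<subseteq>S. A \<noteq> {} \<longrightarrow> L i ` A = L j ` A \<longrightarrow> A = S"
      proof (intro allI impI)
        fix A assume A: "A \<subseteq> S" "A \<noteq> {}" "L i ` A = L j ` A"
        then obtain k where k: "k \<in> A" by blast
        have closed: "?r x \<in> L i ` A" if "x \<in> L i ` A" for x
          using that A r by fastforce
        have "x \<in> L i ` A" if "x \<in> orbit ?r (L i k)" for x
          using that by induction (use closed k in auto)
        moreover have "S = orbit ?r (L i k)"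
          using cyc k A(1) bij by (auto simp: cyclic_on_alldef bij_betw_def)
        ultimately have "S \<subseteq> L i ` A" by blast
        moreover have "L i ` A \<subseteq> S" using image_mono[OF A(1), of "L i"] bij by (simp add: bij_betw_def)
        ultimately have "L i ` S = L i ` A" using bij by (auto simp: bij_betw_def)
        then show "A = S" using A(1) bij by (metis bij_betw_def inj_on_image_eq_iff order_refl)
      qed
    }
    {
      assume *: "\<forall>A\<subseteq>S. A \<noteq> {} \<longrightarrow> L i ` A = L j ` A \<longrightarrow> A = S"
      let ?B = "orbit ?r i"
      define A where "A = {k \<in> S. L i k \<in> ?B}"
      have perm: "?r permutes S" by (rule row_perm_permutes[OF L ij])
      have BS: "?B \<subseteq> S" using perm ij(1) by (rule permutes_orbit_subset)
      have fin: "finite ?B" using BS latin_squareD(1)[OF L] finite_subset by blast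
      have LA: "L i ` A = ?B" using BS bij by (auto simp: A_def bij_betw_def image_iff)
      have "?r ` ?B = ?B"
        using fin perm by (intro endo_inj_surj) (auto intro: orbit.step inj_on_subset[OF permutes_inj])
      moreover have "L j ` A = ?r ` (L i ` A)" using r by (force simp: A_def)
      ultimately have "L i ` A = L j ` A" using LA by simp
      moreover have "A \<noteq> {}" using LA orbit_nonempty by fastforce
      moreover have "A \<subseteq> S" by (auto simp: A_def)
      ultimately have "A = S" using * by blast
      then have "S = ?B" using LA bij by (simp add: bij_betw_def)
      with ij(1) show "cyclic_on ?r S" by (rule cyclic_on_singleI)
    }
  qed
  then show ?thesis unfolding row_hamiltonian_def by (intro ball_cong refl) simp
qed

lemma row_hamiltonian_cong:
  assumes "latin_square S L" "latin_square S M" "\<And>i j. i \<in> S \<Longrightarrow> j \<in> S \<Longrightarrow> L i j = M i j"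
  shows "row_hamiltonian S L \<longleftrightarrow> row_hamiltonian S M"
proof -
  have "L i ` A = M i ` A" if "i \<in> S" "A \<subseteq> S" for i A
    using assms(3) that by (intro image_cong) auto
  then show ?thesis
    unfolding row_hamiltonian_iff[OF assms(1)] row_hamiltonian_iff[OF assms(2)] by metis
qed

text \<open>Exchanging columns and symbols replaces each row permutation by a conjugate of its inverse.\<close>

lemma row_hamiltonian_swap:
  assumes "latin_square S L" "latin_square S M"
    and LM: "\<And>i j k. i \<in> S \<Longrightarrow> j \<in> S \<Longrightarrow> k \<in> S \<Longrightarrow> L i j = k \<longleftrightarrow> M i k = j"
    and "row_hamiltonian S L"
  shows "row_hamiltonian S M"
  unfolding row_hamiltonian_iff[OF assms(2)]
proof (intro ballI allI impI)
  fix i j A assume ij: "i \<in> S" "j \<in> S" "i \<noteq> j" and A: "A \<subseteq> S" "A \<noteq> {}" "M i ` A = M j ` A"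
  have inverse: "L k ` (M k ` A) = A" if "k \<in> S" for k
  proof -
    have "L k (M k x) = x" if "x \<in> A" for x
      using LM[OF \<open>k \<in> S\<close>, of "M k x" x] that A(1) latin_squareD(2)[OF assms(2) \<open>k \<in> S\<close>] by auto
    then show ?thesis by force
  qed
  have "M i ` A \<subseteq> S" using A(1) latin_squareD(2)[OF assms(2)] ij by auto
  then have "M i ` A = S"
    using assms(4) ij A inverse unfolding row_hamiltonian_iff[OF assms(1)]
    by (metis image_is_empty)
  then show "A = S"
    using inverse[OF ij(1)] latin_row_bij[OF assms(1) ij(1)] by (simp add: bij_betw_def)
qed

section \<open>The six conjugates and how many of them count\<close>

lemma conjugate_eq_iff:
  assumes "latin_square S L" "\<sigma> permutes {..<3}" "i \<in> S" "j \<in> S"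
  shows "conjugate S L \<sigma> i j = k \<longleftrightarrow>
    (\<exists>a\<in>S. \<exists>b\<in>S. [a, b, L a b] ! \<sigma> 0 = i \<and> [a, b, L a b] ! \<sigma> 1 = j \<and> [a, b, L a b] ! \<sigma> 2 = k)"
proof -
  have "permute_list \<sigma> [a, b, c] = [[a, b, c] ! \<sigma> 0, [a, b, c] ! \<sigma> 1, [a, b, c] ! \<sigma> 2]" for a b c :: 'a
    by (simp add: permute_list_def upt_rec numeral_2_eq_2)
  moreover have "[i, j, k] \<in> permute_list \<sigma> ` triples S L \<longleftrightarrow>
      (\<exists>a\<in>S. \<exists>b\<in>S. permute_list \<sigma> [a, b, L a b] = [i, j, k])"
    unfolding triples_def image_iff by (blast dest: sym intro: sym)
  ultimately show ?thesis
    using permuted_triples_iff[OF assms, of k] by auto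
qed

text \<open>\<open>\<sigma> 0\<close> is the coordinate that serves as row index. Two permutations
  that agree there are equal or differ by exchanging columns and symbols, which is
  \<open>row_hamiltonian_swap\<close>.\<close>

lemma row_hamiltonian_conjugate_cong:
  assumes L: "latin_square S L" and \<sigma>: "\<sigma> permutes {..<3}" and \<tau>: "\<tau> permutes {..<3}"
    and "\<sigma> 0 = \<tau> 0" and ham: "row_hamiltonian S (conjugate S L \<sigma>)"
  shows "row_hamiltonian S (conjugate S L \<tau>)"
proof -
  have less: "\<rho> b < 3" if "\<rho> permutes {..<3}" "b < 3" for \<rho> :: "nat \<Rightarrow> nat" and b
    using permutes_in_image[OF that(1), of b] that(2) by simp
  have third: "c = 3 - a - b" if "a < 3" "b < 3" "c < 3" "a \<noteq> b" "a \<noteq> c" "b \<noteq> c" for a b c :: nat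
    using that by (auto simp: less_Suc_eq numeral_3_eq_3)
  have dist: "\<rho> 0 \<noteq> \<rho> 1" "\<rho> 0 \<noteq> \<rho> 2" "\<rho> 1 \<noteq> \<rho> 2" if "\<rho> permutes {..<3}" for \<rho> :: "nat \<Rightarrow> nat"
    by (simp_all add: inj_eq[OF permutes_inj[OF that]])
  have 2: "\<rho> 2 = 3 - \<rho> 0 - \<rho> 1" if "\<rho> permutes {..<3}" for \<rho> :: "nat \<Rightarrow> nat"
    by (rule third) (use less[OF that] dist[OF that] in auto)
  have "\<tau> 1 = 3 - \<sigma> 0 - \<sigma> 1" if "\<sigma> 1 \<noteq> \<tau> 1"
    by (rule third) (use less[OF \<sigma>] less[OF \<tau>] dist[OF \<sigma>] dist[OF \<tau>] \<open>\<sigma> 0 = \<tau> 0\<close> that in auto)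
  moreover have "\<sigma> 1 = 3 - \<sigma> 0 - \<tau> 1" if "\<sigma> 1 \<noteq> \<tau> 1"
    by (rule third) (use less[OF \<sigma>] less[OF \<tau>] dist[OF \<sigma>] dist[OF \<tau>] \<open>\<sigma> 0 = \<tau> 0\<close> that in auto)
  ultimately consider "\<sigma> 1 = \<tau> 1" "\<sigma> 2 = \<tau> 2" | "\<sigma> 1 = \<tau> 2" "\<sigma> 2 = \<tau> 1"
    using 2[OF \<sigma>] 2[OF \<tau>] \<open>\<sigma> 0 = \<tau> 0\<close> by metis
  then show ?thesis
  proof cases
    case 1
    have eq: "conjugate S L \<sigma> i j = conjugate S L \<tau> i j" if "i \<in> S" "j \<in> S" for i j
      using 1 conjugate_eq_iff[OF L \<sigma> that] conjugate_eq_iff[OF L \<tau> that] \<open>\<sigma> 0 = \<tau> 0\<close> by metis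
    show ?thesis
      using row_hamiltonian_cong[OF latin_square_conjugate[OF L \<sigma>] latin_square_conjugate[OF L \<tau>] eq] ham
      by simp
  next
    case 2
    show ?thesis
    proof (rule row_hamiltonian_swap[OF latin_square_conjugate[OF L \<sigma>] latin_square_conjugate[OF L \<tau>] _ ham])
      fix i j k assume ijk: "i \<in> S" "j \<in> S" "k \<in> S"
      show "conjugate S L \<sigma> i j = k \<longleftrightarrow> conjugate S L \<tau> i k = j"
        unfolding conjugate_eq_iff[OF L \<sigma> ijk(1,2)] conjugate_eq_iff[OF L \<tau> ijk(1,3)]
        using 2 \<open>\<sigma> 0 = \<tau> 0\<close> by auto
    qed
  qed
qed

lemma card_permutes_3_not_2:
  "card {\<sigma> :: nat \<Rightarrow> nat. \<sigma> permutes {..<3} \<and> \<sigma> 0 \<noteq> 2} = 4"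
proof -
  let ?P = "{\<pi>. \<pi> permutes {1, 2 :: nat}}"
  let ?f = "\<lambda>(b, \<pi>). Transposition.transpose 0 b \<circ> \<pi>"
  have fix0: "\<pi> 0 = 0" if "\<pi> \<in> ?P" for \<pi> using that by (simp add: permutes_def)
  have "{..<3} = insert 0 {1, 2 :: nat}" by auto
  then have perms: "{\<sigma>. \<sigma> permutes {..<3 :: nat}} = ?f ` {(b, \<pi>). b \<in> insert 0 {1, 2} \<and> \<pi> \<in> ?P}"
    using permutes_insert[of "0 :: nat" "{1, 2}"] by simp
  have f0: "?f (b, \<pi>) 0 = b" if "\<pi> \<in> ?P" for b \<pi> using fix0[OF that] by simp
  have "{\<sigma> :: nat \<Rightarrow> nat. \<sigma> permutes {..<3} \<and> \<sigma> 0 \<noteq> 2} = ?f ` ({0, 1} \<times> ?P)"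
  proof (intro equalityI subsetI)
    fix \<sigma> :: "nat \<Rightarrow> nat" assume "\<sigma> \<in> {\<sigma>. \<sigma> permutes {..<3} \<and> \<sigma> 0 \<noteq> 2}"
    then have "\<sigma> \<in> ?f ` {(b, \<pi>). b \<in> insert 0 {1, 2} \<and> \<pi> \<in> ?P}" "\<sigma> 0 \<noteq> 2"
      unfolding perms[symmetric] by simp_all
    then obtain b \<pi> where "b \<in> {0, 1, 2}" "\<pi> \<in> ?P" "\<sigma> = ?f (b, \<pi>)" by blast
    moreover from this have "b \<noteq> 2" using f0 \<open>\<sigma> 0 \<noteq> 2\<close> by blast
    ultimately show "\<sigma> \<in> ?f ` ({0, 1} \<times> ?P)" by blast
  next
    fix \<sigma> assume "\<sigma> \<in> ?f ` ({0, 1} \<times> ?P)"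
    then obtain b \<pi> where b: "b \<in> {0, 1}" "\<pi> \<in> ?P" "\<sigma> = ?f (b, \<pi>)" by blast
    then have "\<sigma> \<in> {\<sigma>. \<sigma> permutes {..<3}}" unfolding perms by blast
    moreover have "\<sigma> 0 \<noteq> 2" using f0[OF b(2), of b] b by auto
    ultimately show "\<sigma> \<in> {\<sigma>. \<sigma> permutes {..<3} \<and> \<sigma> 0 \<noteq> 2}" by simp
  qed
  moreover have "inj_on ?f ({0, 1} \<times> ?P)"
  proof (rule inj_onI)
    fix x y assume xy: "x \<in> {0, 1} \<times> ?P" "y \<in> {0, 1} \<times> ?P" "?f x = ?f y"
    obtain b \<pi> c \<rho> where [simp]: "x = (b, \<pi>)" "y = (c, \<rho>)" by (cases x, cases y)
    have \<pi>: "\<pi> \<in> ?P" "\<rho> \<in> ?P" using xy by auto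
    have "b = ?f x 0" unfolding \<open>x = (b, \<pi>)\<close> by (rule f0[OF \<pi>(1), symmetric])
    also have "\<dots> = ?f y 0" by (simp only: xy(3))
    also have "\<dots> = c" unfolding \<open>y = (c, \<rho>)\<close> by (rule f0[OF \<pi>(2)])
    finally have "b = c" .
    then have "Transposition.transpose 0 b \<circ> \<pi> = Transposition.transpose 0 b \<circ> \<rho>"
      using xy(3) by simp
    then have eq: "Transposition.transpose 0 b (\<pi> n) = Transposition.transpose 0 b (\<rho> n)" for n
      unfolding fun_eq_iff comp_apply by (rule spec)
    have "\<pi> n = \<rho> n" for n
      using arg_cong[OF eq[of n], of "Transposition.transpose 0 b"] by (simp only: transpose_involutory)
    then have "\<pi> = \<rho>" by (rule ext)
    then show "x = y" using \<open>b = c\<close> by simp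
  qed
  moreover have "card ?P = 2" by (simp add: card_permutations[OF refl])
  ultimately show ?thesis by (simp add: card_image card_cartesian_product)
qed

text \<open>\<open>L\<close> and its transpose account for two conjugates each. In the conjugate
  \<open>?M\<close> indexed by symbols, the rows \<open>k\<close> and \<open>k'\<close> both send
  the columns \<open>B\<close> onto \<open>A\<close>, so the permutation between them preserves the
  proper subset \<open>A\<close>. The bound on \<open>card B\<close> turns the inclusion given by
  \<open>hit\<close> into an equality.\<close>

lemma nu_eq_4I:
  assumes L: "latin_square S L"
    and rows: "row_hamiltonian S L"
    and cols: "row_hamiltonian S (\<lambda>i j. L j i)"
    and k: "k \<in> S" "k' \<in> S" "k \<noteq> k'"
    and A: "A \<subseteq> S" "A \<noteq> {}" "A \<noteq> S" and B: "B \<subseteq> S" "card B \<le> card A"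
    and hit: "\<And>i. i \<in> A \<Longrightarrow> \<exists>j\<in>B. L i j = k" "\<And>i. i \<in> A \<Longrightarrow> \<exists>j\<in>B. L i j = k'"
  shows "\<nu> S L = 4"
proof -
  note conj_iff = conjugate_eq_iff[OF L] and conj_latin = latin_square_conjugate[OF L]
  have fin: "finite S" by (rule latin_squareD(1)[OF L])
  have \<tau>_perm: "Transposition.transpose a b permutes {..<3}" if "a < 3" "b < 3" for a b :: nat
    using that by (intro permutes_swap_id) auto
  have rows': "row_hamiltonian S (conjugate S L \<sigma>)" if \<sigma>: "\<sigma> permutes {..<3}" "\<sigma> 0 = 0" for \<sigma>
  proof (rule row_hamiltonian_conjugate_cong[OF L permutes_id \<sigma>(1)])
    have "conjugate S L id i j = L i j" if "i \<in> S" "j \<in> S" for i j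
      using conj_iff[OF permutes_id that, of "L i j"] that by auto
    then show "row_hamiltonian S (conjugate S L id)"
      using row_hamiltonian_cong[OF conj_latin[OF permutes_id] L] rows by blast
  qed (use \<sigma> in auto)
  have cols': "row_hamiltonian S (conjugate S L \<sigma>)" if \<sigma>: "\<sigma> permutes {..<3}" "\<sigma> 0 = 1" for \<sigma>
  proof (rule row_hamiltonian_conjugate_cong[OF L \<tau>_perm \<sigma>(1)])
    let ?t = "Transposition.transpose 0 (1 :: nat)"
    have perm: "?t permutes {..<3}" by (rule \<tau>_perm) auto
    have "conjugate S L ?t i j = L j i" if "i \<in> S" "j \<in> S" for i j
      using conj_iff[OF perm that, of "L j i"] that
      by (auto simp: Transposition.transpose_def)
    moreover have "latin_square S (\<lambda>i j. L j i)" using L by (simp add: latin_square_def)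
    ultimately show "row_hamiltonian S (conjugate S L ?t)"
      using row_hamiltonian_cong[OF conj_latin[OF perm]] cols by blast
  qed (use \<sigma> in auto)
  have syms: "\<not> row_hamiltonian S (conjugate S L \<sigma>)" if \<sigma>: "\<sigma> permutes {..<3}" "\<sigma> 0 = 2" for \<sigma>
  proof
    assume "row_hamiltonian S (conjugate S L \<sigma>)"
    have perm: "Transposition.transpose 0 2 permutes {..<3 :: nat}" by (rule \<tau>_perm) auto
    let ?M = "conjugate S L (Transposition.transpose 0 2)"
    have "row_hamiltonian S ?M"
      using \<sigma>(2) by (intro row_hamiltonian_conjugate_cong[OF L \<sigma>(1) perm _ \<open>row_hamiltonian S (conjugate S L \<sigma>)\<close>]) simp
    have M_iff: "?M s j = i \<longleftrightarrow> L i j = s" if "s \<in> S" "i \<in> S" "j \<in> S" for s i j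
      unfolding conj_iff[OF perm that(1,3)] using that by simp
    have image_eq: "?M s ` B = A" if "s \<in> S" and h: "\<And>i. i \<in> A \<Longrightarrow> \<exists>j\<in>B. L i j = s" for s
    proof -
      have "A \<subseteq> ?M s ` B"
      proof
        fix i assume "i \<in> A"
        then obtain j where "j \<in> B" "L i j = s" using h by blast
        then show "i \<in> ?M s ` B"
          using M_iff[of s i j] subsetD[OF A(1) \<open>i \<in> A\<close>] subsetD[OF B(1)] that(1) by (intro image_eqI[of _ _ j]) simp_all
      qed
      moreover have "card (?M s ` B) \<le> card A"
        using card_image_le[OF finite_subset[OF B(1) fin]] B(2) le_trans by blast
      ultimately show ?thesis
        using card_seteq[of "?M s ` B" A] finite_subset[OF B(1) fin] by auto
    qed
    have images: "?M k ` B = A" "?M k' ` B = A"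
      using image_eq[OF k(1) hit(1)] image_eq[OF k(2) hit(2)] by simp_all
    then have "B \<noteq> {}" using A(2) by auto
    have "B = S"
      using \<open>row_hamiltonian S ?M\<close> k B(1) \<open>B \<noteq> {}\<close> images
      unfolding row_hamiltonian_iff[OF conj_latin[OF perm]] by simp
    then have "?M k ` S = A" using images by simp
    then show False using latin_row_bij[OF conj_latin[OF perm] k(1)] A(3) by (simp add: bij_betw_def)
  qed
  have "\<sigma> 0 < 3" if "\<sigma> permutes {..<3}" for \<sigma> :: "nat \<Rightarrow> nat"
    using permutes_in_image[OF that, of 0] by simp
  then have "\<sigma> 0 = 0 \<or> \<sigma> 0 = 1 \<or> \<sigma> 0 = 2" if "\<sigma> permutes {..<3}" for \<sigma> :: "nat \<Rightarrow> nat"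
    using that by fastforce
  then have "{\<sigma>. \<sigma> permutes {..<3} \<and> row_hamiltonian S (conjugate S L \<sigma>)} =
      {\<sigma>. \<sigma> permutes {..<3} \<and> \<sigma> 0 \<noteq> 2}"
    using rows' cols' syms by fastforce
  then show ?thesis by (simp add: \<nu>_def card_permutes_3_not_2)
qed

section \<open>Latin squares developed from a first row\<close>

text \<open>Adding one constant modulo \<open>n\<close> to row, column and symbol is an automorphism
  of this square, so the permutation between two rows depends, up to translation, only on their
  difference.\<close>

definition diff_square :: "nat \<Rightarrow> (int \<Rightarrow> int) \<Rightarrow> nat \<Rightarrow> nat \<Rightarrow> nat" where
  "diff_square n F i j = nat ((int i + F (int j - int i)) mod int n)"

text \<open>The conclusion of \<open>diff_hamiltonian\<close> is that a set of symbols, described by the symbol differences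
  \<^term>\<open>c\<close> relative to a row \<open>i\<close> and mapped to itself by the row permutation from \<open>i\<close> to \<open>i + d\<close>, is trivial.\<close>

definition diff_hamiltonian :: "nat \<Rightarrow> (int \<Rightarrow> int) \<Rightarrow> bool" where
  "diff_hamiltonian n F \<longleftrightarrow> (\<forall>d (c :: int \<Rightarrow> bool). \<not> int n dvd d \<longrightarrow>
     (\<forall>x y. [x = y] (mod int n) \<longrightarrow> c x = c y) \<longrightarrow> (\<forall>k. c (F k) = c (d + F (k - d))) \<longrightarrow>
     (\<forall>x y. c x = c y))"

text \<open>\<open>F\<close> is an orthomorphism of the integers modulo \<open>n\<close>:
  injectivity of \<open>F\<close> handles the rows, that of \<open>F x - x\<close> the
  columns.\<close>

locale diff_latin =
  fixes n :: nat and F :: "int \<Rightarrow> int"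
  assumes n_pos: "n > 0"
    and F_cong: "[x = y] (mod int n) \<Longrightarrow> [F x = F y] (mod int n)"
    and F_inj: "[F x = F y] (mod int n) \<Longrightarrow> [x = y] (mod int n)"
    and F_diff_inj: "[F x - x = F y - y] (mod int n) \<Longrightarrow> [x = y] (mod int n)"
begin

lemma diff_square_less: "diff_square n F i j < n"
  using n_pos by (simp add: diff_square_def nat_less_iff)

lemma int_diff_square: "int (diff_square n F i j) = (int i + F (int j - int i)) mod int n"
  using n_pos by (simp add: diff_square_def)

lemma diff_square_eq_iff:
  "diff_square n F i j = diff_square n F i' j' \<longleftrightarrow>
    [int i + F (int j - int i) = int i' + F (int j' - int i')] (mod int n)"
  by (simp add: int_diff_square cong_def flip: int_int_eq)

lemma nat_cong_imp_eq:
  assumes "[int i = int j] (mod int n)" "i < n" "j < n"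
  shows "i = j"
  using assms by (simp add: cong_def)

lemma latin_diff_square: "latin_square {..<n} (diff_square n F)"
proof -
  have row: "inj_on (diff_square n F i) {..<n}" for i
  proof (rule inj_onI)
    fix j j' assume j: "j \<in> {..<n}" "j' \<in> {..<n}" "diff_square n F i j = diff_square n F i j'"
    then have "[F (int j - int i) = F (int j' - int i)] (mod int n)"
      by (simp add: diff_square_eq_iff cong_add_lcancel)
    then have "[int j - int i + int i = int j' - int i + int i] (mod int n)"
      by (rule cong_add[OF F_inj cong_refl])
    then show "j = j'" using j by (intro nat_cong_imp_eq) auto
  qed
  have col: "inj_on (\<lambda>i. diff_square n F i j) {..<n}" for j
  proof (rule inj_onI)
    fix i i' assume i: "i \<in> {..<n}" "i' \<in> {..<n}" "diff_square n F i j = diff_square n F i' j"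
    then have "[int i + F (int j - int i) - int j = int i' + F (int j - int i') - int j] (mod int n)"
      by (intro cong_diff cong_refl) (simp add: diff_square_eq_iff)
    then have "[F (int j - int i) - (int j - int i) = F (int j - int i') - (int j - int i')] (mod int n)"
      by (simp add: algebra_simps)
    then have "[int j - (int j - int i) = int j - (int j - int i')] (mod int n)"
      by (rule cong_diff[OF cong_refl F_diff_inj])
    then show "i = i'" using i by (intro nat_cong_imp_eq) auto
  qed
  have ex1: "\<exists>!j. j \<in> {..<n} \<and> f j = x"
    if f: "inj_on f {..<n}" "f ` {..<n} \<subseteq> {..<n}" "x \<in> {..<n}" for f :: "nat \<Rightarrow> nat" and x
  proof -
    have "f ` {..<n} = {..<n}" using f by (intro endo_inj_surj) auto
    then obtain j where "j \<in> {..<n}" "f j = x" using f(3) by (metis imageE)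
    then show ?thesis using f(1) by (intro ex1I[of _ j]) (auto dest: inj_onD)
  qed
  show ?thesis
    unfolding latin_square_def
    using ex1[OF row] ex1[OF col] diff_square_less by (simp add: image_subset_iff)
qed

lemma row_hamiltonian_diff_square:
  assumes ham: "diff_hamiltonian n F"
  shows "row_hamiltonian {..<n} (diff_square n F)"
  unfolding row_hamiltonian_iff[OF latin_diff_square]
proof (intro ballI allI impI)
  fix i j A assume i: "i \<in> {..<n}" and j: "j \<in> {..<n}" and "i \<noteq> j"
    and A: "A \<subseteq> {..<n}" "A \<noteq> {}" and eq: "diff_square n F i ` A = diff_square n F j ` A"
  let ?L = "diff_square n F"
  define c where "c x \<longleftrightarrow> nat ((int i + x) mod int n) \<in> ?L i ` A" for x
  have L_eq: "?L i k = nat ((int i + F (int k - int i)) mod int n)" for i k by (simp add: diff_square_def)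
  have mem: "?L i k \<in> ?L i ` A \<longleftrightarrow> k \<in> A" if "k < n" "i < n" for i k
    using latin_row_bij[OF latin_diff_square, of i] that A(1)
    by (subst inj_on_image_mem_iff[of _ "{..<n}"]) (auto simp: bij_betw_def)
  have c_cong: "c x = c y" if "[x = y] (mod int n)" for x y
    using cong_add[OF cong_refl[of "int i"] that] by (simp add: c_def cong_def)
  have "c (F k) = c (int j - int i + F (k - (int j - int i)))" for k
  proof -
    define a where "a = nat ((int i + k) mod int n)"
    have a: "a < n" "[int a = int i + k] (mod int n)" using n_pos by (simp_all add: a_def nat_less_iff cong_def)
    have "[int a - int i = k] (mod int n)" "[int a - int j = k - (int j - int i)] (mod int n)"
      using cong_diff[OF a(2) cong_refl[of "int i"]] cong_diff[OF a(2) cong_refl[of "int j"]]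
      by (simp_all add: algebra_simps)
    note F = this[THEN F_cong]
    have "c (F k) \<longleftrightarrow> c (F (int a - int i))" by (rule c_cong[OF cong_sym[OF F(1)]])
    also have "\<dots> \<longleftrightarrow> a \<in> A" using mem[OF a(1), of i] i by (simp add: c_def L_eq)
    also have "\<dots> \<longleftrightarrow> ?L j a \<in> ?L i ` A" using mem[OF a(1), of j] j eq by simp
    also have "\<dots> \<longleftrightarrow> c (int j - int i + F (int a - int j))" by (simp add: c_def L_eq)
    also have "\<dots> \<longleftrightarrow> c (int j - int i + F (k - (int j - int i)))"
      by (rule c_cong[OF cong_add[OF cong_refl F(2)]])
    finally show ?thesis .
  qed
  moreover have "\<not> int n dvd int j - int i"
    using nat_cong_imp_eq[of j i] i j \<open>i \<noteq> j\<close> by (auto simp: cong_iff_dvd_diff)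
  ultimately have const: "c x = c y" for x y
    using ham c_cong unfolding diff_hamiltonian_def by blast
  obtain k where k: "k \<in> A" using A(2) by blast
  have "k' \<in> A" if "k' \<in> {..<n}" for k'
    using const[of "F (int k' - int i)" "F (int k - int i)"] k that i mem[of k' i]
    by (simp add: c_def L_eq[symmetric])
  then show "A = {..<n}" using A(1) by blast
qed

lemma transpose_diff_square: "diff_square n F j i = diff_square n (\<lambda>x. x + F (- x)) i j"
  by (simp add: diff_square_def algebra_simps)

lemma transpose_diff_latin: "diff_latin n (\<lambda>x. x + F (- x))"
proof
  fix x y :: int
  assume "[x + F (- x) = y + F (- y)] (mod int n)"
  then have "[F (- x) - (- x) = F (- y) - (- y)] (mod int n)" by (simp add: add.commute)
  then show "[x = y] (mod int n)" using F_diff_inj cong_minus_minus_iff by blast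
next
  fix x y :: int
  assume "[x + F (- x) - x = y + F (- y) - y] (mod int n)"
  then show "[x = y] (mod int n)" using F_inj[of "- x" "- y"] by (simp add: cong_minus_minus_iff)
next
  fix x y :: int
  assume "[x = y] (mod int n)"
  then show "[x + F (- x) = y + F (- y)] (mod int n)"
    by (intro cong_add F_cong) (simp_all add: cong_minus_minus_iff)
qed (rule n_pos)

lemma nu_diff_square_eq_4I:
  assumes "diff_hamiltonian n F" "diff_hamiltonian n (\<lambda>x. x + F (- x))"
    and "k < n" "k' < n" "k \<noteq> k'"
    and "A \<subseteq> {..<n}" "A \<noteq> {}" "A \<noteq> {..<n}" "B \<subseteq> {..<n}" "card B \<le> card A"
    and "\<And>i. i \<in> A \<Longrightarrow> \<exists>j\<in>B. diff_square n F i j = k"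
    and "\<And>i. i \<in> A \<Longrightarrow> \<exists>j\<in>B. diff_square n F i j = k'"
  shows "\<nu> {..<n} (diff_square n F) = 4"
proof (rule nu_eq_4I[OF latin_diff_square row_hamiltonian_diff_square[OF assms(1)]])
  show "row_hamiltonian {..<n} (\<lambda>i j. diff_square n F j i)"
    unfolding transpose_diff_square
    using diff_latin.row_hamiltonian_diff_square[OF transpose_diff_latin assms(2)] .
qed (use assms in auto)

end

section \<open>Reflection and doubling along a class invariant under -2\<close>

locale reflection_square =
  fixes p :: nat and N :: "int \<Rightarrow> bool" and F :: "int \<Rightarrow> int"
  assumes p_prime: "prime p" and p_gt_3: "p > 3"
    and N_cong: "[x = y] (mod int p) \<Longrightarrow> N x \<longleftrightarrow> N y"
    and N_double: "N (- 2 * x) \<longleftrightarrow> N x"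
    and N_0: "\<not> N 0"
    and N_ex: "\<exists>x. N x"
    and F: "[F x = (if N x then 2 * x else - x)] (mod int p)"
begin

lemma p_odd: "odd (int p)"
  using prime_odd_nat[OF p_prime] p_gt_3 by simp

lemma cong_mult_lcancel_p:
  assumes "[a * x = a * y] (mod int p)" "\<not> int p dvd a"
  shows "[x = y] (mod int p)"
proof -
  have "coprime a (int p)"
    using assms(2) p_prime by (metis coprime_commute prime_imp_coprime prime_nat_int_transfer)
  then show ?thesis using assms(1) by (simp add: cong_mult_lcancel)
qed

lemma not_p_dvd_small: "\<not> int p dvd 2" "\<not> int p dvd - 2" "\<not> int p dvd 3"
  using zdvd_imp_le[of "int p" 2] zdvd_imp_le[of "int p" 3] p_gt_3 by auto

lemma diff_latin_F: "diff_latin p F"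
proof
  show "p > 0" using p_gt_3 by simp
next
  fix x y :: int assume xy: "[x = y] (mod int p)"
  have "[(if N x then 2 * x else - x) = (if N y then 2 * y else - y)] (mod int p)"
    using xy N_cong[OF xy] by (simp add: cong_minus_minus_iff cong_scalar_left)
  then show "[F x = F y] (mod int p)" by (meson F cong_sym cong_trans)
next
  fix x y :: int assume "[F x = F y] (mod int p)"
  then have eq: "[(if N x then 2 * x else - x) = (if N y then 2 * y else - y)] (mod int p)"
    by (meson F cong_sym cong_trans)
  \<comment> \<open>The doubling and the reflecting branch have disjoint images: a common value
    would mean \<open>y = - 2 * x\<close>, but \<open>N\<close> is invariant under -2.\<close>
  have mixed: False if "N x" "\<not> N y" "[2 * x = - y] (mod int p)" for x y
    using N_cong[of "- 2 * x" y] that N_double[of x] cong_minus_minus_iff[of "2 * x" "- y" "int p"] by simp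
  show "[x = y] (mod int p)"
  proof (cases "N x"; cases "N y")
    assume "N x" "N y"
    then show ?thesis using eq cong_mult_lcancel_p[of 2 x y] not_p_dvd_small by simp
  qed (use eq mixed[of x y] mixed[of y x] in \<open>auto simp: cong_minus_minus_iff cong_sym\<close>)
next
  fix x y :: int assume "[F x - x = F y - y] (mod int p)"
  moreover have "[F x - x = (if N x then 2 * x else - x) - x] (mod int p)" for x
    by (intro cong_diff F cong_refl)
  ultimately have "[(if N x then 2 * x else - x) - x = (if N y then 2 * y else - y) - y] (mod int p)"
    by (meson cong_sym cong_trans)
  then have eq: "[(if N x then x else - 2 * x) = (if N y then y else - 2 * y)] (mod int p)"
    by (auto split: if_splits)
  have mixed: False if "N x" "\<not> N y" "[x = - 2 * y] (mod int p)" for x y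
    using N_cong[OF that(3)] that N_double[of y] by simp
  show "[x = y] (mod int p)"
  proof (cases "N x"; cases "N y")
    assume "\<not> N x" "\<not> N y"
    then show ?thesis using eq cong_mult_lcancel_p[of "- 2" x y] not_p_dvd_small by simp
  qed (use eq mixed[of x y] mixed[of y x] in \<open>auto simp: cong_sym\<close>)
qed

lemma diff_hamiltonian_F: "diff_hamiltonian p F"
  unfolding diff_hamiltonian_def
proof (intro allI impI)
  fix d x y and c :: "int \<Rightarrow> bool"
  assume d: "\<not> int p dvd d"
    and "\<forall>x y. [x = y] (mod int p) \<longrightarrow> c x = c y"
    and eq: "\<forall>k. c (F k) = c (d + F (k - d))"
  then have c_eq: "c x = c y" if "[x = y] (mod int p)" for x y using that by blast
  have "coprime d (int p)"
    using d p_prime by (metis coprime_commute prime_imp_coprime prime_nat_int_transfer)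
  then obtain d' where d': "[d * d' = 1] (mod int p)" using cong_solve_coprime_int by blast
  have rescale: "[d * (d' * z) = z] (mod int p)" for z
    using cong_mult[OF d' cong_refl[of z]] by (simp add: mult.assoc)
  define N' where "N' k \<longleftrightarrow> N (d * k)" for k
  \<comment> \<open>The symbol difference \<open>d * (1 - z)\<close> gets the coordinate
    \<open>z\<close>. The values \<open>- d * k\<close> and \<open>2 * d * k\<close> of
    \<open>F\<close> thereby become \<open>k + 1\<close> and \<open>- 2 * k + 1\<close>, and the
    shift by \<open>d\<close> becomes a shift by 1.\<close>
  define c' where "c' z = c (d - d * z)" for z
  have main: "c' ((if N' k then - 2 * k else k) + 1) =
      c' (if N' (k - 1) then - 2 * (k - 1) else k - 1)" for k
  proof -
    have "c' ((if N' k then - 2 * k else k) + 1) = c (F (d * k))"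
      unfolding c'_def by (intro c_eq cong_trans[OF _ cong_sym[OF F]])
        (simp add: N'_def algebra_simps)
    also have "\<dots> = c (d + F (d * k - d))" using eq by blast
    also have "\<dots> = c (d + (if N (d * k - d) then 2 * (d * k - d) else - (d * k - d)))"
      by (rule c_eq[OF cong_add[OF cong_refl F]])
    also have "\<dots> = c' (if N' (k - 1) then - 2 * (k - 1) else k - 1)"
      unfolding c'_def N'_def by (simp add: algebra_simps)
    finally show ?thesis .
  qed
  interpret doubling_colouring "int p" N' c'
  proof
    show "odd (int p)" "int p > 0" using p_odd p_gt_3 by auto
  next
    fix x y :: int assume xy: "[x = y] (mod int p)"
    show "N' x \<longleftrightarrow> N' y" unfolding N'_def by (intro N_cong cong_scalar_left xy)
    show "c' x = c' y" unfolding c'_def by (intro c_eq cong_diff cong_refl cong_scalar_left xy)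
  next
    fix x show "N' (- 2 * x) \<longleftrightarrow> N' x"
      using N_double[of "d * x"] by (simp add: N'_def mult.left_commute)
  next
    show "\<not> N' 0" using N_0 by (simp add: N'_def)
  next
    obtain x where "N x" using N_ex by blast
    then show "\<exists>x. N' x" unfolding N'_def using N_cong[OF rescale] by blast
  next
    fix x assume "\<not> N' x" "\<not> N' (x + 1)"
    then show "c' x = c' (x + 2)" using main[of "x + 1"] by (simp add: algebra_simps)
  next
    fix x assume "\<not> N' x" "N' (x + 1)"
    moreover have "- 2 * x - 1 = - 2 * (x + 1) + 1" by simp
    ultimately show "c' x = c' (- 2 * x - 1)" using main[of "x + 1"] by (simp only: if_True if_False) simp
  next
    fix x assume x: "N' x" "N' (x - 2)"
    obtain m where m: "int p = 2 * m + 1" using p_odd by (elim oddE)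
    \<comment> \<open>From \<open>2 * m + 1 = p\<close> it follows that \<open>m\<close> inverts -2,
      so \<open>k\<close> is the half of \<open>x - 2\<close> and \<open>k - 1\<close> that of
      \<open>x\<close>.\<close>
    define k where "k = m * (x - 2)"
    have k: "[- 2 * k = x - 2] (mod int p)"
    proof -
      have "- 2 * k - (x - 2) = int p * (- (x - 2))" by (simp add: k_def m algebra_simps)
      then show ?thesis by (simp add: cong_iff_dvd_diff)
    qed
    have k1: "[- 2 * (k - 1) = x] (mod int p)" using cong_add[OF k cong_refl[of 2]] by simp
    have N'_half: "N' u \<longleftrightarrow> N' z" if "[- 2 * u = z] (mod int p)" for u z
      using N_double[of "d * u"] N_cong[OF cong_scalar_left[OF that, of d]]
      by (simp add: N'_def mult.left_commute)
    have "c' (- 2 * k + 1) = c' (- 2 * (k - 1))"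
      using main[of k] N'_half[OF k] N'_half[OF k1] x by simp
    moreover have "c' (- 2 * k + 1) = c' (x - 1)"
      unfolding c'_def using cong_add[OF k cong_refl[of 1]]
      by (intro c_eq cong_diff cong_refl cong_scalar_left) simp
    moreover have "c' (- 2 * (k - 1)) = c' x"
      unfolding c'_def by (intro c_eq cong_diff cong_refl cong_scalar_left k1)
    ultimately show "c' x = c' (x - 1)" by simp
  next
    fix x assume "\<not> N' x" "N' (x - 1)"
    then show "c' (2 - 2 * x) = c' (x + 1)" using main[of x] by (simp add: algebra_simps)
  qed
  have "c z = c' (d' * (d - z))" for z
    unfolding c'_def using c_eq[OF cong_diff[OF cong_refl[of d] rescale[of "d - z"]]] by simp
  then show "c x = c y" using c_const by metis
qed

lemma N_half:
  assumes "[- 2 * x = y] (mod int p)"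
  shows "N x \<longleftrightarrow> N y"
  using N_cong[OF assms] N_double[of x] by simp

lemma p_dvd_double_iff: "int p dvd 2 * x \<longleftrightarrow> int p dvd x"
  using p_prime not_p_dvd_small by (simp add: prime_dvd_mult_iff)

text \<open>Replacing \<open>F x\<close> by \<open>x + F (- x)\<close> exchanges doubling and
  reflection: \<open>2 * x\<close> arises where \<open>- x\<close> was reflected. Only 0 stays on
  the reflecting side, consistently, as both branches vanish there. The point \<open>v\<close> makes
  the new class nonempty.\<close>

lemma transpose_reflection_square:
  assumes "\<not> int p dvd v" "\<not> N v"
  shows "reflection_square p (\<lambda>x. \<not> int p dvd x \<and> \<not> N (- x)) (\<lambda>x. x + F (- x))"
proof
  fix x y :: int assume xy: "[x = y] (mod int p)"
  have "[- x = - y] (mod int p)" using xy by (simp add: cong_minus_minus_iff)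
  then show "(\<not> int p dvd x \<and> \<not> N (- x)) \<longleftrightarrow> (\<not> int p dvd y \<and> \<not> N (- y))"
    using cong_dvd_iff[OF xy] N_cong by simp
next
  fix x show "(\<not> int p dvd - 2 * x \<and> \<not> N (- (- 2 * x))) \<longleftrightarrow> (\<not> int p dvd x \<and> \<not> N (- x))"
    using N_double[of "- x"] p_dvd_double_iff[of x] by simp
next
  show "\<exists>x. \<not> int p dvd x \<and> \<not> N (- x)" using assms by (intro exI[of _ "- v"]) simp
next
  fix x :: int
  have "[x + F (- x) = x + (if N (- x) then 2 * (- x) else - (- x))] (mod int p)"
    by (rule cong_add[OF cong_refl F])
  also have "[x + (if N (- x) then 2 * (- x) else - (- x)) =
      (if \<not> int p dvd x \<and> \<not> N (- x) then 2 * x else - x)] (mod int p)"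
  proof (cases "int p dvd x")
    case True
    then have "\<not> N (- x)" using N_cong[of "- x" 0] N_0 by (simp add: cong_0_iff)
    moreover have "[2 * x = - x] (mod int p)" using True by (simp add: cong_iff_dvd_diff)
    ultimately show ?thesis using True by simp
  qed simp
  finally show "[x + F (- x) = (if \<not> int p dvd x \<and> \<not> N (- x) then 2 * x else - x)] (mod int p)" .
qed (use p_prime p_gt_3 in auto)

text \<open>Three rows and three columns carry two common symbols \<open>0\<close> and \<open>2 e\<close>, which gives a cycle of
  length three in the permutation between the corresponding rows of the conjugate.\<close>

lemma nu_reflection_square_eq_4:
  assumes v: "\<not> int p dvd v" "\<not> N v" and e: "\<not> int p dvd e"
    and N: "N (x - 2 * e)" "\<not> N (x - e)" "\<not> N x" "\<not> N (x + e)" "N (x + 2 * e)"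
  shows "\<nu> {..<p} (diff_square p F) = 4"
proof -
  interpret diff_latin p F by (rule diff_latin_F)
  define res where "res z = nat (z mod int p)" for z
  have p: "int p > 0" using p_gt_3 by simp
  have res_less: "res z < p" for z using p by (simp add: res_def nat_less_iff)
  have int_res: "[int (res z) = z] (mod int p)" for z using p by (simp add: res_def cong_def)
  have res_cong: "res y = res z" if "[y = z] (mod int p)" for y z
    using that by (simp add: res_def cong_def)
  have res_eq_iff: "res y = res z \<longleftrightarrow> int p dvd y - z" for y z
    using p by (simp add: res_def nat_eq_iff cong_def mod_eq_dvd_iff)
  have L: "diff_square p F (res a) (res b) = res c"
    if "[a + (if N (b - a) then 2 * (b - a) else - (b - a)) = c] (mod int p)" for a b c
  proof -
    have "[int (res a) + F (int (res b) - int (res a)) = a + F (b - a)] (mod int p)"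
      by (intro cong_add int_res F_cong cong_diff)
    also have "[a + F (b - a) = a + (if N (b - a) then 2 * (b - a) else - (b - a))] (mod int p)"
      by (rule cong_add[OF cong_refl F])
    also note that
    finally show ?thesis
      using res_cong by (simp add: diff_square_def res_def[symmetric])
  qed
  have double: "int p dvd 2 * z \<longleftrightarrow> int p dvd z" for z by (rule p_dvd_double_iff)
  obtain m where m: "int p = 2 * m + 1" using p_odd by (elim oddE)
  \<comment> \<open>\<open>m + 1\<close> inverts 2, so \<open>y\<close> is half of
    \<open>x + 2 * e\<close>. The columns \<open>2 * x\<close> and \<open>2 * x + 2 * e\<close>
    yield 0 and \<open>2 * e\<close> by reflection, the column \<open>y\<close> by doubling; the
    differences used there are the halves of \<open>x + 2 * e\<close> and
    \<open>x - 2 * e\<close>.\<close>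
  define y where "y = (m + 1) * (x + 2 * e)"
  have "2 * y = x + 2 * e + int p * (x + 2 * e)" by (simp add: y_def m algebra_simps)
  then have y: "[2 * y = x + 2 * e] (mod int p)" by (simp add: cong_iff_dvd_diff)
  have N1: "N (y - (x + 2 * e))"
  proof -
    have "[- 2 * (y - (x + 2 * e)) = 2 * (x + 2 * e) - (x + 2 * e)] (mod int p)"
      using cong_diff[OF cong_refl[of "2 * (x + 2 * e)"] y] by (simp add: algebra_simps)
    then show ?thesis using N_half N(5) by simp
  qed
  have N2: "N (y - x)"
  proof -
    have "[- 2 * (y - x) = 2 * x - (x + 2 * e)] (mod int p)"
      using cong_diff[OF cong_refl[of "2 * x"] y] by (simp add: algebra_simps)
    then show ?thesis using N_half N(1) by simp
  qed
  let ?A = "{res x, res (x + e), res (x + 2 * e)}" and ?B = "{res (2 * x), res (2 * x + 2 * e), res y}"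
  have card_A: "card ?A = 3" using e double[of e] by (simp add: res_eq_iff)
  show ?thesis
  proof (rule nu_diff_square_eq_4I[OF diff_hamiltonian_F])
    interpret t: reflection_square p "\<lambda>x. \<not> int p dvd x \<and> \<not> N (- x)" "\<lambda>x. x + F (- x)"
      by (rule transpose_reflection_square[OF v])
    show "diff_hamiltonian p (\<lambda>x. x + F (- x))" by (rule t.diff_hamiltonian_F)
  next
    show "res 0 < p" "res (2 * e) < p" by (rule res_less)+
    show "res 0 \<noteq> res (2 * e)" using e double[of e] by (simp add: res_eq_iff)
    show "?A \<subseteq> {..<p}" "?B \<subseteq> {..<p}" using res_less by auto
    show "?A \<noteq> {}" by simp
    show "?A \<noteq> {..<p}" using card_A p_gt_3 by (metis card_lessThan less_irrefl)
    show "card ?B \<le> card ?A" using card_A by (simp add: card_insert_if)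
  next
    fix i assume "i \<in> ?A"
    moreover have "diff_square p F (res x) (res (2 * x)) = res 0"
      by (rule L) (use N in simp)
    moreover have "diff_square p F (res (x + e)) (res (2 * x + 2 * e)) = res 0"
      by (rule L) (use N in simp)
    moreover have "diff_square p F (res (x + 2 * e)) (res y) = res 0"
      using cong_diff[OF y cong_refl[of "x + 2 * e"]] by (intro L) (simp only: N1 if_True, simp add: algebra_simps)
    ultimately show "\<exists>j\<in>?B. diff_square p F i j = res 0" by auto
  next
    fix i assume "i \<in> ?A"
    moreover have "diff_square p F (res (x + e)) (res (2 * x)) = res (2 * e)"
      by (rule L) (use N in simp)
    moreover have "diff_square p F (res (x + 2 * e)) (res (2 * x + 2 * e)) = res (2 * e)"
      by (rule L) (use N in simp)
    moreover have "diff_square p F (res x) (res y) = res (2 * e)"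
      using cong_diff[OF y cong_refl[of x]] by (intro L) (simp only: N2 if_True, simp add: algebra_simps)
    ultimately show "\<exists>j\<in>?B. diff_square p F i j = res (2 * e)" by auto
  qed
qed

end

section \<open>Order 19\<close>

primrec walk :: "('a \<Rightarrow> 'a) \<Rightarrow> nat \<Rightarrow> 'a \<Rightarrow> 'a list" where
  "walk g 0 x = []"
| "walk g (Suc m) x = x # walk g m (g x)"

lemma walk_numeral: "walk g (numeral k) x = x # walk g (pred_numeral k) (g x)"
  by (simp add: numeral_eq_Suc)

definition residues19 :: "nat list" where
  "residues19 = [0, 1, 2, 3, 4, 5, 6, 7, 8, 9, 10, 11, 12, 13, 14, 15, 16, 17, 18]"

lemma set_residues19: "set residues19 = {..<19}"
proof -
  have "residues19 = [0..<19]" by (simp add: residues19_def upt_conv_Cons)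
  then show ?thesis by (metis set_upt lessThan_atLeast0)
qed

definition covers :: "nat list \<Rightarrow> bool" where
  "covers w \<longleftrightarrow> list_all (\<lambda>x. x \<in> set w) residues19"

text \<open>The permutation from row 0 to row \<open>d\<close>, acting on symbols; \<open>g\<close>
  is the table of the inverse of \<open>f\<close>.\<close>

definition table_step :: "nat list \<Rightarrow> nat list \<Rightarrow> nat \<Rightarrow> nat \<Rightarrow> nat" where
  "table_step f g d x = (d + f ! ((g ! x + (19 - d)) mod 19)) mod 19"

definition table_diff :: "nat list \<Rightarrow> int \<Rightarrow> int" where
  "table_diff f x = int (f ! nat (x mod 19))"

lemma diff_hamiltonian_table_diff:
  assumes inverse: "list_all (\<lambda>x. g ! x < 19 \<and> f ! (g ! x) = x) residues19"
    and cover: "\<And>d. d \<in> set residues19 \<Longrightarrow> d \<noteq> 0 \<Longrightarrow> covers (walk (table_step f g d) 19 0)"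
  shows "diff_hamiltonian 19 (table_diff f)"
  unfolding diff_hamiltonian_def
proof (intro allI impI)
  fix d x y and c :: "int \<Rightarrow> bool"
  assume d: "\<not> int 19 dvd d" and "\<forall>x y. [x = y] (mod int 19) \<longrightarrow> c x = c y"
    and eq: "\<forall>k. c (table_diff f k) = c (d + table_diff f (k - d))"
  then have c_cong: "c x = c y" if "[x = y] (mod 19)" for x y using that by simp
  define e where "e = nat (d mod 19)"
  have "d mod 19 \<noteq> 0" using d by (simp add: dvd_eq_mod_eq_0)
  then have e: "e \<in> {1..18}" "int e = d mod 19"
    using pos_mod_bound[of 19 d] pos_mod_sign[of 19 d] by (auto simp: e_def nat_le_iff le_nat_iff)
  have step: "c (int (table_step f g e x)) = c (int x)" if "x < 19" for x
  proof -
    define k where "k = int (g ! x)"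
    have g: "g ! x < 19" "f ! (g ! x) = x"
      using inverse that by (auto simp: list_all_iff set_residues19)
    have "c (int x) = c (table_diff f k)" using g by (simp add: table_diff_def k_def)
    also have "\<dots> = c (d + table_diff f (k - d))" using eq by blast
    also have "nat ((k - d) mod 19) = (g ! x + (19 - e)) mod 19"
    proof -
      have "(k - d) mod 19 = (k - int e + 19) mod 19" unfolding e(2) by (simp add: mod_diff_right_eq)
      also have "k - int e + 19 = int (g ! x + (19 - e))" using e(1) by (simp add: k_def)
      finally show ?thesis by (simp add: nat_mod_as_int zmod_int)
    qed
    then have "c (d + table_diff f (k - d)) = c (int (table_step f g e x))"
      by (intro c_cong) (simp add: table_diff_def table_step_def cong_def zmod_int e(2) mod_simps)
    finally show ?thesis by simp
  qed
  have less: "table_step f g e x < 19" for x by (simp add: table_step_def)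
  have walk: "c (int z) = c (int w)" if "z \<in> set (walk (table_step f g e) m w)" "w < 19" for m w z
    using that by (induction m arbitrary: w) (use step less in force)+
  have "c x = c (int 0)" for x
  proof -
    have "nat (x mod 19) \<in> set (walk (table_step f g e) 19 0)"
      using cover[of e] e(1) by (auto simp: covers_def list_all_iff set_residues19 nat_less_iff)
    then have "c (int (nat (x mod 19))) = c (int 0)" by (rule walk) simp
    moreover have "c (int (nat (x mod 19))) = c x" by (intro c_cong) (simp add: cong_def)
    ultimately show ?thesis by simp
  qed
  then show "c x = c y" by metis
qed

lemma diff_hamiltonian_cong:
  assumes "diff_hamiltonian n F" and FG: "\<And>x. [F x = G x] (mod int n)"
  shows "diff_hamiltonian n G"
  unfolding diff_hamiltonian_def
proof (intro allI impI)
  fix d x y and c :: "int \<Rightarrow> bool"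
  assume d: "\<not> int n dvd d" and c: "\<forall>x y. [x = y] (mod int n) \<longrightarrow> c x = c y"
    and eq: "\<forall>k. c (G k) = c (d + G (k - d))"
  have "c (F k) = c (d + F (k - d))" for k
    using c eq FG[of k] cong_add[OF cong_refl FG[of "k - d"], of d] by blast
  then show "c x = c y" using assms(1) d c unfolding diff_hamiltonian_def by blast
qed

lemma diff_latin_table_diff:
  assumes f: "length f = 19" "distinct f" "list_all (\<lambda>x. x < 19) f"
    and diff: "distinct (map (\<lambda>x. (f ! x + (19 - x)) mod 19) residues19)"
  shows "diff_latin 19 (table_diff f)"
proof
  have f_less: "f ! x < 19" if "x < 19" for x
    using f that by (simp add: list_all_length)
  have residue: "nat (x mod 19) < 19" for x :: int by (simp add: nat_less_iff)
  have residue_eq: "[x = y] (mod int 19)" if "nat (x mod 19) = nat (y mod 19)" for x y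
    using that by (simp add: cong_def)
  fix x y :: int
  show "[table_diff f x = table_diff f y] (mod int 19)" if "[x = y] (mod int 19)"
    using that by (simp add: table_diff_def cong_def)
  show "[x = y] (mod int 19)" if "[table_diff f x = table_diff f y] (mod int 19)"
  proof -
    have "table_diff f x = table_diff f y"
      using that f_less[OF residue] by (simp add: table_diff_def cong_def)
    then show ?thesis
      using f residue by (intro residue_eq) (simp add: table_diff_def nth_eq_iff_index_eq)
  qed
  show "[x = y] (mod int 19)" if "[table_diff f x - x = table_diff f y - y] (mod int 19)"
  proof -
    have "int ((f ! a + (19 - a)) mod 19) = (table_diff f x - x) mod 19" if "a = nat (x mod 19)" for a x
    proof -
      have "int a = x mod 19" "a \<le> 19" using that residue[of x] by auto
      then have "int (f ! a + (19 - a)) = int (f ! a) - x mod 19 + 19" by simp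
      then have "int (f ! a + (19 - a)) mod 19 = (int (f ! a) - x mod 19) mod 19"
        by (simp only: mod_add_self2)
      also have "\<dots> = (table_diff f x - x) mod 19"
        using that by (simp add: table_diff_def mod_diff_right_eq)
      finally show ?thesis by (simp add: zmod_int)
    qed
    note table_diff_mod = this
    have inj: "inj_on (\<lambda>x. (f ! x + (19 - x)) mod 19) {..<19}"
      using diff by (simp only: distinct_map set_residues19)
    have "int ((f ! nat (x mod 19) + (19 - nat (x mod 19))) mod 19) =
        int ((f ! nat (y mod 19) + (19 - nat (y mod 19))) mod 19)"
      unfolding table_diff_mod[OF refl] using that by (simp add: cong_def)
    then have "(f ! nat (x mod 19) + (19 - nat (x mod 19))) mod 19 =
        (f ! nat (y mod 19) + (19 - nat (y mod 19))) mod 19"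
      by (simp only: of_nat_eq_iff)
    then have "nat (x mod 19) = nat (y mod 19)"
      by (rule inj_onD[OF inj]) (simp_all only: lessThan_iff residue)
    then show ?thesis by (rule residue_eq)
  qed
qed simp

text \<open>For the prime 19, no progression carries the required pattern; this table was found by a
  computer search.\<close>

definition table19 :: "nat list" where
  "table19 = [0, 3, 9, 4, 13, 17, 10, 2, 18, 15, 7, 14, 8, 11, 6, 1, 5, 16, 12]"

lemma diff_hamiltonian_table19: "diff_hamiltonian 19 (table_diff table19)"
proof (rule diff_hamiltonian_table_diff)
  let ?g = "[0, 15, 7, 1, 3, 16, 14, 10, 12, 2, 6, 13, 18, 4, 11, 9, 17, 5, 8] :: nat list"
  show "list_all (\<lambda>x. ?g ! x < 19 \<and> table19 ! (?g ! x) = x) residues19"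
    by (simp add: table19_def residues19_def)
  have "covers (walk (table_step table19 ?g 1) 19 0)"
    "covers (walk (table_step table19 ?g 2) 19 0)"
    "covers (walk (table_step table19 ?g 3) 19 0)"
    "covers (walk (table_step table19 ?g 4) 19 0)"
    "covers (walk (table_step table19 ?g 5) 19 0)"
    "covers (walk (table_step table19 ?g 6) 19 0)"
    "covers (walk (table_step table19 ?g 7) 19 0)"
    "covers (walk (table_step table19 ?g 8) 19 0)"
    "covers (walk (table_step table19 ?g 9) 19 0)"
    "covers (walk (table_step table19 ?g 10) 19 0)"
    "covers (walk (table_step table19 ?g 11) 19 0)"
    "covers (walk (table_step table19 ?g 12) 19 0)"
    "covers (walk (table_step table19 ?g 13) 19 0)"
    "covers (walk (table_step table19 ?g 14) 19 0)"
    "covers (walk (table_step table19 ?g 15) 19 0)"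
    "covers (walk (table_step table19 ?g 16) 19 0)"
    "covers (walk (table_step table19 ?g 17) 19 0)"
    "covers (walk (table_step table19 ?g 18) 19 0)"
    by (simp add: walk_numeral table_step_def table19_def covers_def residues19_def)+
  moreover fix d :: nat assume "d \<in> set residues19" "d \<noteq> 0"
  ultimately show "covers (walk (table_step table19 ?g d) 19 0)"
    unfolding residues19_def list.set by (elim insertE) simp_all
qed

definition table19_transposed :: "nat list" where
  "table19_transposed = [0, 13, 18, 8, 5, 11, 17, 15, 3, 16, 6, 10, 14, 4, 12, 9, 1, 7, 2]"

lemma diff_hamiltonian_table19_transposed: "diff_hamiltonian 19 (table_diff table19_transposed)"
proof (rule diff_hamiltonian_table_diff)
  let ?g = "[0, 16, 18, 8, 13, 4, 10, 17, 3, 15, 11, 5, 14, 1, 12, 7, 9, 6, 2] :: nat list"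
  show "list_all (\<lambda>x. ?g ! x < 19 \<and> table19_transposed ! (?g ! x) = x) residues19"
    by (simp add: table19_transposed_def residues19_def)
  have "covers (walk (table_step table19_transposed ?g 1) 19 0)"
    "covers (walk (table_step table19_transposed ?g 2) 19 0)"
    "covers (walk (table_step table19_transposed ?g 3) 19 0)"
    "covers (walk (table_step table19_transposed ?g 4) 19 0)"
    "covers (walk (table_step table19_transposed ?g 5) 19 0)"
    "covers (walk (table_step table19_transposed ?g 6) 19 0)"
    "covers (walk (table_step table19_transposed ?g 7) 19 0)"
    "covers (walk (table_step table19_transposed ?g 8) 19 0)"
    "covers (walk (table_step table19_transposed ?g 9) 19 0)"
    "covers (walk (table_step table19_transposed ?g 10) 19 0)"
    "covers (walk (table_step table19_transposed ?g 11) 19 0)"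
    "covers (walk (table_step table19_transposed ?g 12) 19 0)"
    "covers (walk (table_step table19_transposed ?g 13) 19 0)"
    "covers (walk (table_step table19_transposed ?g 14) 19 0)"
    "covers (walk (table_step table19_transposed ?g 15) 19 0)"
    "covers (walk (table_step table19_transposed ?g 16) 19 0)"
    "covers (walk (table_step table19_transposed ?g 17) 19 0)"
    "covers (walk (table_step table19_transposed ?g 18) 19 0)"
    by (simp add: walk_numeral table_step_def table19_transposed_def covers_def residues19_def)+
  moreover fix d :: nat assume "d \<in> set residues19" "d \<noteq> 0"
  ultimately show "covers (walk (table_step table19_transposed ?g d) 19 0)"
    unfolding residues19_def list.set by (elim insertE) simp_all
qed

lemma nu_table19: "\<nu> {..<19} (diff_square 19 (table_diff table19)) = 4"
proof -
  interpret diff_latin 19 "table_diff table19"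
    by (rule diff_latin_table_diff) (simp_all add: table19_def residues19_def)
  have transposed: "[table_diff table19_transposed x = x + table_diff table19 (- x)] (mod int 19)" for x
  proof -
    define a where "a = nat (x mod 19)"
    have a: "a < 19" "int a = x mod 19" by (simp_all add: a_def nat_less_iff)
    have "list_all (\<lambda>a. table19_transposed ! a = (a + table19 ! ((19 - a) mod 19)) mod 19) residues19"
      by (simp add: table19_def table19_transposed_def residues19_def)
    then have "table19_transposed ! a = (a + table19 ! ((19 - a) mod 19)) mod 19"
      using a(1) by (simp add: list_all_iff set_residues19)
    moreover have "(19 - a) mod 19 = nat ((- x) mod 19)"
    proof -
      have "(- x) mod 19 = (- x + 19) mod 19" by (rule mod_add_self2[symmetric])
      also have "- x + 19 = 19 - x" by simp
      also have "(19 - x) mod 19 = (19 - x mod 19) mod 19" by (rule mod_diff_right_eq[symmetric])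
      also have "19 - x mod 19 = int (19 - a)" using a by simp
      finally show ?thesis by (simp add: nat_mod_as_int zmod_int)
    qed
    ultimately show ?thesis
      using a(2) by (simp add: table_diff_def cong_def zmod_int a_def[symmetric] mod_add_left_eq)
  qed
  show ?thesis
  proof (rule nu_diff_square_eq_4I[OF diff_hamiltonian_table19])
    show "diff_hamiltonian 19 (\<lambda>x. x + table_diff table19 (- x))"
      by (rule diff_hamiltonian_cong[OF diff_hamiltonian_table19_transposed transposed])
  next
    \<comment> \<open>Symbol 0 is in the cells (3,1), (17,5), (14,11) and symbol 2 in (3,11),
      (17,1), (14,5): a cycle of length three.\<close>
    have "0 \<notin> {3, 17, 14 :: nat}" "0 \<in> {..<19 :: nat}" by simp_all
    then show "{3, 17, 14} \<noteq> {..<19 :: nat}" by metis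
    show "\<exists>j\<in>{1, 5, 11}. diff_square 19 (table_diff table19) i j = 0" if "i \<in> {3, 17, 14}" for i
      using that by (auto simp: diff_square_def table_diff_def table19_def)
    show "\<exists>j\<in>{1, 5, 11}. diff_square 19 (table_diff table19) i j = 2" if "i \<in> {3, 17, 14}" for i
      using that by (auto simp: diff_square_def table_diff_def table19_def)
  qed auto
qed

section \<open>Character sums\<close>

locale quadratic_character =
  fixes p :: nat
  assumes p_prime: "prime p" and p_gt_2: "p > 2"
begin

abbreviation \<chi> :: "int \<Rightarrow> int" where
  "\<chi> x \<equiv> Legendre x (int p)"

abbreviation residues :: "int set" where
  "residues \<equiv> {0..<int p}"

lemma prime_int_p: "prime (int p)"
  using p_prime by simp

lemma p_dvd_mult: "int p dvd a * b \<longleftrightarrow> int p dvd a \<or> int p dvd b"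
  using prime_int_p by (rule prime_dvd_mult_iff)

lemma p_dvd_power: "int p dvd a ^ Suc k \<longleftrightarrow> int p dvd a"
  by (rule prime_dvd_power_iff[OF prime_int_p]) simp

lemma not_p_dvd_1_2: "\<not> int p dvd 1" "\<not> int p dvd 2"
  using zdvd_imp_le[of "int p" 1] zdvd_imp_le[of "int p" 2] p_gt_2 by auto

lemma residue_eqI: "x \<in> residues \<Longrightarrow> y \<in> residues \<Longrightarrow> [x = y] (mod int p) \<Longrightarrow> x = y"
  by (simp add: cong_def)

lemma mod_residue [simp]: "x mod int p \<in> residues"
  using p_gt_2 by simp

lemma chi_cong:
  assumes "[x = y] (mod int p)"
  shows "\<chi> x = \<chi> y"
proof -
  have "[a = x] (mod int p) \<longleftrightarrow> [a = y] (mod int p)" for a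
    using assms cong_trans cong_sym by blast
  then show ?thesis by (simp add: Legendre_def QuadRes_def cong_sym_eq[of _ 0])
qed

lemma chi_eq_0_iff: "\<chi> x = 0 \<longleftrightarrow> int p dvd x"
  by (simp add: Legendre_def cong_0_iff)

lemma chi_cases: "\<chi> x = 0 \<or> \<chi> x = 1 \<or> \<chi> x = - 1"
  by (simp add: Legendre_def)

lemma chi_mult: "\<chi> (x * y) = \<chi> x * \<chi> y"
proof (cases "int p dvd x * y")
  case True
  then show ?thesis using chi_eq_0_iff p_dvd_mult by (metis mult_eq_0_iff)
next
  case False
  then have xy: "\<not> int p dvd x" "\<not> int p dvd y" by auto
  have euler: "[\<chi> a = a ^ ((p - 1) div 2)] (mod int p)" for a
    using euler_criterion[OF p_prime, of a] p_gt_2 by simp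
  have "[\<chi> (x * y) = (x * y) ^ ((p - 1) div 2)] (mod int p)" by (rule euler)
  also have "[(x * y) ^ ((p - 1) div 2) = \<chi> x * \<chi> y] (mod int p)"
    unfolding power_mult_distrib by (intro cong_mult cong_sym[OF euler])
  finally have "int p dvd \<chi> (x * y) - \<chi> x * \<chi> y" by (simp add: cong_iff_dvd_diff)
  moreover have "\<bar>\<chi> (x * y) - \<chi> x * \<chi> y\<bar> < int p"
    using chi_cases[of x] chi_cases[of y] chi_cases[of "x * y"] p_gt_2 by auto
  ultimately show ?thesis
    using zdvd_not_zless[of "\<bar>\<chi> (x * y) - \<chi> x * \<chi> y\<bar>" "int p"] by auto
qed

lemma chi_square: "\<not> int p dvd x \<Longrightarrow> \<chi> (x ^ 2) = 1"
  unfolding power2_eq_square chi_mult using chi_cases[of x] chi_eq_0_iff[of x] by auto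

lemma chi_square_mult: "\<not> int p dvd x \<Longrightarrow> \<chi> (x ^ 2 * y) = \<chi> y"
  unfolding chi_mult using chi_square by simp

lemma chi_1: "\<chi> 1 = 1"
  using chi_square[of 1] not_p_dvd_1_2 by simp

lemma chi_sq_eq: "\<chi> x * \<chi> x = (if int p dvd x then 0 else 1)"
  using chi_cases[of x] chi_eq_0_iff[of x] by auto

section \<open>Substitutions in sums over all residues\<close>

lemma sum_reindex:
  assumes f: "\<And>x y. [x = y] (mod int p) \<Longrightarrow> f x = f y"
    and g: "\<And>x y. x \<in> residues \<Longrightarrow> y \<in> residues \<Longrightarrow> [g x = g y] (mod int p) \<Longrightarrow> x = y"
  shows "(\<Sum>x\<in>residues. f (g x)) = (\<Sum>x\<in>residues. f x)"
proof -
  have inj: "inj_on (\<lambda>x. g x mod int p) residues"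
    by (rule inj_onI, rule g) (simp_all add: cong_def)
  then have "(\<lambda>x. g x mod int p) ` residues = residues"
    by (intro endo_inj_surj) auto
  then have "(\<Sum>x\<in>residues. f x) = (\<Sum>x\<in>residues. f (g x mod int p))"
    using sum.reindex[OF inj, of f] by simp
  also have "\<dots> = (\<Sum>x\<in>residues. f (g x))"
    by (intro sum.cong refl f) simp
  finally show ?thesis by simp
qed

lemma sum_affine:
  assumes f: "\<And>x y. [x = y] (mod int p) \<Longrightarrow> f x = f y" and a: "\<not> int p dvd a"
  shows "(\<Sum>x\<in>residues. f (a * x + b)) = (\<Sum>x\<in>residues. f x)"
proof (rule sum_reindex[OF f])
  fix x y assume xy: "x \<in> residues" "y \<in> residues" and "[a * x + b = a * y + b] (mod int p)"
  then have "int p dvd a * (x - y)" by (simp add: cong_iff_dvd_diff algebra_simps)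
  then have "[x = y] (mod int p)" using a p_dvd_mult by (simp add: cong_iff_dvd_diff)
  then show "x = y" by (rule residue_eqI[OF xy])
qed

text \<open>Fermat's inverse. As \<open>p > 2\<close>, it sends 0 to 0, so inversion permutes all
  residues and can be substituted in complete sums.\<close>

definition inv_mod :: "int \<Rightarrow> int" where
  "inv_mod x = x ^ (p - 2)"

lemma mult_inv_mod:
  assumes "\<not> int p dvd x"
  shows "[x * inv_mod x = 1] (mod int p)"
proof -
  have "x * inv_mod x = x ^ (p - 1)"
    using p_gt_2 by (simp add: inv_mod_def Suc_diff_Suc numeral_2_eq_2 flip: power_Suc)
  moreover have "x ^ (p - 1) = (x ^ ((p - 1) div 2)) ^ 2"
    using prime_odd_nat[OF p_prime] p_gt_2 by (simp flip: power_mult)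
  moreover have "[(x ^ ((p - 1) div 2)) ^ 2 = \<chi> x ^ 2] (mod int p)"
    by (intro cong_pow cong_sym[OF euler_criterion[OF p_prime]]) (use p_gt_2 in simp)
  moreover have "\<chi> x ^ 2 = 1" using chi_sq_eq[of x] assms by (simp add: power2_eq_square)
  ultimately show ?thesis by simp
qed

lemma inv_mod_dvd: "int p dvd inv_mod x \<longleftrightarrow> int p dvd x"
proof -
  have "p - 2 = Suc (p - 3)" using p_gt_2 by simp
  then show ?thesis using p_dvd_power[of x "p - 3"] by (simp only: inv_mod_def)
qed

lemma sum_inv_mod:
  assumes f: "\<And>x y. [x = y] (mod int p) \<Longrightarrow> f x = f y"
  shows "(\<Sum>x\<in>residues. f (inv_mod x)) = (\<Sum>x\<in>residues. f x)"
proof (rule sum_reindex[OF f])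
  fix x y assume xy: "x \<in> residues" "y \<in> residues" and eq: "[inv_mod x = inv_mod y] (mod int p)"
  show "x = y"
  proof (rule residue_eqI[OF xy])
    show "[x = y] (mod int p)"
    proof (cases "int p dvd x")
      case True
      then have "int p dvd y" using cong_dvd_iff[OF eq] inv_mod_dvd by simp
      with True show ?thesis by (simp add: cong_iff_dvd_diff)
    next
      case False
      then have y: "\<not> int p dvd y" using cong_dvd_iff[OF eq] inv_mod_dvd by simp
      have "[x * (y * inv_mod y) = x * 1] (mod int p)" by (intro cong_mult mult_inv_mod y cong_refl)
      moreover have "[y * (x * inv_mod x) = y * 1] (mod int p)" by (intro cong_mult mult_inv_mod False cong_refl)
      moreover have "[x * (y * inv_mod x) = x * (y * inv_mod y)] (mod int p)" by (intro cong_mult eq cong_refl)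
      moreover have "x * (y * inv_mod x) = y * (x * inv_mod x)" by simp
      ultimately show ?thesis by (metis cong_sym cong_trans mult.right_neutral)
    qed
  qed
qed

lemma card_sqrt: "int (card {x \<in> residues. int p dvd x ^ 2 - t}) = 1 + \<chi> t"
proof (cases "int p dvd t")
  case True
  then have "int p dvd x ^ 2 - t \<longleftrightarrow> int p dvd x" for x
    using p_dvd_power[of x 1] by (simp add: dvd_diff_left_iff numeral_2_eq_2)
  then have "{x \<in> residues. int p dvd x ^ 2 - t} = {0}"
    using p_gt_2 by (auto dest: zdvd_imp_le)
  then show ?thesis using True chi_eq_0_iff by simp
next
  case t: False
  show ?thesis
  proof (cases "QuadRes (int p) t")
    case True
    then obtain y where y: "[y ^ 2 = t] (mod int p)" by (auto simp: QuadRes_def)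
    have p_y: "\<not> int p dvd y" using t cong_dvd_iff[OF y] p_dvd_power[of y 1] by (simp add: numeral_2_eq_2)
    have "int p dvd x ^ 2 - t \<longleftrightarrow> [x = y] (mod int p) \<or> [x = - y] (mod int p)" for x
    proof -
      have "int p dvd x ^ 2 - t \<longleftrightarrow> [x ^ 2 = t] (mod int p)" by (simp add: cong_iff_dvd_diff)
      also have "\<dots> \<longleftrightarrow> [x ^ 2 = y ^ 2] (mod int p)" using y by (meson cong_sym cong_trans)
      also have "\<dots> \<longleftrightarrow> int p dvd (x - y) * (x + y)"
        by (simp add: cong_iff_dvd_diff power2_eq_square algebra_simps)
      finally show ?thesis by (simp add: p_dvd_mult cong_iff_dvd_diff)
    qed
    then have "{x \<in> residues. int p dvd x ^ 2 - t} = {y mod int p, (- y) mod int p}"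
      using mod_residue by (auto simp: cong_def)
    moreover have "y mod int p \<noteq> (- y) mod int p"
      using p_y p_dvd_mult[of 2 y] not_p_dvd_1_2 by (auto simp: mod_eq_dvd_iff)
    ultimately show ?thesis using True t by (simp add: Legendre_def cong_0_iff)
  next
    case False
    then have "{x \<in> residues. int p dvd x ^ 2 - t} = {}"
      by (auto simp: QuadRes_def cong_iff_dvd_diff)
    then have "card {x \<in> residues. int p dvd x ^ 2 - t} = 0" by (simp only: card.empty)
    then show ?thesis using False t by (simp add: Legendre_def cong_0_iff)
  qed
qed

lemma card_quadratic: "int (card {x \<in> residues. int p dvd x ^ 2 - t * x + b}) = 1 + \<chi> (t ^ 2 - 4 * b)"
proof -
  have ind: "int (card {x \<in> residues. P x}) = (\<Sum>x\<in>residues. of_bool (P x))" for P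
    by (auto simp: Int_def intro!: arg_cong[where f = card])
  have "int p dvd x ^ 2 - t * x + b \<longleftrightarrow> int p dvd (2 * x + (- t)) ^ 2 - (t ^ 2 - 4 * b)" for x
  proof -
    have "(2 * x + (- t)) ^ 2 - (t ^ 2 - 4 * b) = 2 * (2 * (x ^ 2 - t * x + b))"
      by (simp add: power2_eq_square algebra_simps)
    then show ?thesis using p_dvd_mult not_p_dvd_1_2 by metis
  qed
  then have "int (card {x \<in> residues. int p dvd x ^ 2 - t * x + b}) =
      (\<Sum>x\<in>residues. of_bool (int p dvd (2 * x + (- t)) ^ 2 - (t ^ 2 - 4 * b)))"
    unfolding ind by simp
  also have "\<dots> = (\<Sum>x\<in>residues. of_bool (int p dvd x ^ 2 - (t ^ 2 - 4 * b)))"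
  proof (rule sum_affine)
    fix x y :: int assume "[x = y] (mod int p)"
    then have "[x ^ 2 - (t ^ 2 - 4 * b) = y ^ 2 - (t ^ 2 - 4 * b)] (mod int p)"
      by (intro cong_diff cong_pow cong_refl)
    then have "int p dvd x ^ 2 - (t ^ 2 - 4 * b) \<longleftrightarrow> int p dvd y ^ 2 - (t ^ 2 - 4 * b)"
      by (rule cong_dvd_iff)
    then show "(of_bool (int p dvd x ^ 2 - (t ^ 2 - 4 * b)) :: int) = of_bool (int p dvd y ^ 2 - (t ^ 2 - 4 * b))"
      by simp
  qed (use not_p_dvd_1_2 in simp)
  also have "\<dots> = 1 + \<chi> (t ^ 2 - 4 * b)" unfolding ind[symmetric] by (rule card_sqrt)
  finally show ?thesis .
qed

lemma sum_over_squares: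
  assumes f: "\<And>x y. [x = y] (mod int p) \<Longrightarrow> f x = f y"
  shows "(\<Sum>x\<in>residues. f (x ^ 2)) = (\<Sum>t\<in>residues. f t) + (\<Sum>t\<in>residues. \<chi> t * f t :: int)"
proof -
  have "f (x ^ 2) = (\<Sum>t\<in>residues. if int p dvd x ^ 2 - t then f t else 0)" for x
  proof -
    have "(\<Sum>t\<in>residues. if int p dvd x ^ 2 - t then f t else 0) =
        (\<Sum>t\<in>residues. if t = x ^ 2 mod int p then f t else 0)"
    proof (intro sum.cong refl)
      fix t assume "t \<in> residues"
      then have "int p dvd x ^ 2 - t \<longleftrightarrow> t = x ^ 2 mod int p"
        using mod_eq_dvd_iff[of "x ^ 2" "int p" t] by auto
      then show "(if int p dvd x ^ 2 - t then f t else 0) = (if t = x ^ 2 mod int p then f t else 0)"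
        by simp
    qed
    also have "\<dots> = f (x ^ 2 mod int p)" using mod_residue by simp
    also have "\<dots> = f (x ^ 2)" by (rule f) simp
    finally show ?thesis by simp
  qed
  then have "(\<Sum>x\<in>residues. f (x ^ 2)) = (\<Sum>x\<in>residues. \<Sum>t\<in>residues. if int p dvd x ^ 2 - t then f t else 0)"
    by simp
  also have "\<dots> = (\<Sum>t\<in>residues. \<Sum>x\<in>residues. if int p dvd x ^ 2 - t then f t else 0)"
    by (rule sum.swap)
  also have "\<dots> = (\<Sum>t\<in>residues. int (card {x \<in> residues. int p dvd x ^ 2 - t}) * f t)"
    by (intro sum.cong refl) (simp add: sum.If_cases Int_def)
  also have "\<dots> = (\<Sum>t\<in>residues. (1 + \<chi> t) * f t)" by (simp only: card_sqrt)
  finally show ?thesis by (simp add: sum.distrib algebra_simps)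
qed

lemma sum_chi: "(\<Sum>x\<in>residues. \<chi> x) = 0"
  using sum_over_squares[of "\<lambda>_. 1"] by simp

lemma sum_chi_shift: "(\<Sum>x\<in>residues. \<chi> (x + a)) = 0"
  using sum_affine[of \<chi> 1 a] chi_cong sum_chi not_p_dvd_1_2 by simp

lemma sum_remove_0:
  assumes "\<And>x. \<not> int p dvd x \<Longrightarrow> f x = g x"
  shows "(\<Sum>x\<in>residues. f x) - f 0 = (\<Sum>x\<in>residues. g x) - (g 0 :: int)"
proof -
  have "x \<in> residues \<Longrightarrow> x \<noteq> 0 \<Longrightarrow> \<not> int p dvd x" for x
    by (auto dest: zdvd_imp_le)
  then have "(\<Sum>x\<in>residues - {0}. f x) = (\<Sum>x\<in>residues - {0}. g x)"
    by (intro sum.cong refl assms) auto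
  moreover have "0 \<in> residues" using p_gt_2 by simp
  ultimately show ?thesis by (simp add: sum_diff1)
qed

text \<open>After a translation, dividing by \<open>x ^ 2\<close> and substituting the inverse of
  \<open>x\<close> makes the argument linear. The linear sum vanishes, and -1 is the correction for
  the value \<open>\<chi> 1\<close> that the substitution adds at 0.\<close>

lemma sum_chi_pair:
  assumes "\<not> int p dvd a - b"
  shows "(\<Sum>x\<in>residues. \<chi> ((x + a) * (x + b))) = - 1"
proof -
  have ba: "\<not> int p dvd b - a" using assms by (metis dvd_minus_iff minus_diff_eq)
  have c: "[x = y] (mod int p) \<Longrightarrow> \<chi> (x * (x + (b - a))) = \<chi> (y * (y + (b - a)))" for x y
    by (intro chi_cong cong_mult cong_add cong_refl)
  have "(\<Sum>x\<in>residues. \<chi> ((x + a) * (x + b))) = (\<Sum>x\<in>residues. \<chi> (x * (x + (b - a))))"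
    using sum_affine[where f = "\<lambda>x. \<chi> (x * (x + (b - a)))" and a = 1 and b = a, OF c] not_p_dvd_1_2
    by (simp add: algebra_simps)
  also have "\<dots> - \<chi> (0 * (0 + (b - a))) = (\<Sum>x\<in>residues. \<chi> ((b - a) * inv_mod x + 1)) - \<chi> ((b - a) * inv_mod 0 + 1)"
  proof (rule sum_remove_0)
    fix x assume x: "\<not> int p dvd x"
    have "[x ^ 2 * ((b - a) * inv_mod x + 1) = x * (x + (b - a))] (mod int p)"
      using cong_add[OF cong_mult[OF cong_refl[of "(b - a) * x"] mult_inv_mod[OF x]] cong_refl[of "x ^ 2"]]
      by (simp add: power2_eq_square algebra_simps)
    then show "\<chi> (x * (x + (b - a))) = \<chi> ((b - a) * inv_mod x + 1)"
      using chi_cong chi_square_mult[OF x] by metis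
  qed
  also have "inv_mod 0 = 0" using p_gt_2 by (simp add: inv_mod_def)
  also have "(\<Sum>x\<in>residues. \<chi> ((b - a) * inv_mod x + 1)) = (\<Sum>x\<in>residues. \<chi> ((b - a) * x + 1))"
    by (rule sum_inv_mod) (intro chi_cong cong_add cong_mult cong_refl)
  also have "\<dots> = (\<Sum>x\<in>residues. \<chi> x)"
    by (rule sum_affine[OF chi_cong ba])
  finally show ?thesis using chi_1 chi_eq_0_iff[of 0] by (simp add: sum_chi)
qed



lemma sum_chi_quadratic:
  assumes "\<not> int p dvd a - b"
  shows "(\<Sum>t\<in>residues. \<chi> ((t - a) * (t - b))) = - 1"
  using sum_chi_pair[of "- a" "- b"] assms dvd_diff_commute[of "int p" a b] by simp

text \<open>Both sides count, up to sign, points on two elliptic curves related by an isogeny of degree two.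
  The left side is the sum of \<open>\<chi> (t + a)\<close> over the solutions of \<open>x\<^sup>2 - t x + b = 0\<close>.\<close>

lemma sum_chi_isogeny:
  assumes b: "\<not> int p dvd b"
  shows "(\<Sum>x\<in>residues. \<chi> (x * (x ^ 2 + a * x + b))) =
    (\<Sum>x\<in>residues. \<chi> (x * (x ^ 2 - 2 * a * x + (a ^ 2 - 4 * b))))"
proof -
  let ?q = "\<lambda>x t. int p dvd x ^ 2 - t * x + b"
  have term_eq: "\<chi> (x * (x ^ 2 + a * x + b)) = (\<Sum>t\<in>residues. if ?q x t then \<chi> (t + a) else 0)"
    if x: "x \<in> residues" for x
  proof (cases "int p dvd x")
    case True
    then have "\<not> ?q x t" for t
      using b by (metis dvd_add_right_iff dvd_diff dvd_mult power2_eq_square)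
    then show ?thesis using True chi_eq_0_iff by simp
  next
    case False
    \<comment> \<open>For \<open>x\<close> prime to \<open>p\<close> the quadratic condition is
      linear in \<open>t\<close>, with solution \<open>x + b / x\<close>; here \<open>s + a\<close>
      is the x-coordinate of the isogeny.\<close>
    define s where "s = (x + b * inv_mod x) mod int p"
    have s: "[x * s = x ^ 2 + b] (mod int p)"
    proof -
      have "[x * s = x * (x + b * inv_mod x)] (mod int p)"
        unfolding s_def by (intro cong_mult cong_refl) simp
      also have "x * (x + b * inv_mod x) = x ^ 2 + b * (x * inv_mod x)"
        by (simp add: power2_eq_square algebra_simps)
      also have "[\<dots> = x ^ 2 + b * 1] (mod int p)"
        by (intro cong_add cong_mult cong_refl mult_inv_mod False)
      finally show ?thesis by simp
    qed
    have "?q x t \<longleftrightarrow> t = s" if "t \<in> residues" for t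
    proof -
      have "?q x t \<longleftrightarrow> [x * t = x ^ 2 + b] (mod int p)"
        using dvd_diff_commute[of "int p" "x * t" "x ^ 2 + b"] by (simp add: cong_iff_dvd_diff algebra_simps)
      also have "\<dots> \<longleftrightarrow> [x * t = x * s] (mod int p)" using s cong_trans cong_sym by blast
      also have "\<dots> \<longleftrightarrow> int p dvd x * (t - s)" by (simp add: cong_iff_dvd_diff algebra_simps)
      also have "\<dots> \<longleftrightarrow> [t = s] (mod int p)" using False by (simp add: p_dvd_mult cong_iff_dvd_diff)
      also have "\<dots> \<longleftrightarrow> t = s" using that residue_eqI[of t s] mod_residue by (auto simp: s_def)
      finally show ?thesis .
    qed
    then have "(\<Sum>t\<in>residues. if ?q x t then \<chi> (t + a) else 0) = (\<Sum>t\<in>residues. if t = s then \<chi> (t + a) else 0)"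
      by (intro sum.cong refl) simp
    also have "\<dots> = \<chi> (s + a)" using mod_residue by (simp add: s_def)
    also have "\<dots> = \<chi> (x ^ 2 * (s + a))" using chi_square_mult[OF False] by simp
    also have "\<dots> = \<chi> (x * (x ^ 2 + a * x + b))"
    proof (rule chi_cong)
      have "[x * (x * s + a * x) = x * (x ^ 2 + b + a * x)] (mod int p)"
        by (intro cong_mult cong_add cong_refl s)
      then show "[x ^ 2 * (s + a) = x * (x ^ 2 + a * x + b)] (mod int p)"
        by (simp add: power2_eq_square algebra_simps)
    qed
    finally show ?thesis by simp
  qed
  have "(\<Sum>x\<in>residues. \<chi> (x * (x ^ 2 + a * x + b))) =
      (\<Sum>x\<in>residues. \<Sum>t\<in>residues. if ?q x t then \<chi> (t + a) else 0)"
    by (intro sum.cong refl term_eq)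
  also have "\<dots> = (\<Sum>t\<in>residues. \<Sum>x\<in>residues. if ?q x t then \<chi> (t + a) else 0)"
    by (rule sum.swap)
  also have "\<dots> = (\<Sum>t\<in>residues. int (card {x \<in> residues. ?q x t}) * \<chi> (t + a))"
    by (intro sum.cong refl) (simp add: sum.If_cases Int_def)
  also have "\<dots> = (\<Sum>t\<in>residues. (1 + \<chi> (t ^ 2 - 4 * b)) * \<chi> (t + a))" by (simp only: card_quadratic)
  also have "\<dots> = (\<Sum>t\<in>residues. \<chi> (t + a)) + (\<Sum>t\<in>residues. \<chi> ((t ^ 2 - 4 * b) * (t + a)))"
    by (simp add: chi_mult distrib_right sum.distrib)
  also have "\<dots> = (\<Sum>t\<in>residues. \<chi> ((t ^ 2 - 4 * b) * (t + a)))" by (simp add: sum_chi_shift)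
  also have "\<dots> = (\<Sum>t\<in>residues. \<chi> (((1 * t + (- a)) ^ 2 - 4 * b) * (1 * t + (- a) + a)))"
    by (rule sum_affine[symmetric])
      (use not_p_dvd_1_2 in \<open>auto intro!: chi_cong cong_mult cong_add cong_diff cong_pow\<close>)
  also have "\<dots> = (\<Sum>x\<in>residues. \<chi> (x * (x ^ 2 - 2 * a * x + (a ^ 2 - 4 * b))))"
    by (intro sum.cong refl arg_cong[where f = \<chi>]) (simp add: power2_eq_square algebra_simps)
  finally show ?thesis .
qed

text \<open>The curve y^2 = x (x - a) (x - b) has \<open>p + cubic_sum a b\<close> affine points, so
  for a nonsingular curve this is minus the trace of Frobenius.\<close>

definition cubic_sum :: "int \<Rightarrow> int \<Rightarrow> int" where
  "cubic_sum a b = (\<Sum>t\<in>residues. \<chi> (t * (t - a) * (t - b)))"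

lemma cubic_sum_commute: "cubic_sum a b = cubic_sum b a"
  by (simp add: cubic_sum_def mult.assoc mult.commute[of "_ - a"])

lemma cubic_sum_cong:
  assumes "[a = a'] (mod int p)" "[b = b'] (mod int p)"
  shows "cubic_sum a b = cubic_sum a' b'"
  unfolding cubic_sum_def by (intro sum.cong refl chi_cong cong_mult cong_diff assms cong_refl)

lemma cubic_arg_cong:
  assumes "[x = y] (mod int p)"
  shows "\<chi> (x * (x - a) * (x - b)) = \<chi> (y * (y - a) * (y - b))"
  by (intro chi_cong cong_mult cong_diff cong_refl assms)

lemma cubic_sum_shift: "cubic_sum (- a) (b - a) = cubic_sum a b"
proof -
  have "cubic_sum a b = (\<Sum>t\<in>residues. \<chi> ((1 * t + a) * (1 * t + a - a) * (1 * t + a - b)))"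
    unfolding cubic_sum_def
    by (rule sum_affine[symmetric, OF cubic_arg_cong]) (use not_p_dvd_1_2 in auto)
  also have "\<dots> = cubic_sum (- a) (b - a)"
    unfolding cubic_sum_def by (intro sum.cong refl arg_cong[where f = \<chi>]) (simp add: algebra_simps)
  finally show ?thesis by simp
qed

lemma cubic_sum_scale:
  assumes "\<not> int p dvd k"
  shows "cubic_sum (k * a) (k * b) = \<chi> k * cubic_sum a b"
proof -
  have "cubic_sum (k * a) (k * b) = (\<Sum>t\<in>residues. \<chi> ((k * t + 0) * (k * t + 0 - k * a) * (k * t + 0 - k * b)))"
    unfolding cubic_sum_def by (rule sum_affine[symmetric, OF cubic_arg_cong assms])
  also have "\<dots> = (\<Sum>t\<in>residues. \<chi> (k ^ 2 * (k * (t * (t - a) * (t - b)))))"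
    by (intro sum.cong refl arg_cong[where f = \<chi>]) (simp add: power2_eq_square algebra_simps)
  also have "\<dots> = (\<Sum>t\<in>residues. \<chi> k * \<chi> (t * (t - a) * (t - b)))"
    by (simp only: chi_square_mult[OF assms] chi_mult[of k])
  finally show ?thesis by (simp add: cubic_sum_def sum_distrib_left)
qed

lemma cubic_sum_scale_sq:
  assumes "\<not> int p dvd k"
  shows "(cubic_sum (k * a) (k * b)) ^ 2 = (cubic_sum a b) ^ 2"
  unfolding cubic_sum_scale[OF assms] power_mult_distrib
  using chi_sq_eq[of k] assms by (simp add: power2_eq_square)

text \<open>\<open>sum_chi_isogeny\<close> for the cubic with roots 0, \<open>a\<close>,
  \<open>b\<close>, in case the isogenous cubic splits as well. Its roots \<open>c\<close> and
  \<open>d\<close> are prescribed by sum and product, which stay rational integers even when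
  \<open>c\<close> and \<open>d\<close> involve a square root.\<close>

lemma cubic_sum_isogeny:
  assumes "\<not> int p dvd a * b"
    and "[c + d = - 2 * (a + b)] (mod int p)" "[c * d = (a - b) ^ 2] (mod int p)"
  shows "cubic_sum a b = cubic_sum c d"
proof -
  have "cubic_sum a b = (\<Sum>x\<in>residues. \<chi> (x * (x ^ 2 + (- (a + b)) * x + a * b)))"
    unfolding cubic_sum_def
    by (intro sum.cong refl arg_cong[where f = \<chi>]) (simp add: power2_eq_square algebra_simps)
  also have "\<dots> = (\<Sum>x\<in>residues. \<chi> (x * (x ^ 2 - 2 * (- (a + b)) * x + ((- (a + b)) ^ 2 - 4 * (a * b)))))"
    by (rule sum_chi_isogeny[OF assms(1)])
  also have "\<dots> = (\<Sum>x\<in>residues. \<chi> (x * (x ^ 2 - (c + d) * x + c * d)))"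
  proof (intro sum.cong refl chi_cong cong_mult cong_add cong_diff)
    show "[2 * (- (a + b)) = c + d] (mod int p)" using cong_sym[OF assms(2)] by simp
    have "(- (a + b)) ^ 2 - 4 * (a * b) = (a - b) ^ 2" by (simp add: power2_eq_square algebra_simps)
    then show "[(- (a + b)) ^ 2 - 4 * (a * b) = c * d] (mod int p)" using cong_sym[OF assms(3)] by simp
  qed simp_all
  also have "\<dots> = cubic_sum c d"
    unfolding cubic_sum_def
    by (intro sum.cong refl arg_cong[where f = \<chi>]) (simp add: power2_eq_square algebra_simps)
  finally show ?thesis .
qed

lemma sum_chi_quartic:
  assumes "\<not> int p dvd a - b"
  shows "(\<Sum>x\<in>residues. \<chi> ((x ^ 2 - a) * (x ^ 2 - b))) = cubic_sum a b - 1"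
proof -
  have "(\<Sum>x\<in>residues. \<chi> ((x ^ 2 - a) * (x ^ 2 - b))) =
      (\<Sum>t\<in>residues. \<chi> ((t - a) * (t - b))) + (\<Sum>t\<in>residues. \<chi> t * \<chi> ((t - a) * (t - b)))"
    by (rule sum_over_squares) (intro chi_cong cong_mult cong_diff cong_refl)
  then show ?thesis
    using sum_chi_quadratic[OF assms] by (simp add: cubic_sum_def chi_mult mult.assoc)
qed

text \<open>After expanding the square, the sum over \<open>l\<close> comes first: it is
  \<open>p - 1\<close> on the diagonal and -1 elsewhere. What remains is \<open>p * (p - 2)\<close>
  minus the square of a quadratic sum equal to -1.\<close>

lemma cubic_sum_second_moment: "(\<Sum>l\<in>residues. (cubic_sum 1 l) ^ 2) = int p ^ 2 - 2 * int p - 1"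
proof -
  let ?g = "\<lambda>x. \<chi> (x * (x - 1))"
  have inner: "(\<Sum>l\<in>residues. \<chi> ((x - l) * (y - l))) = (if x = y then int p else 0) - 1"
    if xy: "x \<in> residues" "y \<in> residues" for x y
  proof (cases "x = y")
    case False
    then have "\<not> int p dvd x - y" using residue_eqI[OF xy] by (auto simp: cong_iff_dvd_diff)
    then have "(\<Sum>l\<in>residues. \<chi> ((l - x) * (l - y))) = - 1" by (rule sum_chi_quadratic)
    moreover have "(x - l) * (y - l) = (l - x) * (l - y)" for l by (simp add: algebra_simps)
    ultimately show ?thesis using False by simp
  next
    case True
    have "\<chi> ((x - l) * (y - l)) = 1 - (if l = x then 1 else 0)" if "l \<in> residues" for l
      using residue_eqI[OF xy(1) that] True by (auto simp: chi_mult chi_sq_eq cong_iff_dvd_diff)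
    then have "(\<Sum>l\<in>residues. \<chi> ((x - l) * (y - l))) = (\<Sum>l\<in>residues. 1 - (if l = x then 1 else 0))"
      by (intro sum.cong refl)
    also have "\<dots> = int p - 1" using xy(1) by (simp add: sum_subtractf)
    finally show ?thesis using True by simp
  qed
  have "(cubic_sum 1 l) ^ 2 = (\<Sum>x\<in>residues. \<Sum>y\<in>residues. ?g x * ?g y * \<chi> ((x - l) * (y - l)))" for l
    by (simp add: cubic_sum_def power2_eq_square sum_product chi_mult mult_ac)
  then have "(\<Sum>l\<in>residues. (cubic_sum 1 l) ^ 2) =
      (\<Sum>l\<in>residues. \<Sum>x\<in>residues. \<Sum>y\<in>residues. ?g x * ?g y * \<chi> ((x - l) * (y - l)))"
    by simp
  also have "\<dots> = (\<Sum>x\<in>residues. \<Sum>l\<in>residues. \<Sum>y\<in>residues. ?g x * ?g y * \<chi> ((x - l) * (y - l)))"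
    by (rule sum.swap)
  also have "\<dots> = (\<Sum>x\<in>residues. \<Sum>y\<in>residues. \<Sum>l\<in>residues. ?g x * ?g y * \<chi> ((x - l) * (y - l)))"
    by (intro sum.cong refl sum.swap)
  also have "\<dots> = (\<Sum>x\<in>residues. \<Sum>y\<in>residues. ?g x * ?g y * ((if x = y then int p else 0) - 1))"
    by (intro sum.cong refl) (simp only: sum_distrib_left[symmetric] inner)
  also have "\<dots> = (\<Sum>x\<in>residues. \<Sum>y\<in>residues. (if x = y then int p * (?g x * ?g y) else 0) - ?g x * ?g y)"
    by (intro sum.cong refl) (simp add: algebra_simps)
  also have "\<dots> = (\<Sum>x\<in>residues. int p * (?g x * ?g x)) - (\<Sum>x\<in>residues. ?g x) ^ 2"
    by (simp add: sum_subtractf power2_eq_square sum_product)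
  also have "(\<Sum>x\<in>residues. ?g x) = - 1" using sum_chi_quadratic[of 0 1] not_p_dvd_1_2 by simp
  also have "(\<Sum>x\<in>residues. int p * (?g x * ?g x)) = int p * (int p - 2)"
  proof -
    have sq: "?g x * ?g x = 1 - (if x = 0 then 1 else 0) - (if x = 1 then 1 else 0)" if "x \<in> residues" for x
    proof -
      have "int p dvd x \<longleftrightarrow> x = 0" "int p dvd x - 1 \<longleftrightarrow> x = 1"
        using that p_gt_2 residue_eqI[OF that, of 0] residue_eqI[OF that, of 1] by (auto simp: cong_iff_dvd_diff)
      then show ?thesis using chi_sq_eq[of "x * (x - 1)"] p_dvd_mult by auto
    qed
    have "(\<Sum>x\<in>residues. ?g x * ?g x) = (\<Sum>x\<in>residues. 1 - (if x = 0 then 1 else 0) - (if x = 1 then 1 else 0))"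
      by (intro sum.cong refl sq)
    also have "\<dots> = int p - 2" using p_gt_2 by (simp add: sum_subtractf)
    finally show ?thesis by (simp add: sum_distrib_left[symmetric])
  qed
  finally show ?thesis by (simp add: power2_eq_square algebra_simps)
qed

section \<open>Progressions with an isolated triple\<close>

text \<open>For the values of \<open>\<chi>\<close> on a progression of length five, the left side is a multiple of the
  indicator function of the pattern \<open>-1, 1, 1, 1, -1\<close> and its negative; the right side is summable.\<close>

lemma window_identity:
  fixes a b c d e :: int
  shows "(1 - a) * (1 + b) * (1 + c) * (1 + d) * (1 - e) + (1 + a) * (1 - b) * (1 - c) * (1 - d) * (1 + e) =
    2 * (1 - a * b - a * c - a * d + a * e + b * c + b * d - b * e + c * d - c * e - d * e
      - a * b * c * d - b * c * d * e + a * b * d * e + a * b * c * e + a * c * d * e)"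
  by (simp add: algebra_simps)

text \<open>Each of these four-point sets is symmetric about a centre, so the product is a
  polynomial in a square and \<open>sum_chi_quartic\<close> applies; \<open>2 * x + m\<close> clears
  a half-integral centre.\<close>

lemma sum_window_quartic:
  assumes "\<not> int p dvd 3"
  shows "(\<Sum>x\<in>residues. \<chi> ((x - 2) * (x - 1) * x * (x + 1))) = cubic_sum 1 9 - 1"
    and "(\<Sum>x\<in>residues. \<chi> ((x - 1) * x * (x + 1) * (x + 2))) = cubic_sum 1 9 - 1"
    and "(\<Sum>x\<in>residues. \<chi> ((x - 2) * (x - 1) * (x + 1) * (x + 2))) = cubic_sum 1 4 - 1"
proof -
  have "\<not> int p dvd 2 ^ 3" using p_dvd_power[of 2 2] not_p_dvd_1_2 by (simp add: numeral_3_eq_3)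
  then have 8: "\<not> int p dvd 1 - 9" by simp
  have "\<not> int p dvd 2 ^ 2" using p_dvd_power[of 2 1] not_p_dvd_1_2 by (simp add: numeral_2_eq_2)
  then have 4: "\<not> int p dvd 4" by simp
  have c: "[x = y] (mod int p) \<Longrightarrow> \<chi> ((x ^ 2 - 1) * (x ^ 2 - 9)) = \<chi> ((y ^ 2 - 1) * (y ^ 2 - 9))" for x y
    by (intro chi_cong cong_mult cong_diff cong_pow cong_refl)
  have scaled: "(\<Sum>x\<in>residues. \<chi> (f x)) = cubic_sum 1 9 - 1"
    if f: "\<And>x. 4 ^ 2 * f x = ((2 * x + m) ^ 2 - 1) * ((2 * x + m) ^ 2 - 9)" for f m
  proof -
    have "\<chi> (f x) = \<chi> (((2 * x + m) ^ 2 - 1) * ((2 * x + m) ^ 2 - 9))" for x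
      using chi_square_mult[OF 4, of "f x"] by (simp only: f)
    then have "(\<Sum>x\<in>residues. \<chi> (f x)) = (\<Sum>x\<in>residues. \<chi> ((x ^ 2 - 1) * (x ^ 2 - 9)))"
      using sum_affine[OF c not_p_dvd_1_2(2), where b = m] by simp
    also have "\<dots> = cubic_sum 1 9 - 1" by (rule sum_chi_quartic[OF 8])
    finally show ?thesis .
  qed
  show "(\<Sum>x\<in>residues. \<chi> ((x - 2) * (x - 1) * x * (x + 1))) = cubic_sum 1 9 - 1"
    by (rule scaled[where m = "- 1"]) (simp add: power2_eq_square algebra_simps)
  show "(\<Sum>x\<in>residues. \<chi> ((x - 1) * x * (x + 1) * (x + 2))) = cubic_sum 1 9 - 1"
    by (rule scaled[where m = 1]) (simp add: power2_eq_square algebra_simps)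
  have "(\<Sum>x\<in>residues. \<chi> ((x - 2) * (x - 1) * (x + 1) * (x + 2))) = (\<Sum>x\<in>residues. \<chi> ((x ^ 2 - 1) * (x ^ 2 - 4)))"
    by (intro sum.cong refl arg_cong[where f = \<chi>]) (simp add: power2_eq_square algebra_simps)
  also have "\<dots> = cubic_sum 1 4 - 1"
    by (rule sum_chi_quartic) (use assms dvd_minus_iff[of "int p" 3] in simp)
  finally show "(\<Sum>x\<in>residues. \<chi> ((x - 2) * (x - 1) * (x + 1) * (x + 2))) = cubic_sum 1 4 - 1" .
qed

text \<open>The points -2, 0, 1, 2 have no centre of symmetry. Instead one root is moved to 0 and
  the variable inverted, which turns the quartic into a cubic. The second sum is the mirror image of
  the first.\<close>

lemma sum_window_gap:
  assumes "\<not> int p dvd 3" and "\<chi> (- 2) = 1"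
  shows "(\<Sum>x\<in>residues. \<chi> ((x - 2) * x * (x + 1) * (x + 2))) = cubic_sum 1 3 - 1"
    and "(\<Sum>x\<in>residues. \<chi> ((x - 2) * (x - 1) * x * (x + 2))) = cubic_sum 1 3 - 1"
proof -
  let ?f = "\<lambda>x. \<chi> ((x - 2) * x * (x + 1) * (x + 2))"
  let ?g = "\<lambda>y. \<chi> (y * (y + 2) * (y + 3) * (y + 4))"
  let ?h = "\<lambda>z. \<chi> ((1 + 2 * z) * (1 + 3 * z) * (1 + 4 * z))"
  have "\<not> int p dvd 2 ^ 2 * 3"
    using p_dvd_power[of 2 1] not_p_dvd_1_2 assms(1) p_dvd_mult[of "2 ^ 2" 3] by (simp add: numeral_2_eq_2)
  then have 12: "\<not> int p dvd 12" by simp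
  have 6: "\<not> int p dvd 6" using p_dvd_mult[of 2 3] not_p_dvd_1_2 assms(1) by simp
  have f: "[x = y] (mod int p) \<Longrightarrow> ?f x = ?f y" and g: "[x = y] (mod int p) \<Longrightarrow> ?g x = ?g y"
    and h: "[x = y] (mod int p) \<Longrightarrow> ?h x = ?h y"
    for x y by (intro chi_cong cong_mult cong_add cong_diff cong_refl; assumption)+
  have "(\<Sum>x\<in>residues. ?f x) = (\<Sum>y\<in>residues. ?g y)"
    using sum_affine[where f = ?g and a = 1 and b = "- 2", OF g] not_p_dvd_1_2 by (simp add: algebra_simps)
  moreover have "(\<Sum>y\<in>residues. ?g y) - ?g 0 = (\<Sum>y\<in>residues. ?h (inv_mod y)) - ?h (inv_mod 0)"
  proof (rule sum_remove_0)
    fix y assume y: "\<not> int p dvd y"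
    define z where "z = inv_mod y"
    have z: "[y * z = 1] (mod int p)" unfolding z_def by (rule mult_inv_mod[OF y])
    have shift: "[y * (1 + k * z) = y + k] (mod int p)" for k
      using cong_add[OF cong_refl[of y] cong_mult[OF cong_refl[of k] z]] by (simp add: algebra_simps)
    have "[y * ((y * (1 + 2 * z)) * (y * (1 + 3 * z)) * (y * (1 + 4 * z))) = y * ((y + 2) * (y + 3) * (y + 4))] (mod int p)"
      by (intro cong_mult shift cong_refl)
    then have "?g y = \<chi> (y * ((y * (1 + 2 * z)) * (y * (1 + 3 * z)) * (y * (1 + 4 * z))))"
      using chi_cong by (simp add: mult.assoc)
    also have "y * ((y * (1 + 2 * z)) * (y * (1 + 3 * z)) * (y * (1 + 4 * z))) =
        (y ^ 2) ^ 2 * ((1 + 2 * z) * (1 + 3 * z) * (1 + 4 * z))"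
      by (simp add: power2_eq_square mult_ac)
    also have "\<chi> \<dots> = ?h z" by (rule chi_square_mult) (use y p_dvd_power[of y 1] in \<open>simp add: numeral_2_eq_2\<close>)
    finally show "?g y = ?h (inv_mod y)" by (simp add: z_def)
  qed
  moreover have "(\<Sum>y\<in>residues. ?h (inv_mod y)) = (\<Sum>z\<in>residues. ?h z)" by (rule sum_inv_mod[OF h])
  moreover have "inv_mod 0 = 0" using p_gt_2 by (simp add: inv_mod_def)
  then have "?h (inv_mod 0) = 1" using chi_1 by simp
  moreover have "?g 0 = 0" using chi_eq_0_iff[of 0] by simp
  moreover have "(\<Sum>z\<in>residues. ?h z) = cubic_sum 1 3"
  proof -
    \<comment> \<open>\<open>?w\<close> sends the roots -1/4, -1/3, -1/2 to 0, 1, 3. Comparing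
      leading coefficients, (-12)^3 = 24 * 6^2 * (-2), so \<open>\<chi> (- 2) = 1\<close> absorbs
      the factor.\<close>
    let ?w = "\<lambda>z. - 12 * z + (- 3)"
    have "(6 ^ 2 * (- 2)) * ((1 + 2 * z) * (1 + 3 * z) * (1 + 4 * z)) = ?w z * (?w z - 1) * (?w z - 3)" for z :: int
      by (simp add: algebra_simps)
    then have "\<chi> (?w z * (?w z - 1) * (?w z - 3)) = \<chi> (6 ^ 2 * (- 2)) * ?h z" for z
      by (simp only: chi_mult[symmetric])
    moreover have "\<chi> (6 ^ 2 * (- 2)) = 1" by (simp only: chi_square_mult[OF 6] assms(2))
    ultimately have "?h z = \<chi> (?w z * (?w z - 1) * (?w z - 3))" for z
      by simp
    then have "(\<Sum>z\<in>residues. ?h z) = (\<Sum>z\<in>residues. \<chi> (?w z * (?w z - 1) * (?w z - 3)))" by simp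
    also have "\<dots> = cubic_sum 1 3"
      unfolding cubic_sum_def by (rule sum_affine[OF cubic_arg_cong]) (use 12 in simp_all)
    finally show ?thesis .
  qed
  ultimately show fsum: "(\<Sum>x\<in>residues. ?f x) = cubic_sum 1 3 - 1" by simp
  have "(\<Sum>x\<in>residues. \<chi> ((x - 2) * (x - 1) * x * (x + 2))) = (\<Sum>x\<in>residues. ?f (- 1 * x + 0))"
    by (intro sum.cong refl arg_cong[where f = \<chi>]) (simp add: algebra_simps)
  also have "\<dots> = (\<Sum>x\<in>residues. ?f x)"
    by (rule sum_affine[OF f]) (use not_p_dvd_1_2 in simp_all)
  finally show "(\<Sum>x\<in>residues. \<chi> ((x - 2) * (x - 1) * x * (x + 2))) = cubic_sum 1 3 - 1"
    using fsum by simp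
qed

text \<open>For the roots 1 and 4 the isogeny prescribes sum -10 and product 9, that is, the roots
  -1 and -9; the sign is a quadratic twist.\<close>

lemma cubic_sum_1_4: 
  assumes "\<not> int p dvd 3"
  shows "cubic_sum 1 4 = \<chi> (- 1) * cubic_sum 1 9"
proof -
  have "\<not> int p dvd 2 ^ 2" using p_dvd_power[of 2 1] not_p_dvd_1_2 by (simp add: numeral_2_eq_2)
  then have "cubic_sum 1 4 = cubic_sum (- 1 * 1) (- 1 * 9)"
    by (intro cubic_sum_isogeny) (simp_all add: cong_def)
  then show ?thesis using cubic_sum_scale[of "- 1" 1 9] not_p_dvd_1_2 by simp
qed

definition isolated_triple :: "int \<Rightarrow> int \<Rightarrow> bool" where
  "isolated_triple x e \<longleftrightarrow> \<chi> (x - 2 * e) = - 1 \<and> \<chi> (x - e) = 1 \<and> \<chi> x = 1 \<and> \<chi> (x + e) = 1 \<and> \<chi> (x + 2 * e) = - 1"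

text \<open>The negated pattern around \<open>x\<close> has \<open>\<chi> x = - 1\<close>;
  multiplying the progression by \<open>x\<close> gives the pattern itself, with centre
  \<open>x * x\<close> and difference \<open>x\<close>. Windows containing a zero of
  \<open>\<chi>\<close> are translates of 0 by at most 2, and there the values at 1, 2, 4 and their
  negatives kill one factor of each product.\<close>

lemma window_zero:
  assumes no: "\<And>x e. \<not> int p dvd e \<Longrightarrow> \<not> isolated_triple x e" and m2: "\<chi> (- 2) = 1"
  shows "(1 - \<chi> (x - 2)) * (1 + \<chi> (x - 1)) * (1 + \<chi> x) * (1 + \<chi> (x + 1)) * (1 - \<chi> (x + 2)) +
    (1 + \<chi> (x - 2)) * (1 - \<chi> (x - 1)) * (1 - \<chi> x) * (1 - \<chi> (x + 1)) * (1 + \<chi> (x + 2)) = 0"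
    (is "?P + ?Q = 0")
proof -
  have m1: "\<chi> (- 1) = 1 \<or> \<chi> (- 1) = - 1" using chi_cases[of "- 1"] chi_eq_0_iff[of "- 1"] not_p_dvd_1_2 by simp
  have "\<chi> (- 1 * 2) = \<chi> (- 1) * \<chi> 2" by (rule chi_mult)
  then have c2: "\<chi> 2 = \<chi> (- 1)" using m1 m2 by auto
  have "\<chi> (2 * 2) = 1" unfolding chi_mult using chi_sq_eq[of 2] not_p_dvd_1_2 by simp
  then have c4: "\<chi> 4 = 1" by simp
  have "\<chi> (2 * - 2) = \<chi> 2 * \<chi> (- 2)" by (rule chi_mult)
  then have cm4: "\<chi> (- 4) = \<chi> (- 1)" using m2 c2 by simp
  note facts = m2 c2 c4 cm4 chi_1
  have eval: "\<chi> (x + i) = \<chi> (i - j)" if "int p dvd x + j" for i j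
  proof (rule chi_cong)
    show "[x + i = i - j] (mod int p)" using that by (simp add: cong_iff_dvd_diff algebra_simps)
  qed
  have zero: "\<chi> 0 = 0" using chi_eq_0_iff[of 0] by simp
  show ?thesis
  proof (cases "\<exists>j\<in>{- 2, - 1, 0, 1, 2}. \<chi> (x + j) = 0")
    case True
    then obtain j where j: "j \<in> {- 2, - 1, 0, 1, 2}" "\<chi> (x + j) = 0" by blast
    then have "int p dvd x + j" using chi_eq_0_iff by blast
    note e = eval[OF this]
    have "\<chi> (x - 2) = \<chi> (- 2 - j)" "\<chi> (x - 1) = \<chi> (- 1 - j)" "\<chi> x = \<chi> (- j)"
      "\<chi> (x + 1) = \<chi> (1 - j)" "\<chi> (x + 2) = \<chi> (2 - j)"
      using e[of "- 2"] e[of "- 1"] e[of 0] e[of 1] e[of 2] by simp_all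
    then show ?thesis using j(1) m1 by (elim insertE disjE) (simp_all add: facts \<open>\<chi> 0 = 0\<close>)
  next
    case False
    then have nonzero: "\<chi> (x - 2) \<noteq> 0" "\<chi> (x - 1) \<noteq> 0" "\<chi> x \<noteq> 0" "\<chi> (x + 1) \<noteq> 0" "\<chi> (x + 2) \<noteq> 0"
      by simp_all
    note cases = chi_cases[of "x - 2"] chi_cases[of "x - 1"] chi_cases[of x] chi_cases[of "x + 1"] chi_cases[of "x + 2"]
    have "?P = 0"
      using no[of 1 x] not_p_dvd_1_2 cases nonzero by (auto simp: isolated_triple_def)
    moreover have "?Q = 0"
    proof (rule ccontr)
      assume "?Q \<noteq> 0"
      then have "\<chi> (x - 2) = 1" "\<chi> (x - 1) = - 1" "\<chi> x = - 1" "\<chi> (x + 1) = - 1" "\<chi> (x + 2) = 1"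
        using cases nonzero by auto
      then have "\<chi> (x * (x - 2)) = - 1" "\<chi> (x * (x - 1)) = 1" "\<chi> (x * x) = 1" "\<chi> (x * (x + 1)) = 1" "\<chi> (x * (x + 2)) = - 1"
        by (simp_all add: chi_mult)
      then have "isolated_triple (x * x) x"
        by (simp add: isolated_triple_def algebra_simps)
      moreover have "\<not> int p dvd x" using \<open>\<chi> x = - 1\<close> chi_eq_0_iff[of x] by auto
      ultimately show False using no by blast
    qed
    ultimately show ?thesis by (simp only: add_0_left)
  qed
qed

lemma cubic_sums_no_isolated_triple:
  assumes 3: "\<not> int p dvd 3" and m2: "\<chi> (- 2) = 1"
    and no: "\<And>x e. \<not> int p dvd e \<Longrightarrow> \<not> isolated_triple x e"
  shows "int p + 1 = (2 - \<chi> (- 1)) * cubic_sum 1 9 - 2 * cubic_sum 1 3"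
proof -
  define v where "v i x = \<chi> (x + i)" for i x
  have pair: "(\<Sum>x\<in>residues. v i x * v j x) = - 1" if "\<not> int p dvd i - j" for i j
    using sum_chi_pair[OF that] by (simp add: v_def chi_mult)
  have "\<not> int p dvd 2 * 2" using p_dvd_mult not_p_dvd_1_2 by blast
  then have small: "\<not> int p dvd - 1" "\<not> int p dvd - 2" "\<not> int p dvd - 3" "\<not> int p dvd - 4"
    using not_p_dvd_1_2 3 by simp_all
  have quads: "(\<Sum>x\<in>residues. v (- 2) x * v (- 1) x * v 0 x * v 1 x) = cubic_sum 1 9 - 1"
    "(\<Sum>x\<in>residues. v (- 1) x * v 0 x * v 1 x * v 2 x) = cubic_sum 1 9 - 1"
    "(\<Sum>x\<in>residues. v (- 2) x * v (- 1) x * v 1 x * v 2 x) = cubic_sum 1 4 - 1"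
    "(\<Sum>x\<in>residues. v (- 2) x * v (- 1) x * v 0 x * v 2 x) = cubic_sum 1 3 - 1"
    "(\<Sum>x\<in>residues. v (- 2) x * v 0 x * v 1 x * v 2 x) = cubic_sum 1 3 - 1"
    using sum_window_quartic[OF 3] sum_window_gap[OF 3 m2] by (simp_all add: v_def chi_mult)
  have "0 = (\<Sum>x\<in>residues. 2 * (1 - v (- 2) x * v (- 1) x - v (- 2) x * v 0 x - v (- 2) x * v 1 x + v (- 2) x * v 2 x
      + v (- 1) x * v 0 x + v (- 1) x * v 1 x - v (- 1) x * v 2 x + v 0 x * v 1 x - v 0 x * v 2 x - v 1 x * v 2 x
      - v (- 2) x * v (- 1) x * v 0 x * v 1 x - v (- 1) x * v 0 x * v 1 x * v 2 x
      + v (- 2) x * v (- 1) x * v 1 x * v 2 x + v (- 2) x * v (- 1) x * v 0 x * v 2 x + v (- 2) x * v 0 x * v 1 x * v 2 x))"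
    unfolding window_identity[symmetric] using window_zero[OF no m2] by (simp add: v_def)
  also have "\<dots> = 2 * (int p - (- 1) - (- 1) - (- 1) + (- 1) + (- 1) + (- 1) - (- 1) + (- 1) - (- 1) - (- 1)
      - (cubic_sum 1 9 - 1) - (cubic_sum 1 9 - 1) + (cubic_sum 1 4 - 1) + (cubic_sum 1 3 - 1) + (cubic_sum 1 3 - 1))"
    unfolding sum_distrib_left[symmetric] sum.distrib sum_subtractf quads using small by (simp add: pair)
  finally show ?thesis using cubic_sum_1_4[OF 3] by (simp add: algebra_simps)
qed

section \<open>Orbits of the Legendre parameter\<close>

definition ratio :: "int \<Rightarrow> int \<Rightarrow> int" where
  "ratio a b = a * inv_mod b mod int p"

lemma mult_ratio:
  assumes "\<not> int p dvd b"
  shows "[b * ratio a b = a] (mod int p)"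
proof -
  have "[b * ratio a b = b * (a * inv_mod b)] (mod int p)"
    unfolding ratio_def by (intro cong_mult cong_refl) simp
  also have "b * (a * inv_mod b) = a * (b * inv_mod b)" by simp
  also have "[\<dots> = a * 1] (mod int p)" by (intro cong_mult cong_refl mult_inv_mod assms)
  finally show ?thesis by simp
qed

lemma ratio_neq:
  assumes "\<not> int p dvd b" "\<not> int p dvd d" "\<not> int p dvd a * d - c * b"
  shows "ratio a b \<noteq> ratio c d"
proof
  assume eq: "ratio a b = ratio c d"
  have "[a * d = (b * ratio a b) * d] (mod int p)" by (intro cong_mult cong_refl cong_sym[OF mult_ratio] assms)
  also have "(b * ratio a b) * d = (d * ratio c d) * b" using eq by simp
  also have "[\<dots> = c * b] (mod int p)" by (intro cong_mult cong_refl mult_ratio assms)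
  finally show False using assms(3) by (simp add: cong_iff_dvd_diff)
qed

lemma cubic_sum_ratio:
  assumes "\<not> int p dvd b"
  shows "(cubic_sum 1 (ratio a b)) ^ 2 = (cubic_sum a b) ^ 2"
proof -
  have "(cubic_sum 1 (ratio a b)) ^ 2 = (cubic_sum (b * 1) (b * ratio a b)) ^ 2"
    by (rule cubic_sum_scale_sq[OF assms, symmetric])
  also have "cubic_sum (b * 1) (b * ratio a b) = cubic_sum b a"
    by (intro cubic_sum_cong mult_ratio assms) simp
  finally show ?thesis by (simp add: cubic_sum_commute)
qed

text \<open>For \<open>l = a / b\<close>, the quotient \<open>m / d\<close> is the \<open>j\<close>-invariant (up to a constant) of
  the curve \<open>y\<^sup>2 = x (x - a) (x - b)\<close>; it separates the orbits of \<open>l\<close>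
  under \<open>l \<mapsto> 1 / l\<close> and \<open>l \<mapsto> 1 - l\<close>.\<close>

definition has_invariant :: "int \<Rightarrow> int \<Rightarrow> int \<Rightarrow> bool" where
  "has_invariant m d l \<longleftrightarrow> \<not> int p dvd l * (1 - l) \<and>
    [(l ^ 2 - l + 1) ^ 3 * d = m * (l * (1 - l)) ^ 2] (mod int p)"

lemma has_invariant_unique:
  assumes "has_invariant m d l" "has_invariant m' d' l"
  shows "int p dvd m * d' - m' * d"
proof -
  let ?u = "(l * (1 - l)) ^ 2" and ?w = "(l ^ 2 - l + 1) ^ 3"
  have "[m * ?u = ?w * d] (mod int p)" "[m' * ?u = ?w * d'] (mod int p)"
    using assms by (simp_all add: has_invariant_def cong_sym)
  then have "[m * ?u * d' = ?w * d * d'] (mod int p)" "[m' * ?u * d = ?w * d' * d] (mod int p)"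
    by (simp_all only: cong_mult cong_refl)
  then have "[m * ?u * d' - m' * ?u * d = ?w * d * d' - ?w * d' * d] (mod int p)" by (rule cong_diff)
  then have "[?u * (m * d' - m' * d) = 0] (mod int p)" by (simp add: algebra_simps)
  then have "int p dvd ?u * (m * d' - m' * d)" by (simp add: cong_0_iff)
  moreover have "\<not> int p dvd ?u"
    using assms(1) p_dvd_power[of "l * (1 - l)" 1] by (simp add: has_invariant_def numeral_2_eq_2)
  ultimately show ?thesis using p_dvd_mult by blast
qed

lemma has_invariant_ratio:
  assumes "\<not> int p dvd a" "\<not> int p dvd b" "\<not> int p dvd a - b"
    and m: "m = (a ^ 2 - a * b + b ^ 2) ^ 3" and d: "d = (a * b * (a - b)) ^ 2"
  shows "has_invariant m d (ratio a b)"
proof -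
  define l where "l = ratio a b"
  have l: "[b * l = a] (mod int p)" unfolding l_def by (rule mult_ratio[OF assms(2)])
  have l1: "[b * (1 - l) = b - a] (mod int p)"
    using cong_diff[OF cong_refl[of b] l] by (simp add: algebra_simps)
  have "\<not> int p dvd b * l" using cong_dvd_iff[OF l] assms(1) by simp
  moreover have "\<not> int p dvd b * (1 - l)"
    using cong_dvd_iff[OF l1] assms(3) dvd_minus_iff[of "int p" "a - b"] by simp
  ultimately have units: "\<not> int p dvd l * (1 - l)" using p_dvd_mult by blast
  have "[(b * l) ^ 2 - (b * l) * b + b ^ 2 = a ^ 2 - a * b + b ^ 2] (mod int p)"
    by (intro cong_add cong_diff cong_mult cong_pow cong_refl l)
  then have h1: "[((b * l) ^ 2 - (b * l) * b + b ^ 2) ^ 3 * d = m * d] (mod int p)"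
    unfolding m by (intro cong_mult cong_pow cong_refl)
  have h2: "[m * ((b * l) * (b * (1 - l)) * b) ^ 2 = m * (a * (b - a) * b) ^ 2] (mod int p)"
    by (intro cong_mult cong_pow cong_refl l l1)
  have d': "(a * (b - a) * b) ^ 2 = d" by (simp add: d power2_eq_square algebra_simps)
  have e1: "((b * l) ^ 2 - (b * l) * b + b ^ 2) ^ 3 * d = (b ^ 2) ^ 3 * ((l ^ 2 - l + 1) ^ 3 * d)"
  proof -
    have "(b * l) ^ 2 - (b * l) * b + b ^ 2 = b ^ 2 * (l ^ 2 - l + 1)"
      by (simp add: power2_eq_square algebra_simps)
    then show ?thesis by (simp only: power_mult_distrib mult.assoc)
  qed
  have e2: "m * ((b * l) * (b * (1 - l)) * b) ^ 2 = (b ^ 2) ^ 3 * (m * (l * (1 - l)) ^ 2)"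
    by (simp add: power2_eq_square power3_eq_cube algebra_simps)
  have "[(b ^ 2) ^ 3 * ((l ^ 2 - l + 1) ^ 3 * d) = (b ^ 2) ^ 3 * (m * (l * (1 - l)) ^ 2)] (mod int p)"
    using cong_trans[OF h1 cong_sym[OF h2[unfolded d']]] by (simp only: e1 e2)
  moreover have "\<not> int p dvd (b ^ 2) ^ 3"
    using assms(2) p_dvd_power[of "b ^ 2" 2] p_dvd_power[of b 1] by (simp add: numeral_3_eq_3 numeral_2_eq_2)
  ultimately have "[(l ^ 2 - l + 1) ^ 3 * d = m * (l * (1 - l)) ^ 2] (mod int p)"
    using p_dvd_mult by (simp add: cong_iff_dvd_diff right_diff_distrib[symmetric])
  then show ?thesis using units by (simp add: has_invariant_def l_def)
qed

text \<open>Here \<open>s\<close> and \<open>q\<close> are the sum and the product of \<open>a\<close> and \<open>b\<close>; the invariant only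
  depends on them, which keeps it rational when \<open>a\<close> and \<open>b\<close> are not.\<close>

lemma six_ratios:
  assumes s: "[a + b = s] (mod int p)" and q: "[a * b = q] (mod int p)"
    and units: "\<not> int p dvd s * q * (s ^ 2 - 4 * q) * (2 * s ^ 2 - 9 * q) * (s ^ 2 - 3 * q)"
  obtains A where "A \<subseteq> residues" "card A = 6"
    "\<And>l. l \<in> A \<Longrightarrow> (cubic_sum 1 l) ^ 2 = (cubic_sum a b) ^ 2"
    "\<And>l. l \<in> A \<Longrightarrow> has_invariant ((s ^ 2 - 3 * q) ^ 3) (q ^ 2 * (s ^ 2 - 4 * q)) l"
proof -
  \<comment> \<open>Orbits with fewer than six elements are excluded: \<open>s\<close> and
    \<open>2 * s ^ 2 - 9 * q\<close> rule out the parameters -1, 2 and 1/2, and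
    \<open>s ^ 2 - 3 * q\<close> the roots of l^2 - l + 1. The other factors keep 0,
    \<open>a\<close> and \<open>b\<close> distinct.\<close>
  have units': "\<not> int p dvd s" "\<not> int p dvd q" "\<not> int p dvd s ^ 2 - 4 * q" "\<not> int p dvd 2 * s ^ 2 - 9 * q"
    "\<not> int p dvd s ^ 2 - 3 * q"
    using units by (simp_all add: p_dvd_mult)
  have disc: "[(a - b) ^ 2 = s ^ 2 - 4 * q] (mod int p)"
  proof -
    have "(a - b) ^ 2 = (a + b) ^ 2 - 4 * (a * b)" by (simp add: power2_eq_square algebra_simps)
    then show ?thesis using cong_diff[OF cong_pow[OF s] cong_mult[OF cong_refl q]] by simp
  qed
  have halves: "[- ((2 * a - b) * (2 * b - a)) = 2 * s ^ 2 - 9 * q] (mod int p)"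
  proof -
    have "- ((2 * a - b) * (2 * b - a)) = 2 * (a + b) ^ 2 - 9 * (a * b)" by (simp add: power2_eq_square algebra_simps)
    then show ?thesis using cong_diff[OF cong_mult[OF cong_refl cong_pow[OF s]] cong_mult[OF cong_refl q]] by simp
  qed
  define k where "k = a ^ 2 - a * b + b ^ 2"
  have k: "[k = s ^ 2 - 3 * q] (mod int p)"
  proof -
    have "k = (a + b) ^ 2 - 3 * (a * b)" by (simp add: k_def power2_eq_square algebra_simps)
    then show ?thesis using cong_diff[OF cong_pow[OF s] cong_mult[OF cong_refl q]] by simp
  qed
  have ab: "\<not> int p dvd a" "\<not> int p dvd b" using cong_dvd_iff[OF q] units' by (auto simp: p_dvd_mult)
  have sum: "\<not> int p dvd a + b" using cong_dvd_iff[OF s] units' by simp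
  have diff: "\<not> int p dvd a - b" using cong_dvd_iff[OF disc] units' p_dvd_power[of "a - b" 1] by (simp add: numeral_2_eq_2)
  then have diff': "\<not> int p dvd b - a" by (metis dvd_minus_iff minus_diff_eq)
  have twice: "\<not> int p dvd 2 * a - b" "\<not> int p dvd 2 * b - a"
    using cong_dvd_iff[OF halves] units' by (auto simp: p_dvd_mult)
  have kk: "\<not> int p dvd k" using cong_dvd_iff[OF k] units' by simp
  note all = ab sum diff diff' twice kk
  \<comment> \<open>Each pair arises by translating one of the three roots to 0 and ordering the
    other two. With l = a / b the ratios are l, 1 / l, l / (l - 1), 1 - 1 / l, 1 / (1 - l), 1 -
    l.\<close>
  define P where "P = [(a, b), (b, a), (- a, b - a), (b - a, - a), (- b, a - b), (a - b, - b)]"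
  define good where "good x y \<longleftrightarrow> \<not> int p dvd x \<and> \<not> int p dvd y \<and> \<not> int p dvd x - y \<and>
      x ^ 2 - x * y + y ^ 2 = k \<and> (x * y * (x - y)) ^ 2 = (a * b * (a - b)) ^ 2 \<and> cubic_sum x y = cubic_sum a b" for x y
  have cubic: "cubic_sum b a = cubic_sum a b"
    "cubic_sum (- a) (b - a) = cubic_sum a b" "cubic_sum (- b) (a - b) = cubic_sum a b"
    "cubic_sum (b - a) (- a) = cubic_sum a b" "cubic_sum (a - b) (- b) = cubic_sum a b"
    using cubic_sum_shift[of a b] cubic_sum_shift[of b a] by (simp_all add: cubic_sum_commute)
  have "good a b" "good b a" "good (- a) (b - a)" "good (b - a) (- a)" "good (- b) (a - b)" "good (a - b) (- b)"
    unfolding good_def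
    by ((intro conjI, (simp_all only: cubic)?, (simp_all add: all)?,
        (simp_all add: k_def power2_eq_square algebra_simps)?)[1])+
  then have good: "good x y" if "(x, y) \<in> set P" for x y
    using that by (auto simp: P_def)
  have neq: "ratio x y \<noteq> ratio z w"
    if "(x, y) \<in> set P" "(z, w) \<in> set P" "x * w - z * y = u" "\<not> int p dvd u" for x y z w u
    using ratio_neq[of y w x z] good[of x y] good[of z w] that by (simp add: good_def)
  define R where "R = map (\<lambda>(x, y). ratio x y) P"
   \<comment> \<open>Each cross difference \<open>x * w - z * y\<close> factors, up to sign, into
     the quantities listed in \<open>all\<close>.\<close>
   have "ratio (a) (b) \<noteq> ratio (b) (a)"
    by (rule neq[where u = "(a - b) * (a + b)"], simp add: P_def, simp add: P_def,
        simp add: k_def power2_eq_square algebra_simps, simp add: p_dvd_mult all)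
  moreover have "ratio (a) (b) \<noteq> ratio (- a) (b - a)"
    by (rule neq[where u = "a * (2 * b - a)"], simp add: P_def, simp add: P_def,
        simp add: k_def power2_eq_square algebra_simps, simp add: p_dvd_mult all)
  moreover have "ratio (a) (b) \<noteq> ratio (b - a) (- a)"
    by (rule neq[where u = "- k"], simp add: P_def, simp add: P_def,
        simp add: k_def power2_eq_square algebra_simps, simp add: p_dvd_mult all)
  moreover have "ratio (a) (b) \<noteq> ratio (- b) (a - b)"
    by (rule neq[where u = "k"], simp add: P_def, simp add: P_def,
        simp add: k_def power2_eq_square algebra_simps, simp add: p_dvd_mult all)
  moreover have "ratio (a) (b) \<noteq> ratio (a - b) (- b)"
    by (rule neq[where u = "- (b * (2 * a - b))"], simp add: P_def, simp add: P_def,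
        simp add: k_def power2_eq_square algebra_simps, simp add: p_dvd_mult all)
  moreover have "ratio (b) (a) \<noteq> ratio (- a) (b - a)"
    by (rule neq[where u = "k"], simp add: P_def, simp add: P_def,
        simp add: k_def power2_eq_square algebra_simps, simp add: p_dvd_mult all)
  moreover have "ratio (b) (a) \<noteq> ratio (b - a) (- a)"
    by (rule neq[where u = "- (a * (2 * b - a))"], simp add: P_def, simp add: P_def,
        simp add: k_def power2_eq_square algebra_simps, simp add: p_dvd_mult all)
  moreover have "ratio (b) (a) \<noteq> ratio (- b) (a - b)"
    by (rule neq[where u = "b * (2 * a - b)"], simp add: P_def, simp add: P_def,
        simp add: k_def power2_eq_square algebra_simps, simp add: p_dvd_mult all)
  moreover have "ratio (b) (a) \<noteq> ratio (a - b) (- b)"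
    by (rule neq[where u = "- k"], simp add: P_def, simp add: P_def,
        simp add: k_def power2_eq_square algebra_simps, simp add: p_dvd_mult all)
  moreover have "ratio (- a) (b - a) \<noteq> ratio (b - a) (- a)"
    by (rule neq[where u = "b * (2 * a - b)"], simp add: P_def, simp add: P_def,
        simp add: k_def power2_eq_square algebra_simps, simp add: p_dvd_mult all)
  moreover have "ratio (- a) (b - a) \<noteq> ratio (- b) (a - b)"
    by (rule neq[where u = "(b - a) * (a + b)"], simp add: P_def, simp add: P_def,
        simp add: k_def power2_eq_square algebra_simps, simp add: p_dvd_mult all)
  moreover have "ratio (- a) (b - a) \<noteq> ratio (a - b) (- b)"
    by (rule neq[where u = "k"], simp add: P_def, simp add: P_def,
        simp add: k_def power2_eq_square algebra_simps, simp add: p_dvd_mult all)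
  moreover have "ratio (b - a) (- a) \<noteq> ratio (- b) (a - b)"
    by (rule neq[where u = "- k"], simp add: P_def, simp add: P_def,
        simp add: k_def power2_eq_square algebra_simps, simp add: p_dvd_mult all)
  moreover have "ratio (b - a) (- a) \<noteq> ratio (a - b) (- b)"
    by (rule neq[where u = "(a - b) * (a + b)"], simp add: P_def, simp add: P_def,
        simp add: k_def power2_eq_square algebra_simps, simp add: p_dvd_mult all)
  moreover have "ratio (- b) (a - b) \<noteq> ratio (a - b) (- b)"
    by (rule neq[where u = "a * (2 * b - a)"], simp add: P_def, simp add: P_def,
        simp add: k_def power2_eq_square algebra_simps, simp add: p_dvd_mult all)
  ultimately have "distinct R" by (simp add: R_def P_def)
  then have card: "card (set R) = 6" by (simp add: distinct_card R_def P_def)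
  have D: "[(a * b * (a - b)) ^ 2 = q ^ 2 * (s ^ 2 - 4 * q)] (mod int p)"
    unfolding power_mult_distrib[of "a * b"] by (intro cong_mult cong_pow q disc)
  show ?thesis
  proof (rule that[of "set R"])
    show "set R \<subseteq> residues"
    proof
      fix l assume "l \<in> set R"
      then obtain x y where "l = ratio x y" by (auto simp: R_def)
      then show "l \<in> residues" unfolding ratio_def by (simp only: mod_residue)
    qed
  next
    fix l assume "l \<in> set R"
    then obtain x y where xy: "(x, y) \<in> set P" "l = ratio x y" by (auto simp: R_def)
    show "(cubic_sum 1 l) ^ 2 = (cubic_sum a b) ^ 2"
      using cubic_sum_ratio[of y x] good[OF xy(1)] xy(2) by (simp add: good_def)
    have "has_invariant (k ^ 3) ((a * b * (a - b)) ^ 2) l"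
      unfolding xy(2) using good[OF xy(1)] by (intro has_invariant_ratio) (simp_all add: good_def)
    moreover have "[(s ^ 2 - 3 * q) ^ 3 * (l * (1 - l)) ^ 2 = k ^ 3 * (l * (1 - l)) ^ 2] (mod int p)"
      by (intro cong_mult cong_pow cong_sym[OF k] cong_refl)
    moreover have "[(l ^ 2 - l + 1) ^ 3 * (q ^ 2 * (s ^ 2 - 4 * q)) = (l ^ 2 - l + 1) ^ 3 * (a * b * (a - b)) ^ 2] (mod int p)"
      by (intro cong_mult cong_sym[OF D] cong_refl)
    ultimately show "has_invariant ((s ^ 2 - 3 * q) ^ 3) (q ^ 2 * (s ^ 2 - 4 * q)) l"
      unfolding has_invariant_def using cong_trans cong_sym by blast
  qed (rule card)
qed

end

lemma prime_natI_trial_division: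
  assumes "1 < n" "n < k * k" "list_all (\<lambda>d. \<not> d dvd n) [2..<k]"
  shows "prime (n :: nat)"
proof (rule ccontr)
  have small: "\<not> a dvd n" if "2 \<le> a" "a < k" for a
    using assms(3) that by (simp add: list_all_iff)
  assume "\<not> prime n"
  then obtain a where "a dvd n" "a \<noteq> 1" "a \<noteq> n" using assms(1) by (auto simp: prime_nat_iff)
  then obtain b where b: "n = a * b" by (elim dvdE)
  have "a \<noteq> 0" "b \<noteq> 0" "b \<noteq> 1" using b assms(1) \<open>a \<noteq> n\<close> by (auto intro!: Nat.gr0I)
  then have "2 \<le> a" "2 \<le> b" using \<open>a \<noteq> 1\<close> by auto
  moreover have "a < k \<or> b < k" using b assms(2) mult_le_mono[of k a k b] by fastforce
  ultimately show False using small[of a] small[of b] b by auto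
qed

lemma small_primes: "\<forall>q\<in>{2, 3, 5, 7, 11, 13, 17, 19, 23, 43, 47, 59, 67, 73, 113, 131, 257, 283, 337, 1033, 3673}. prime (q :: nat)"
proof -
  have "prime (2 :: nat)" by simp
  moreover have "prime (3 :: nat)" by simp
  moreover have "prime (5 :: nat)" by (rule prime_natI_trial_division[of _ 3]) simp_all
  moreover have "prime (7 :: nat)" by (rule prime_natI_trial_division[of _ 3]) simp_all
  moreover have "prime (11 :: nat)" by (rule prime_natI_trial_division[of _ 4]) simp_all
  moreover have "prime (13 :: nat)" by (rule prime_natI_trial_division[of _ 4]) simp_all
  moreover have "prime (17 :: nat)" by (rule prime_natI_trial_division[of _ 5]) simp_all
  moreover have "prime (19 :: nat)" by (rule prime_natI_trial_division[of _ 5]) simp_all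
  moreover have "prime (23 :: nat)" by (rule prime_natI_trial_division[of _ 5]) simp_all
  moreover have "prime (43 :: nat)" by (rule prime_natI_trial_division[of _ 7]) simp_all
  moreover have "prime (47 :: nat)" by (rule prime_natI_trial_division[of _ 7]) simp_all
  moreover have "prime (59 :: nat)" by (rule prime_natI_trial_division[of _ 8]) simp_all
  moreover have "prime (67 :: nat)" by (rule prime_natI_trial_division[of _ 9]) simp_all
  moreover have "prime (73 :: nat)" by (rule prime_natI_trial_division[of _ 9]) simp_all
  moreover have "prime (113 :: nat)" by (rule prime_natI_trial_division[of _ 11]) simp_all
  moreover have "prime (131 :: nat)" by (rule prime_natI_trial_division[of _ 12]) simp_all
  moreover have "prime (257 :: nat)" by (rule prime_natI_trial_division[of _ 17]) simp_all
  moreover have "prime (283 :: nat)" by (rule prime_natI_trial_division[of _ 17]) simp_all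
  moreover have "prime (337 :: nat)" by (rule prime_natI_trial_division[of _ 19]) simp_all
  moreover have "prime (1033 :: nat)" by (rule prime_natI_trial_division[of _ 33]) simp_all
  moreover have "prime (3673 :: nat)" by (rule prime_natI_trial_division[of _ 61]) simp_all
  ultimately show ?thesis by (simp only: ball_simps simp_thms)
qed

context quadratic_character
begin

text \<open>The excluded primes are those for which two of the five orbits could meet or have fewer than six
  elements: the prime factors of the numbers that are factored in the proof.\<close>

lemma isolated_triple_ex:
  assumes m2: "\<chi> (- 2) = 1"
    and p: "p \<notin> {2, 3, 5, 7, 11, 13, 17, 19, 23, 43, 47, 59, 67, 73, 113, 131, 257, 283, 337, 1033, 3673}"
    (is "_ \<notin> ?B")
  shows "\<exists>x e. \<not> int p dvd e \<and> isolated_triple x e"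
proof (rule ccontr)
  assume "\<nexists>x e. \<not> int p dvd e \<and> isolated_triple x e"
  then have no: "\<And>x e. \<not> int p dvd e \<Longrightarrow> \<not> isolated_triple x e" by blast
  have "\<forall>q\<in>?B. \<not> int p dvd int q"
  proof
    fix q assume q: "q \<in> ?B"
    have "prime q" using small_primes q by (rule bspec)
    moreover have "q \<noteq> p" using p q by blast
    ultimately show "\<not> int p dvd int q" using primes_dvd_imp_eq[OF p_prime] by auto
  qed
  note small = this[simplified ball_simps of_nat_numeral]
  note d2 = small[THEN conjunct1] and d3 = small[THEN conjunct2, THEN conjunct1]
  have "QuadRes (int p) (- 2)" using m2 by (simp add: Legendre_def split: if_splits)
  then obtain r where r: "[r ^ 2 = - 2] (mod int p)" by (auto simp: QuadRes_def)
  txt \<open>The curves for \<open>(\<alpha>, \<beta>)\<close> and \<open>(\<gamma>, \<delta>)\<close> have the same number of points as those for \<open>(1, 9)\<close> and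
    \<open>(1, 3)\<close> by an isogeny.\<close>
  define \<alpha> where "\<alpha> = - 7 + 4 * r"
  define \<beta> where "\<beta> = - 7 - 4 * r"
  define \<gamma> where "\<gamma> = - 1 + 2 * r"
  define \<delta> where "\<delta> = - 1 - 2 * r"
  have \<alpha>\<beta>: "[\<alpha> + \<beta> = - 14] (mod int p)" "[\<alpha> * \<beta> = 81] (mod int p)"
  proof -
    have "\<alpha> * \<beta> = 49 - 16 * r ^ 2" by (simp add: \<alpha>_def \<beta>_def power2_eq_square algebra_simps)
    then show "[\<alpha> * \<beta> = 81] (mod int p)" using cong_diff[OF cong_refl cong_mult[OF cong_refl r], of 49 16] by simp
  qed (simp add: \<alpha>_def \<beta>_def)
  have \<gamma>\<delta>: "[\<gamma> + \<delta> = - 2] (mod int p)" "[\<gamma> * \<delta> = 9] (mod int p)"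
  proof -
    have "\<gamma> * \<delta> = 1 - 4 * r ^ 2" by (simp add: \<gamma>_def \<delta>_def power2_eq_square algebra_simps)
    then show "[\<gamma> * \<delta> = 9] (mod int p)" using cong_diff[OF cong_refl cong_mult[OF cong_refl r], of 1 4] by simp
  qed (simp add: \<gamma>_def \<delta>_def)
  have "\<not> int p dvd 2 * 2 * 2" by (simp only: p_dvd_mult small simp_thms)
  then have "cubic_sum (- 1) 8 = cubic_sum \<alpha> \<beta>"
    by (intro cubic_sum_isogeny) (use \<alpha>\<beta> in simp_all)
  then have curve\<alpha>: "cubic_sum \<alpha> \<beta> = cubic_sum 1 9" using cubic_sum_shift[of 1 9] by simp
  have "cubic_sum (- 1) 2 = cubic_sum \<gamma> \<delta>"
    by (intro cubic_sum_isogeny) (use \<gamma>\<delta> d2 in simp_all)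
  then have curve\<gamma>: "cubic_sum \<gamma> \<delta> = cubic_sum 1 3" using cubic_sum_shift[of 1 3] by simp
  have curve4: "(cubic_sum 1 4) ^ 2 = (cubic_sum 1 9) ^ 2"
    using cubic_sum_1_4[OF d3] chi_sq_eq[of "- 1"] not_p_dvd_1_2 by (simp add: power_mult_distrib power2_eq_square)
  \<comment> \<open>Up to sign, the product is the number required in \<open>six_ratios\<close> for
    the sum 10 and the product 9; 389017 is 73^3 and 5184 is 9^2 * 64. The next four cases follow
    the same scheme.\<close>
  have "\<not> int p dvd 2 * 2 * 2 * 2 * 2 * 2 * 2 * 3 * 3 * 5 * 7 * 17 * 73" by (simp only: p_dvd_mult small simp_thms)
  then obtain A where A: "A \<subseteq> residues" "card A = 6"
    "\<And>l. l \<in> A \<Longrightarrow> (cubic_sum 1 l) ^ 2 = (cubic_sum (1) (9)) ^ 2"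
    "\<And>l. l \<in> A \<Longrightarrow> has_invariant (389017) (5184) l"
    using six_ratios[of "1" "9" "10" "9"] by auto
  have "\<not> int p dvd 2 * 2 * 2 * 3 * 3 * 5 * 7 * 13" by (simp only: p_dvd_mult small simp_thms)
  then obtain B where B: "B \<subseteq> residues" "card B = 6"
    "\<And>l. l \<in> B \<Longrightarrow> (cubic_sum 1 l) ^ 2 = (cubic_sum (1) (4)) ^ 2"
    "\<And>l. l \<in> B \<Longrightarrow> has_invariant (2197) (144) l"
    using six_ratios[of "1" "4" "5" "4"] by auto
  have "\<not> int p dvd 2 * 2 * 2 * 2 * 3 * 5 * 7" by (simp only: p_dvd_mult small simp_thms)
  then obtain C where C: "C \<subseteq> residues" "card C = 6"
    "\<And>l. l \<in> C \<Longrightarrow> (cubic_sum 1 l) ^ 2 = (cubic_sum (1) (3)) ^ 2"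
    "\<And>l. l \<in> C \<Longrightarrow> has_invariant (343) (36) l"
    using six_ratios[of "1" "3" "4" "3"] by auto
  have "\<not> int p dvd 2 * 2 * 2 * 2 * 2 * 2 * 2 * 2 * 3 * 3 * 3 * 3 * 7 * 47 * 337" by (simp only: p_dvd_mult small simp_thms)
  then obtain D where D: "D \<subseteq> residues" "card D = 6"
    "\<And>l. l \<in> D \<Longrightarrow> (cubic_sum 1 l) ^ 2 = (cubic_sum (\<alpha>) (\<beta>)) ^ 2"
    "\<And>l. l \<in> D \<Longrightarrow> has_invariant (-103823) (-839808) l"
    using six_ratios[of "\<alpha>" "\<beta>" "- 14" "81"] \<alpha>\<beta> by auto
  have "\<not> int p dvd 2 * 2 * 2 * 2 * 2 * 2 * 3 * 3 * 23 * 73" by (simp only: p_dvd_mult small simp_thms)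
  then obtain E where E: "E \<subseteq> residues" "card E = 6"
    "\<And>l. l \<in> E \<Longrightarrow> (cubic_sum 1 l) ^ 2 = (cubic_sum (\<gamma>) (\<delta>)) ^ 2"
    "\<And>l. l \<in> E \<Longrightarrow> has_invariant (-12167) (-2592) l"
    using six_ratios[of "\<gamma>" "\<delta>" "- 2" "9"] \<gamma>\<delta> by auto
  \<comment> \<open>The factorisation, up to sign, of \<open>m * d' - m' * d\<close> for the
    invariants of the two orbits, as in \<open>has_invariant_unique\<close>.\<close>
  have "\<not> int p dvd 2 * 2 * 2 * 2 * 3 * 3 * 5 * 5 * 7 * 7 * 11 * 23" by (simp only: p_dvd_mult small simp_thms)
  then have AB: "A \<inter> B = {}"
    using has_invariant_unique[OF A(4) B(4)] by fastforce
  have "\<not> int p dvd 2 * 2 * 3 * 3 * 5 * 5 * 5 * 11 * 13 * 19" by (simp only: p_dvd_mult small simp_thms)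
  then have AC: "A \<inter> C = {}"
    using has_invariant_unique[OF A(4) C(4)] by fastforce
  have "\<not> int p dvd 2 * 2 * 2 * 2 * 2 * 2 * 3 * 3 * 3 * 3 * 7 * 7 * 11 * 113 * 1033" by (simp only: p_dvd_mult small simp_thms)
  then have AD: "A \<inter> D = {}"
    using has_invariant_unique[OF A(4) D(4)] by fastforce
  have "\<not> int p dvd 2 * 2 * 2 * 2 * 2 * 3 * 3 * 3 * 3 * 3 * 11 * 43 * 257" by (simp only: p_dvd_mult small simp_thms)
  then have AE: "A \<inter> E = {}"
    using has_invariant_unique[OF A(4) E(4)] by fastforce
  have "\<not> int p dvd 2 * 2 * 3 * 3 * 3 * 5 * 5 * 11" by (simp only: p_dvd_mult small simp_thms)
  then have BC: "B \<inter> C = {}"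
    using has_invariant_unique[OF B(4) C(4)] by fastforce
  have "\<not> int p dvd 2 * 2 * 2 * 2 * 3 * 3 * 7 * 7 * 11 * 17 * 19 * 73" by (simp only: p_dvd_mult small simp_thms)
  then have BD: "B \<inter> D = {}"
    using has_invariant_unique[OF B(4) D(4)] by fastforce
  have "\<not> int p dvd 2 * 2 * 2 * 2 * 3 * 3 * 11 * 19 * 131" by (simp only: p_dvd_mult small simp_thms)
  then have BE: "B \<inter> E = {}"
    using has_invariant_unique[OF B(4) E(4)] by fastforce
  have "\<not> int p dvd 2 * 2 * 3 * 3 * 11 * 43 * 59 * 283" by (simp only: p_dvd_mult small simp_thms)
  then have CD: "C \<inter> D = {}"
    using has_invariant_unique[OF C(4) D(4)] by fastforce
  have "\<not> int p dvd 2 * 2 * 3 * 3 * 11 * 17 * 67" by (simp only: p_dvd_mult small simp_thms)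
  then have CE: "C \<inter> E = {}"
    using has_invariant_unique[OF C(4) E(4)] by fastforce
  have "\<not> int p dvd 2 * 2 * 2 * 2 * 2 * 3 * 3 * 3 * 3 * 5 * 11 * 19 * 3673" by (simp only: p_dvd_mult small simp_thms)
  then have DE: "D \<inter> E = {}"
    using has_invariant_unique[OF D(4) E(4)] by fastforce
  define t where "t = cubic_sum 1 9"
  define u where "u = cubic_sum 1 3"
  let ?F = "\<lambda>l. (cubic_sum 1 l) ^ 2"
  have fin: "finite A" "finite B" "finite C" "finite D" "finite E"
    using A(2) B(2) C(2) D(2) E(2) by (auto intro: card_ge_0_finite)
  have sums: "sum ?F A = 6 * t ^ 2" "sum ?F B = 6 * t ^ 2" "sum ?F C = 6 * u ^ 2" "sum ?F D = 6 * t ^ 2" "sum ?F E = 6 * u ^ 2"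
    using A(2,3) B(2,3) C(2,3) D(2,3) E(2,3) curve4 curve\<alpha> curve\<gamma> by (simp_all add: t_def u_def)
  have "18 * t ^ 2 + 12 * u ^ 2 = sum ?F A + (sum ?F B + (sum ?F C + (sum ?F D + sum ?F E)))"
    by (simp add: sums)
  also have "\<dots> = sum ?F (A \<union> (B \<union> (C \<union> (D \<union> E))))"
    by (subst sum.union_disjoint, use fin AB AC AD AE BC BD BE CD CE DE in \<open>auto\<close>)+
  also have "\<dots> \<le> sum ?F residues"
    by (rule sum_mono2) (use A(1) B(1) C(1) D(1) E(1) in auto)
  also have "\<dots> = int p ^ 2 - 2 * int p - 1" by (rule cubic_sum_second_moment)
  finally have moment: "18 * t ^ 2 + 12 * u ^ 2 \<le> int p ^ 2 - 2 * int p - 1" .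
  have eq: "int p + 1 = (2 - \<chi> (- 1)) * t - 2 * u"
    unfolding t_def u_def by (rule cubic_sums_no_isolated_triple[OF d3 m2 no])
  have "\<chi> (- 1) = 1 \<or> \<chi> (- 1) = - 1" using chi_cases[of "- 1"] chi_eq_0_iff[of "- 1"] not_p_dvd_1_2 by simp
  \<comment> \<open>Cauchy-Schwarz in explicit form: in either case the difference of the two sides
    is a sum of squares with positive weights.\<close>
  then have "(int p + 1) ^ 2 \<le> 18 * t ^ 2 + 12 * u ^ 2"
  proof
    assume "\<chi> (- 1) = 1"
    then have "18 * t ^ 2 + 12 * u ^ 2 - (int p + 1) ^ 2 = 13 * t ^ 2 + (2 * t + u) ^ 2 + 7 * u ^ 2"
      unfolding eq by (simp add: power2_eq_square algebra_simps)
    moreover have "0 \<le> 13 * t ^ 2 + (2 * t + u) ^ 2 + 7 * u ^ 2" by simp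
    ultimately show ?thesis by linarith
  next
    assume "\<chi> (- 1) = - 1"
    then have "18 * t ^ 2 + 12 * u ^ 2 - (int p + 1) ^ 2 = (3 * t + 2 * u) ^ 2 + 4 * u ^ 2"
      unfolding eq by (simp add: power2_eq_square algebra_simps)
    moreover have "0 \<le> (3 * t + 2 * u) ^ 2 + 4 * u ^ 2" by simp
    ultimately show ?thesis by linarith
  qed
  also note moment
  finally show False by (simp add: power2_eq_square algebra_simps)
qed

section \<open>Existence of the squares\<close>

text \<open>Gauss's lemma for the positive representative \<open>p - 2\<close>: the multiple by
  \<open>x\<close> reduces to \<open>p - 2 * x\<close>, which exceeds \<open>h\<close> exactly for
  \<open>x\<close> up to \<open>2 * k\<close>. The number of such \<open>x\<close> is even.\<close>

lemma chi_minus_2: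
  assumes "p mod 8 = 1 \<or> p mod 8 = 3"
  shows "\<chi> (- 2) = 1"
proof -
  interpret GAUSS p "int p - 2"
  proof
    show "[int p - 2 \<noteq> 0] (mod int p)"
      using not_p_dvd_1_2 dvd_diff[of "int p" "int p" "int p - 2"] by (auto simp: cong_0_iff)
  qed (use p_prime p_gt_2 in auto)
  define k where "k = p div 8"
  define h where "h = (int p - 1) div 2"
  have "p = 8 * k + 1 \<or> p = 8 * k + 3" using assms div_mult_mod_eq[of p 8] unfolding k_def by linarith
  then have h: "h = 4 * int k \<or> h = 4 * int k + 1" "int p = 2 * h + 1" by (auto simp: h_def)
  have mod: "(x * (int p - 2)) mod int p = int p - 2 * x" if "x \<in> A" for x
  proof -
    have "x * (int p - 2) = (int p - 2 * x) + int p * (x - 1)" by (simp add: algebra_simps)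
    then have "(x * (int p - 2)) mod int p = (int p - 2 * x) mod int p" by (simp only: mod_mult_self2)
    also have "\<dots> = int p - 2 * x"
      by (rule mod_pos_pos_trivial) (use that h in \<open>auto simp: A_def h_def[symmetric]\<close>)
    finally show ?thesis .
  qed
  have "C = (\<lambda>x. int p - 2 * x) ` A" by (simp add: C_def B_def image_image mod)
  then have "E = (\<lambda>x. int p - 2 * x) ` A \<inter> {h<..}" by (simp only: E_def h_def)
  also have "\<dots> = (\<lambda>x. int p - 2 * x) ` {0<..2 * int k}"
    using h by (auto simp: A_def)
  finally have "card E = card ((\<lambda>x. int p - 2 * x) ` {0<..2 * int k})" by (rule arg_cong)
  also have "\<dots> = 2 * k" by (subst card_image) (auto intro: inj_onI)
  finally have "card E = 2 * k" .
  then have "\<chi> (int p - 2) = 1" using gauss_lemma by simp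
  then show ?thesis using chi_cong[of "int p - 2" "- 2"] by (simp add: cong_iff_dvd_diff)
qed

lemma chi_eqI:
  assumes "mod_exp a ((p - 1) div 2) p = s" and "s = 1 \<or> s = p - 1"
  shows "\<chi> (int a) = (if s = 1 then 1 else - 1)"
proof -
  define t :: int where "t = (if s = 1 then 1 else - 1)"
  have "[int a ^ ((p - 1) div 2) = int (a ^ ((p - 1) div 2) mod p)] (mod int p)"
    by (simp add: zmod_int)
  also have "a ^ ((p - 1) div 2) mod p = s" using assms(1) by (simp add: mod_exp_def)
  also have "[int s = t] (mod int p)" using assms(2) p_gt_2 by (auto simp: t_def cong_iff_dvd_diff of_nat_diff)
  finally have "[int a ^ ((p - 1) div 2) = t] (mod int p)" .
  then have "[\<chi> (int a) = t] (mod int p)"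
    using euler_criterion[OF p_prime, of "int a"] p_gt_2 cong_trans by simp
  then have "int p dvd \<chi> (int a) - t" by (simp add: cong_iff_dvd_diff)
  moreover have "\<bar>\<chi> (int a) - t\<bar> < int p" using chi_cases[of "int a"] p_gt_2 by (auto simp: t_def)
  ultimately have "\<chi> (int a) - t = 0"
    using dvd_imp_le_int[of "\<chi> (int a) - t" "int p"] by force
  then show ?thesis by (simp add: t_def)
qed

lemma isolated_tripleI:
  assumes "2 * e \<le> x"
    and "list_all (\<lambda>a. mod_exp a ((p - 1) div 2) p = 1) [x - e, x, x + e]"
    and "list_all (\<lambda>a. mod_exp a ((p - 1) div 2) p = p - 1) [x - 2 * e, x + 2 * e]"
  shows "isolated_triple (int x) (int e)"
  using assms chi_eqI[of "x - e" 1] chi_eqI[of x 1] chi_eqI[of "x + e" 1]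
    chi_eqI[of "x - 2 * e" "p - 1"] chi_eqI[of "x + 2 * e" "p - 1"] p_gt_2
  by (simp add: isolated_triple_def of_nat_diff)

lemma isolated_triple_ex_small:
  assumes "p mod 8 = 1 \<or> p mod 8 = 3" "p \<noteq> 3" "p \<noteq> 19"
    and "p \<in> {2, 3, 5, 7, 11, 13, 17, 19, 23, 43, 47, 59, 67, 73, 113, 131, 257, 283, 337, 1033, 3673}"
  shows "\<exists>x e. \<not> int p dvd e \<and> isolated_triple x e"
proof -
  have ex: ?thesis if "0 < e" "e < p" "isolated_triple (int x) (int e)" for x e :: nat
    using that zdvd_imp_le[of "int p" "int e"] by (intro exI[of _ "int x"] exI[of _ "int e"]) auto
  consider "p = 11" | "p = 17" | "p = 43" | "p = 59" | "p = 67" | "p = 73" | "p = 113" | "p = 131" | "p = 257" | "p = 283" | "p = 337" | "p = 1033" | "p = 3673"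
    using assms by auto
  then show ?thesis
  proof cases
    case 1
    \<comment> \<open>The centre \<open>p + 1\<close> stands for 1. This loses nothing, as dividing
      a triple by its centre, where \<open>\<chi>\<close> is 1, preserves the pattern; the added
      \<open>p\<close> keeps \<open>x - 2 * e\<close> a natural number.\<close>
    show ?thesis by (rule ex[OF _ _ isolated_tripleI[of 3 12]]) (simp_all add: 1)
  next
    case 2
    show ?thesis by (rule ex[OF _ _ isolated_tripleI[of 3 18]]) (simp_all add: 2)
  next
    case 3
    show ?thesis by (rule ex[OF _ _ isolated_tripleI[of 9 44]]) (simp_all add: 3)
  next
    case 4
    show ?thesis by (rule ex[OF _ _ isolated_tripleI[of 11 60]]) (simp_all add: 4)
  next
    case 5
    show ?thesis by (rule ex[OF _ _ isolated_tripleI[of 13 68]]) (simp_all add: 5)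
  next
    case 6
    show ?thesis by (rule ex[OF _ _ isolated_tripleI[of 3 74]]) (simp_all add: 6)
  next
    case 7
    show ?thesis by (rule ex[OF _ _ isolated_tripleI[of 10 114]]) (simp_all add: 7)
  next
    case 8
    show ?thesis by (rule ex[OF _ _ isolated_tripleI[of 11 132]]) (simp_all add: 8)
  next
    case 9
    show ?thesis by (rule ex[OF _ _ isolated_tripleI[of 3 258]]) (simp_all add: 9)
  next
    case 10
    show ?thesis by (rule ex[OF _ _ isolated_tripleI[of 15 284]]) (simp_all add: 10)
  next
    case 11
    show ?thesis by (rule ex[OF _ _ isolated_tripleI[of 8 338]]) (simp_all add: 11)
  next
    case 12
    show ?thesis by (rule ex[OF _ _ isolated_tripleI[of 7 1034]]) (simp_all add: 12)
  next
    case 13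
    show ?thesis by (rule ex[OF _ _ isolated_tripleI[of 3 3674]]) (simp_all add: 13)
  qed
qed

lemma reflection_square_ex:
  assumes p: "p mod 8 = 1 \<or> p mod 8 = 3" "p \<noteq> 3" "p \<noteq> 19"
  shows "\<exists>L. latin_square {..<p} L \<and> \<nu> {..<p} L = 4"
proof -
  have m2: "\<chi> (- 2) = 1" using p(1) by (rule chi_minus_2)
  obtain x e where e: "\<not> int p dvd e" and xe: "isolated_triple x e"
    using isolated_triple_ex[OF m2] isolated_triple_ex_small[OF p] by blast
  define N where "N z \<longleftrightarrow> \<chi> z = - 1" for z
  define F where "F z = (if N z then 2 * z else - z)" for z
  interpret reflection_square p N F
  proof
    show "prime p" by (rule p_prime)
    show "p > 3" using p(2) p_gt_2 by simp
    show "N z \<longleftrightarrow> N y" if "[z = y] (mod int p)" for z y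
      using chi_cong[OF that] by (simp add: N_def)
    show "N (- 2 * z) \<longleftrightarrow> N z" for z using chi_mult[of "- 2" z] m2 by (simp add: N_def)
    show "\<not> N 0" using chi_eq_0_iff[of 0] by (simp add: N_def)
    show "\<exists>z. N z" using xe by (auto simp: isolated_triple_def N_def)
    show "[F z = (if N z then 2 * z else - z)] (mod int p)" for z by (simp add: F_def)
  qed
  interpret diff_latin p F by (rule diff_latin_F)
  have "\<nu> {..<p} (diff_square p F) = 4"
    by (rule nu_reflection_square_eq_4[of 1 e x])
      (use e xe not_p_dvd_1_2 chi_1 in \<open>auto simp: N_def isolated_triple_def\<close>)
  then show ?thesis using latin_diff_square by blast
qed

end

lemma latin_table19: "latin_square {..<19} (diff_square 19 (table_diff table19))"
proof -
  interpret diff_latin 19 "table_diff table19"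
    by (rule diff_latin_table_diff) (simp_all add: table19_def residues19_def)
  show ?thesis by (rule latin_diff_square)
qed

theorem theorem1p1:
  fixes p :: nat
  assumes "prime p" and "p > 3" and "p mod 8 = 1 \<or> p mod 8 = 3"
  shows "\<exists>(S :: nat set) (L :: nat \<Rightarrow> nat \<Rightarrow> nat).
           card S = p \<and> latin_square S L \<and> \<nu> S L = 4"
proof (cases "p = 19")
  case True
  then show ?thesis
    using latin_table19 nu_table19 by (intro exI[of _ "{..<19}"] exI[of _ "diff_square 19 (table_diff table19)"]) simp
next
  case False
  interpret quadratic_character p using assms(1,2) by unfold_locales simp_all
  show ?thesis
    using reflection_square_ex[OF assms(3)] False assms(2) by (intro exI[of _ "{..<p}"]) simp
qed

end
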